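(* Let $K$ be a nice finite simplicial complex and let $r:X\to Z$ be a simple branched cover of a connected manifold $Z$ with branching set $Z_{\mathrm{Sing}}$. Assume there is a homeomorphism of pairs $\varphi:(Z,Z_{\mathrm{Sing}})\to(|K|,|K_{\mathrm{odd}}|)$, and let $z_0\in Z\setminus Z_{\mathrm{Sing}}$ be such that $y_0=\varphi(z_0)$ is the barycenter of $|\sigma_0|$ for some facet $\sigma_0$ of $K$. If there is a bijection $\iota:r^{-1}(z_0)\to V(\sigma_0)$ whose induced group isomorphism $\iota_*:\mathfrak{M}_r\to\Pi(K,\sigma_0)$ satisfies $\iota_*\circ\mathfrak{m}_r=\mathfrak{h}_K\circ\varphi_*$ as maps $\pi_1(Z\setminus Z_{\mathrm{Sing}},z_0)\to\Pi(K,\sigma_0)$ (where $\varphi_*:\pi_1(Z\setminus Z_{\mathrm{Sing}},z_0)\to\pi_1(|K|\setminus|K_{\mathrm{odd}}|,y_0)$ is induced by $\varphi$), then the branched covers $p:\widehat{K}\to|K|$ and $r:X\to Z$ are equivalent. In particular $\widehat{K}\cong X$.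
   Context: Nice: $K$ is pure, the star of every face is strongly connected (its dual graph, with facets as nodes adjacent when sharing a ridge, is connected), and the link of every face of codimension $\ge2$ is simply connected. Perspectivity $\langle\sigma,\tau\rangle:V(\sigma)\to V(\tau)$ for facets sharing a ridge: identity on common vertices, sends the vertex of $\sigma$ not in $\tau$ to that of $\tau$ not in $\sigma$. Projectivity $\langle\gamma\rangle$ along a facet path $\gamma$ (consecutive facets share a ridge) is the composite of perspectivities; $\Pi(K,\sigma_0)\le\mathrm{Sym}(V(\sigma_0))$ is the group of projectivities along closed facet paths based at $\sigma_0$. $K_{\mathrm{odd}}$: subcomplex of codimension-2 faces whose link graph is not bipartite, with their faces. Partial unfolding $\widehat K$: quotient of copies $(|\sigma|,v)$ ($\sigma$ facet, $v\in\sigma$ vertex), gluing $(|\sigma|,v)$ and $(|\tau|,w)$ along $|\sigma\cap\tau|$ for neighboring facets when $\langle\sigma,\tau\rangle(v)=w$; $p$ maps each copy identically onto $|\sigma|$. For a facet path $\gamma$, $\overline\gamma$ denotes the piecewise linear path in $|K|$ joining successively the barycenters of the facets and of the common ridges; for nice $K$, $\pi_1(|K|\setminus|K_{\mathrm{odd}}|,y_0)$ is generated by the classes $[\overline\gamma]$ of closed facet paths based at $\sigma_0$, and $\mathfrak{h}_K([\overline\gamma])=\langle\gamma\rangle$ is a well-defined homomorphism $\mathfrak{h}_K:\pi_1(|K|\setminus|K_{\mathrm{odd}}|,y_0)\to\Pi(K,\sigma_0)$. For a branched cover $r:X\to Z$ (Fox) with branching set $Z_{\mathrm{Sing}}$ (minimal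 set off whose preimage $r$ is a covering), the monodromy homomorphism $\mathfrak{m}_r:\pi_1(Z\setminus Z_{\mathrm{Sing}},z_0)\to\mathrm{Sym}(r^{-1}(z_0))$ sends $[\alpha]$ to $x_i\mapsto\alpha_i(1)$, with $\alpha_i$ the lift of $\alpha$ starting at $x_i$; $\mathfrak{M}_r$ is its image. $r$ is simple if $Z_{\mathrm{Sing}}$ is a codimension-2 submanifold with finitely many singularities and every meridian loop around a non-singular point of $Z_{\mathrm{Sing}}$ maps to a transposition. Two branched covers $p:X\to Y$, $p':X'\to Y'$ are equivalent if there are homeomorphisms $\Phi:X\to X'$, $\Psi:Y\to Y'$ with $\Psi(Y_{\mathrm{Sing}})=Y'_{\mathrm{Sing}}$ and $p'\circ\Phi=\Psi\circ p$. *)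

theory Defs
  imports "HOL-Analysis.Analysis" "HOL-Algebra.Bij" "HOL-Combinatorics.Transposition"
begin

section \<open>Paths and fundamental groups in abstract topologies\<close>

text \<open>Counterparts, for the type \<^typ>\<open>'a topology\<close>, of \<^const>\<open>joinpaths\<close>,
  \<^const>\<open>reversepath\<close> and \<^const>\<open>homotopic_paths\<close>, which need a type class topology.\<close>

definition concat_paths :: "(real \<Rightarrow> 'a) \<Rightarrow> (real \<Rightarrow> 'a) \<Rightarrow> real \<Rightarrow> 'a" where
  "concat_paths g h = (\<lambda>t. if t \<le> 1/2 then g (2 * t) else h (2 * t - 1))"

definition reverse_path :: "(real \<Rightarrow> 'a) \<Rightarrow> real \<Rightarrow> 'a" where
  "reverse_path g = (\<lambda>t. g (1 - t))"

definition path_homotopic :: "'a topology \<Rightarrow> (real \<Rightarrow> 'a) \<Rightarrow> (real \<Rightarrow> 'a) \<Rightarrow> bool" where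
  "path_homotopic X p q \<longleftrightarrow>
     homotopic_with (\<lambda>g. g 0 = p 0 \<and> g 1 = p 1) (top_of_set {0..1}) X p q"

lemma path_homotopic_iff_homotopic_paths:
  "path_homotopic (top_of_set S) p q \<longleftrightarrow> homotopic_paths S p q"
  by (simp add: path_homotopic_def homotopic_paths_def pathstart_def pathfinish_def)

definition loops :: "'a topology \<Rightarrow> 'a \<Rightarrow> (real \<Rightarrow> 'a) set" where
  "loops X x0 = {\<alpha>. pathin X \<alpha> \<and> \<alpha> 0 = x0 \<and> \<alpha> 1 = x0}"

definition loop_class :: "'a topology \<Rightarrow> 'a \<Rightarrow> (real \<Rightarrow> 'a) \<Rightarrow> (real \<Rightarrow> 'a) set" where
  "loop_class X x0 \<alpha> = {\<beta> \<in> loops X x0. path_homotopic X \<alpha> \<beta>}"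

text \<open>The underlying set of the fundamental group; an element is a whole homotopy class.\<close>

definition fundamental_group :: "'a topology \<Rightarrow> 'a \<Rightarrow> (real \<Rightarrow> 'a) set set" where
  "fundamental_group X x0 = loop_class X x0 ` loops X x0"

definition induced_on_loops ::
    "'b topology \<Rightarrow> 'b \<Rightarrow> ('a \<Rightarrow> 'b) \<Rightarrow> (real \<Rightarrow> 'a) set \<Rightarrow> (real \<Rightarrow> 'b) set" where
  "induced_on_loops Y y0 f c = (\<Union>\<alpha>\<in>c. loop_class Y y0 (f \<circ> \<alpha>))"


section \<open>Branched covers\<close>

definition preimage_in :: "'x topology \<Rightarrow> ('x \<Rightarrow> 'z) \<Rightarrow> 'z set \<Rightarrow> 'x set" where
  "preimage_in X r W = {x \<in> topspace X. r x \<in> W}"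

text \<open>The abstract topology version of \<^const>\<open>covering_space\<close>.\<close>

definition covering_map :: "'x topology \<Rightarrow> 'z topology \<Rightarrow> ('x \<Rightarrow> 'z) \<Rightarrow> bool" where
  "covering_map X Z r \<longleftrightarrow>
     continuous_map X Z r \<and> r ` topspace X = topspace Z \<and>
     (\<forall>z \<in> topspace Z. \<exists>T. openin Z T \<and> z \<in> T \<and>
        (\<exists>\<V>. \<Union>\<V> = preimage_in X r T \<and> (\<forall>U\<in>\<V>. openin X U) \<and> pairwise disjnt \<V> \<and>
             (\<forall>U\<in>\<V>. homeomorphic_map (subtopology X U) (subtopology Z T) r)))"

lemma covering_map_iff_covering_space:
  "covering_map (top_of_set C) (top_of_set S) r \<longleftrightarrow> covering_space C r S"
proof -
  have hom: "homeomorphic_map (subtopology (top_of_set C) U) (subtopology (top_of_set S) T) r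
      \<longleftrightarrow> (\<exists>q. homeomorphism U T r q)"
    if "openin (top_of_set C) U" "openin (top_of_set S) T" for U T
  proof -
    have "C \<inter> U = U" "S \<inter> T = T"
      using that openin_imp_subset by blast+
    then have sub: "subtopology (top_of_set C) U = top_of_set U"
      "subtopology (top_of_set S) T = top_of_set T"
      by (simp_all add: subtopology_subtopology)
    have "homeomorphic_maps (top_of_set U) (top_of_set T) r q \<longleftrightarrow> homeomorphism U T r q" for q
      unfolding homeomorphic_maps_def homeomorphism_def by auto (metis image_eqI PiE)+
    then show ?thesis
      by (simp add: sub homeomorphic_map_maps)
  qed
  have pre: "preimage_in (top_of_set C) r T = C \<inter> r -` T" for T
    by (auto simp: preimage_in_def)
  have cont: "continuous_map (top_of_set C) (top_of_set S) r \<longleftrightarrow> continuous_on C r \<and> r ` C \<subseteq> S"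
    by auto
  have sheets: "(\<Union>\<V> = C \<inter> r -` T \<and> (\<forall>U\<in>\<V>. openin (top_of_set C) U) \<and> pairwise disjnt \<V> \<and>
        (\<forall>U\<in>\<V>. homeomorphic_map (subtopology (top_of_set C) U) (subtopology (top_of_set S) T) r))
      \<longleftrightarrow> (\<Union>\<V> = C \<inter> r -` T \<and> (\<forall>U\<in>\<V>. openin (top_of_set C) U) \<and> pairwise disjnt \<V> \<and>
        (\<forall>U\<in>\<V>. \<exists>q. homeomorphism U T r q))"
    if "openin (top_of_set S) T" for T \<V>
    using hom that by blast
  have evenly: "(\<exists>T. openin (top_of_set S) T \<and> z \<in> T \<and>
      (\<exists>\<V>. \<Union>\<V> = C \<inter> r -` T \<and> (\<forall>U\<in>\<V>. openin (top_of_set C) U) \<and> pairwise disjnt \<V> \<and>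
        (\<forall>U\<in>\<V>. homeomorphic_map (subtopology (top_of_set C) U) (subtopology (top_of_set S) T) r)))
      \<longleftrightarrow> (\<exists>T. z \<in> T \<and> openin (top_of_set S) T \<and>
      (\<exists>\<V>. \<Union>\<V> = C \<inter> r -` T \<and> (\<forall>U\<in>\<V>. openin (top_of_set C) U) \<and> pairwise disjnt \<V> \<and>
        (\<forall>U\<in>\<V>. \<exists>q. homeomorphism U T r q)))" for z
  proof (intro iffI; elim exE conjE)
    fix T \<V>
    assume "openin (top_of_set S) T" "z \<in> T" "\<Union>\<V> = C \<inter> r -` T"
      "\<forall>U\<in>\<V>. openin (top_of_set C) U" "pairwise disjnt \<V>"
      "\<forall>U\<in>\<V>. homeomorphic_map (subtopology (top_of_set C) U) (subtopology (top_of_set S) T) r"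
    then show "\<exists>T. z \<in> T \<and> openin (top_of_set S) T \<and>
      (\<exists>\<V>. \<Union>\<V> = C \<inter> r -` T \<and> (\<forall>U\<in>\<V>. openin (top_of_set C) U) \<and> pairwise disjnt \<V> \<and>
        (\<forall>U\<in>\<V>. \<exists>q. homeomorphism U T r q))"
      using sheets[of T \<V>] by (intro exI[of _ T] exI[of _ \<V>] conjI) simp_all
  next
    fix T \<V>
    assume "openin (top_of_set S) T" "z \<in> T" "\<Union>\<V> = C \<inter> r -` T"
      "\<forall>U\<in>\<V>. openin (top_of_set C) U" "pairwise disjnt \<V>"
      "\<forall>U\<in>\<V>. \<exists>q. homeomorphism U T r q"
    then show "\<exists>T. openin (top_of_set S) T \<and> z \<in> T \<and>
      (\<exists>\<V>. \<Union>\<V> = C \<inter> r -` T \<and> (\<forall>U\<in>\<V>. openin (top_of_set C) U) \<and> pairwise disjnt \<V> \<and>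
        (\<forall>U\<in>\<V>. homeomorphic_map (subtopology (top_of_set C) U) (subtopology (top_of_set S) T) r))"
      using sheets[of T \<V>] by (intro exI[of _ T] exI[of _ \<V>] conjI) simp_all
  qed
  show ?thesis
    unfolding covering_map_def covering_space_def pre evenly cont topspace_euclidean_subtopology
    by (intro iffI conjI; elim conjE; (assumption | simp only: subset_refl))
qed

definition covering_off :: "'x topology \<Rightarrow> 'z topology \<Rightarrow> ('x \<Rightarrow> 'z) \<Rightarrow> 'z set \<Rightarrow> bool" where
  "covering_off X Z r S \<longleftrightarrow>
     covering_map (subtopology X (preimage_in X r (topspace Z - S)))
                  (subtopology Z (topspace Z - S)) r"

text \<open>The least closed set off whose preimage \<open>r\<close> is a covering. Among arbitrary
  (not necessarily closed) sets there is no least one: off the complement of the origin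
  the squaring map of the plane is a one-sheeted covering of a point.\<close>

definition branching_set :: "'x topology \<Rightarrow> 'z topology \<Rightarrow> ('x \<Rightarrow> 'z) \<Rightarrow> 'z set" where
  "branching_set X Z r = \<Inter>{S. closedin Z S \<and> covering_off X Z r S}"

lemma closedin_branching_set: "closedin Z (branching_set X Z r)"
proof -
  have "covering_off X Z r (topspace Z)"
    by (simp add: covering_off_def covering_map_def preimage_in_def)
  then have "{S. closedin Z S \<and> covering_off X Z r S} \<noteq> {}"
    by auto
  then show ?thesis
    unfolding branching_set_def by (rule closedin_Inter) auto
qed

lemma covering_off_branching_set:
  assumes r: "continuous_map X Z r"
  shows "covering_off X Z r (branching_set X Z r)"
proof -
  define B where "B = branching_set X Z r"
  have evenly: "z \<in> r ` topspace X \<and> (\<exists>T. openin Z T \<and> z \<in> T \<and> T \<subseteq> topspace Z - B \<and>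
      (\<exists>\<V>. \<Union>\<V> = preimage_in X r T \<and> (\<forall>U\<in>\<V>. openin X U) \<and> pairwise disjnt \<V> \<and>
         (\<forall>U\<in>\<V>. homeomorphic_map (subtopology X U) (subtopology Z T) r)))"
    if z: "z \<in> topspace Z - B" for z
  proof -
    obtain S where S: "closedin Z S" "covering_off X Z r S" "z \<notin> S"
      using z by (auto simp: B_def branching_set_def)
    define P where "P = preimage_in X r (topspace Z - S)"
    have SB: "B \<subseteq> S"
      using S by (auto simp: B_def branching_set_def)
    have oZ: "openin Z (topspace Z - S)"
      using S(1) by blast
    have oP: "openin X P"
      unfolding P_def preimage_in_def using oZ r openin_continuous_map_preimage by blast
    have PX: "P \<subseteq> topspace X"
      by (auto simp: P_def preimage_in_def)
    have cov: "covering_map (subtopology X P) (subtopology Z (topspace Z - S)) r"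
      using S(2) by (simp add: covering_off_def P_def)
    have zS: "z \<in> topspace (subtopology Z (topspace Z - S))"
      using z S(3) by auto
    then have "z \<in> r ` topspace (subtopology X P)"
      using cov unfolding covering_map_def by blast
    then have z_im: "z \<in> r ` topspace X"
      by auto
    obtain T \<V> where T: "openin (subtopology Z (topspace Z - S)) T" "z \<in> T"
      and V: "\<Union>\<V> = preimage_in (subtopology X P) r T" "pairwise disjnt \<V>"
      and V_open: "\<forall>U\<in>\<V>. openin (subtopology X P) U"
      and V_hom: "\<forall>U\<in>\<V>. homeomorphic_map (subtopology (subtopology X P) U)
                     (subtopology (subtopology Z (topspace Z - S)) T) r"
      using cov zS unfolding covering_map_def by meson
    have T': "openin Z T" "T \<subseteq> topspace Z - S"
      using T(1) oZ openin_open_subtopology by blast+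
    have pre: "preimage_in (subtopology X P) r T = preimage_in X r T"
      using T'(2) by (auto simp: preimage_in_def P_def)
    have U: "openin X U \<and> homeomorphic_map (subtopology X U) (subtopology Z T) r" if "U \<in> \<V>" for U
    proof
      show "openin X U"
        using V_open that oP openin_open_subtopology by blast
      have "U \<subseteq> P"
        using V_open that oP openin_open_subtopology by blast
      then have "P \<inter> U = U" "(topspace Z - S) \<inter> T = T"
        using T'(2) by auto
      then show "homeomorphic_map (subtopology X U) (subtopology Z T) r"
        using bspec[OF V_hom that] by (simp add: subtopology_subtopology)
    qed
    show ?thesis
      using z_im T' T(2) V pre U SB by (intro conjI exI[of _ T] exI[of _ \<V>]) auto
  qed
  define Q where "Q = preimage_in X r (topspace Z - B)"
  have QX: "Q \<subseteq> topspace X"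
    by (auto simp: Q_def preimage_in_def)
  have im: "r ` Q = topspace Z - B"
    using evenly by (force simp: Q_def preimage_in_def)
  have "\<exists>T. openin (subtopology Z (topspace Z - B)) T \<and> z \<in> T \<and>
      (\<exists>\<V>. \<Union>\<V> = preimage_in (subtopology X Q) r T \<and> (\<forall>U\<in>\<V>. openin (subtopology X Q) U) \<and>
         pairwise disjnt \<V> \<and> (\<forall>U\<in>\<V>. homeomorphic_map (subtopology (subtopology X Q) U)
                     (subtopology (subtopology Z (topspace Z - B)) T) r))"
    if z: "z \<in> topspace Z - B" for z
  proof -
    obtain T \<V> where T: "openin Z T" "z \<in> T" "T \<subseteq> topspace Z - B"
      and V: "\<Union>\<V> = preimage_in X r T" "pairwise disjnt \<V>"
      and V': "\<forall>U\<in>\<V>. openin X U" "\<forall>U\<in>\<V>. homeomorphic_map (subtopology X U) (subtopology Z T) r"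
      using evenly[OF z] by meson
    have pre: "preimage_in (subtopology X Q) r T = preimage_in X r T"
      using T(3) by (auto simp: preimage_in_def Q_def)
    have TB: "(topspace Z - B) \<inter> T = T"
      using T(3) by auto
    have U: "U \<subseteq> Q" "Q \<inter> U = U" if "U \<in> \<V>" for U
      using that V(1) T(3) by (auto simp: preimage_in_def Q_def)
    show ?thesis
    proof (intro exI[of _ T] exI[of _ \<V>] conjI ballI)
      show "openin (subtopology Z (topspace Z - B)) T"
        using T(1) TB openin_subtopology_Int2 by metis
      show "z \<in> T" by (rule T(2))
      show "\<Union>\<V> = preimage_in (subtopology X Q) r T" by (simp add: V pre)
      show "pairwise disjnt \<V>" by (rule V(2))
      fix U assume UV: "U \<in> \<V>"
      show "openin (subtopology X Q) U"
        using V'(1) U[OF UV] UV openin_subtopology_Int2 by metis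
      show "homeomorphic_map (subtopology (subtopology X Q) U)
              (subtopology (subtopology Z (topspace Z - B)) T) r"
        using bspec[OF V'(2) UV] U[OF UV] TB by (simp add: subtopology_subtopology)
    qed
  qed
  moreover have "continuous_map (subtopology X Q) (subtopology Z (topspace Z - B)) r"
    using r im by (auto simp: continuous_map_in_subtopology continuous_map_from_subtopology)
  ultimately show ?thesis
    using im QX unfolding covering_off_def covering_map_def B_def[symmetric] Q_def[symmetric]
    by (auto simp: Int_absorb1)
qed

text \<open>Fox's notions, from \<^emph>\<open>Covering spaces with singularities\<close>: spreads, complete spreads,
  subspaces \<open>A\<close> locally connected in \<open>X\<close>, and branched covers as completions of coverings.\<close>

definition spread :: "'x topology \<Rightarrow> 'z topology \<Rightarrow> ('x \<Rightarrow> 'z) \<Rightarrow> bool" where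
  "spread X Z r \<longleftrightarrow>
     locally_connected_space X \<and> t1_space X \<and> locally_connected_space Z \<and> t1_space Z \<and>
     continuous_map X Z r \<and>
     (\<forall>U x. openin X U \<and> x \<in> U \<longrightarrow>
        (\<exists>W. openin Z W \<and> (\<exists>C \<in> connected_components_of (subtopology X (preimage_in X r W)).
               x \<in> C \<and> C \<subseteq> U)))"

definition complete_spread :: "'x topology \<Rightarrow> 'z topology \<Rightarrow> ('x \<Rightarrow> 'z) \<Rightarrow> bool" where
  "complete_spread X Z r \<longleftrightarrow> spread X Z r \<and>
     (\<forall>z \<in> topspace Z. \<forall>C.
        (\<forall>W. openin Z W \<and> z \<in> W \<longrightarrow>
           C W \<in> connected_components_of (subtopology X (preimage_in X r W))) \<and>
        (\<forall>W W'. openin Z W \<and> openin Z W' \<and> z \<in> W \<and> W \<subseteq> W' \<longrightarrow> C W \<subseteq> C W') \<longrightarrow>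
        (\<Inter>W \<in> {W. openin Z W \<and> z \<in> W}. C W) \<noteq> {})"

definition locally_connected_within :: "'x topology \<Rightarrow> 'x set \<Rightarrow> bool" where
  "locally_connected_within X A \<longleftrightarrow>
     (\<forall>U x. openin X U \<and> x \<in> U \<longrightarrow>
        (\<exists>V. openin X V \<and> x \<in> V \<and> V \<subseteq> U \<and> connectedin X (V \<inter> A)))"

text \<open>Neither \<open>X\<close> nor the covering is assumed connected: partial unfoldings are
  disconnected in general.\<close>

definition branched_cover :: "'x topology \<Rightarrow> 'z topology \<Rightarrow> ('x \<Rightarrow> 'z) \<Rightarrow> bool" where
  "branched_cover X Z r \<longleftrightarrow>
     (let Z0 = topspace Z - branching_set X Z r; X0 = preimage_in X r Z0 in
        complete_spread X Z r \<and> r ` topspace X = topspace Z \<and>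
        Abstract_Topology.closure_of Z Z0 = topspace Z \<and> locally_connected_within Z Z0 \<and>
        Abstract_Topology.closure_of X X0 = topspace X \<and> locally_connected_within X X0)"

definition equivalent_branched_covers ::
    "'x topology \<Rightarrow> 'y topology \<Rightarrow> ('x \<Rightarrow> 'y) \<Rightarrow> 'u topology \<Rightarrow> 'v topology \<Rightarrow> ('u \<Rightarrow> 'v) \<Rightarrow> bool"
  where
  "equivalent_branched_covers X Y p X' Y' p' \<longleftrightarrow>
     branched_cover X Y p \<and> branched_cover X' Y' p' \<and>
     (\<exists>\<Phi> \<Psi>. homeomorphic_map X X' \<Phi> \<and> homeomorphic_map Y Y' \<Psi> \<and>
        \<Psi> ` branching_set X Y p = branching_set X' Y' p' \<and>
        (\<forall>x \<in> topspace X. p' (\<Phi> x) = \<Psi> (p x)))"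

abbreviation unbranched_part :: "'x topology \<Rightarrow> 'z topology \<Rightarrow> ('x \<Rightarrow> 'z) \<Rightarrow> 'z topology" where
  "unbranched_part X Z r \<equiv> subtopology Z (topspace Z - branching_set X Z r)"

text \<open>Permutations are extensional functions, as in \<^const>\<open>Bij\<close> and \<^const>\<open>BijGroup\<close>.\<close>

definition monodromy ::
    "'x topology \<Rightarrow> ('x \<Rightarrow> 'z) \<Rightarrow> 'z \<Rightarrow> (real \<Rightarrow> 'z) set \<Rightarrow> 'x \<Rightarrow> 'x" where
  "monodromy X r z0 c =
     (\<lambda>x \<in> preimage_in X r {z0}.
        THE y. \<exists>\<alpha>\<in>c. \<exists>\<alpha>'. pathin X \<alpha>' \<and> (\<forall>t\<in>{0..1}. r (\<alpha>' t) = \<alpha> t) \<and> \<alpha>' 0 = x \<and> \<alpha>' 1 = y)"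

definition monodromy_group ::
    "'x topology \<Rightarrow> 'z topology \<Rightarrow> ('x \<Rightarrow> 'z) \<Rightarrow> 'z \<Rightarrow> ('x \<Rightarrow> 'x) monoid" where
  "monodromy_group X Z r z0 =
     (BijGroup (preimage_in X r {z0}))
       \<lparr>carrier := monodromy X r z0 ` fundamental_group (unbranched_part X Z r) z0\<rparr>"


section \<open>Manifolds and simple branched covers\<close>

definition topological_manifold :: "nat \<Rightarrow> 'z topology \<Rightarrow> bool" where
  "topological_manifold n Z \<longleftrightarrow>
     Hausdorff_space Z \<and> second_countable Z \<and>
     (\<forall>z \<in> topspace Z. \<exists>U V. openin Z U \<and> z \<in> U \<and> openin (Euclidean_space n) V \<and>
        subtopology Z U homeomorphic_space subtopology (Euclidean_space n) V)"

text \<open>A chart of the \<open>n\<close>-manifold \<open>Z\<close> centred at \<open>s\<close> in which \<open>S\<close> is the coordinate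
  plane given by the vanishing of the last two coordinates.\<close>

definition codim2_chart ::
    "nat \<Rightarrow> 'z topology \<Rightarrow> 'z set \<Rightarrow> 'z \<Rightarrow> 'z set \<Rightarrow> ('z \<Rightarrow> nat \<Rightarrow> real) \<Rightarrow> bool" where
  "codim2_chart n Z S s U h \<longleftrightarrow>
     2 \<le> n \<and> openin Z U \<and> s \<in> U \<and>
     homeomorphic_map (subtopology Z U) (Euclidean_space n) h \<and> h s = (\<lambda>i. 0) \<and>
     h ` (U \<inter> S) = {x \<in> topspace (Euclidean_space n). x (n - 2) = 0 \<and> x (n - 1) = 0}"

definition nonsingular_points :: "nat \<Rightarrow> 'z topology \<Rightarrow> 'z set \<Rightarrow> 'z set" where
  "nonsingular_points n Z S = {s \<in> S. \<exists>U h. codim2_chart n Z S s U h}"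

definition transverse_circle :: "nat \<Rightarrow> real \<Rightarrow> nat \<Rightarrow> real" where
  "transverse_circle n t =
     (\<lambda>i. if i = n - 2 then cos (2 * pi * t) else if i = n - 1 then sin (2 * pi * t) else 0)"

text \<open>A meridian runs along a path \<open>\<beta>\<close> in the complement of \<open>S\<close>, once around \<open>S\<close> in the
  transverse plane of a chart, and back along \<open>\<beta>\<close>.\<close>

definition meridian_loop ::
    "nat \<Rightarrow> 'z topology \<Rightarrow> 'z set \<Rightarrow> 'z \<Rightarrow> 'z \<Rightarrow> (real \<Rightarrow> 'z) \<Rightarrow> bool" where
  "meridian_loop n Z S z0 s \<mu> \<longleftrightarrow>
     (\<exists>U h \<beta>. codim2_chart n Z S s U h \<and>
        pathin (subtopology Z (topspace Z - S)) \<beta> \<and> \<beta> 0 = z0 \<and>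
        \<beta> 1 = inv_into U h (transverse_circle n 0) \<and>
        \<mu> = concat_paths (concat_paths \<beta> (inv_into U h \<circ> transverse_circle n)) (reverse_path \<beta>))"

definition transposition_on :: "'a set \<Rightarrow> ('a \<Rightarrow> 'a) \<Rightarrow> bool" where
  "transposition_on A g \<longleftrightarrow> (\<exists>a\<in>A. \<exists>b\<in>A. a \<noteq> b \<and> g = restrict (Transposition.transpose a b) A)"

definition simple_branched_cover ::
    "nat \<Rightarrow> 'x topology \<Rightarrow> 'z topology \<Rightarrow> ('x \<Rightarrow> 'z) \<Rightarrow> bool" where
  "simple_branched_cover n X Z r \<longleftrightarrow>
     branched_cover X Z r \<and>
     (let S = branching_set X Z r in
        finite (S - nonsingular_points n Z S) \<and>
        (\<forall>z0 \<in> topspace Z - S. \<forall>s \<in> nonsingular_points n Z S. \<forall>\<mu>.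
           meridian_loop n Z S z0 s \<mu> \<longrightarrow>
           transposition_on (preimage_in X r {z0})
             (monodromy X r z0 (loop_class (unbranched_part X Z r) z0 \<mu>))))"


section \<open>Simplicial complexes\<close>

text \<open>Finite complexes are the geometric ones of \<^const>\<open>simplicial_complex\<close>: \<open>|\<sigma>|\<close> is \<open>\<sigma>\<close>,
  \<open>|K|\<close> is \<open>\<Union>K\<close>, and for \<open>f, g\<close> in \<open>K\<close> the inclusion \<open>f \<subseteq> g\<close> says that \<open>f\<close> is a face
  of \<open>g\<close>. A nonempty complex contains the empty simplex.\<close>

definition vertices :: "'a::euclidean_space set \<Rightarrow> 'a set" where
  "vertices \<sigma> = {v. v extreme_point_of \<sigma>}"

definition barycenter :: "'a::euclidean_space set \<Rightarrow> 'a" where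
  "barycenter \<sigma> = (\<Sum>v\<in>vertices \<sigma>. v) /\<^sub>R real (card (vertices \<sigma>))"

definition facets :: "'a::euclidean_space set set \<Rightarrow> 'a set set" where
  "facets K = {\<sigma> \<in> K. \<forall>\<tau>\<in>K. \<sigma> \<subseteq> \<tau> \<longrightarrow> \<sigma> = \<tau>}"

definition codim :: "'a::euclidean_space set set \<Rightarrow> 'a set \<Rightarrow> int" where
  "codim K f = Max (aff_dim ` K) - aff_dim f"

definition pure_complex :: "'a::euclidean_space set set \<Rightarrow> bool" where
  "pure_complex K \<longleftrightarrow> (\<forall>\<sigma>\<in>facets K. codim K \<sigma> = 0)"

definition neighbouring_facets :: "'a::euclidean_space set set \<Rightarrow> 'a set \<Rightarrow> 'a set \<Rightarrow> bool" where
  "neighbouring_facets K \<sigma> \<tau> \<longleftrightarrow>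
     \<sigma> \<in> facets K \<and> \<tau> \<in> facets K \<and> \<sigma> \<noteq> \<tau> \<and> codim K (\<sigma> \<inter> \<tau>) = 1"

definition strongly_connected :: "'a::euclidean_space set set \<Rightarrow> bool" where
  "strongly_connected K \<longleftrightarrow>
     (\<forall>\<sigma>\<in>facets K. \<forall>\<tau>\<in>facets K. (neighbouring_facets K)\<^sup>*\<^sup>* \<sigma> \<tau>)"

definition star :: "'a::euclidean_space set set \<Rightarrow> 'a set \<Rightarrow> 'a set set" where
  "star K f = {g \<in> K. \<exists>\<sigma>\<in>K. f \<subseteq> \<sigma> \<and> g \<subseteq> \<sigma>}"

definition link :: "'a::euclidean_space set set \<Rightarrow> 'a set \<Rightarrow> 'a set set" where
  "link K f = {g \<in> star K f. f \<inter> g = {}}"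

text \<open>With \<open>c = 2\<close> the links of the codimension-2 faces, which are graphs, are required to
  be simply connected as well; they are then trees, so bipartite, and the odd subcomplex has
  no points. With \<open>c = 3\<close>, the form of the condition that triangulated combinatorial
  manifolds satisfy, these graphs are unrestricted. Faces are nonempty here: for the empty
  face the conditions would concern \<open>K\<close> itself.\<close>

definition nice_complex :: "int \<Rightarrow> 'a::euclidean_space set set \<Rightarrow> bool" where
  "nice_complex c K \<longleftrightarrow>
     pure_complex K \<and>
     (\<forall>f\<in>K. f \<noteq> {} \<longrightarrow> strongly_connected (star K f)) \<and>
     (\<forall>f\<in>K. f \<noteq> {} \<and> codim K f \<ge> c \<longrightarrow> simply_connected (\<Union>(link K f)))"

lemma nice_complex_mono: "nice_complex c K \<Longrightarrow> c \<le> c' \<Longrightarrow> nice_complex c' K"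
  by (auto simp: nice_complex_def)

definition bipartite_graph :: "'a::euclidean_space set set \<Rightarrow> bool" where
  "bipartite_graph G \<longleftrightarrow>
     (\<exists>A. \<forall>u v. u \<noteq> v \<and> convex hull {u, v} \<in> G \<longrightarrow> (u \<in> A \<longleftrightarrow> v \<notin> A))"

definition odd_subcomplex :: "'a::euclidean_space set set \<Rightarrow> 'a set set" where
  "odd_subcomplex K =
     {g \<in> K. \<exists>f\<in>K. codim K f = 2 \<and> \<not> bipartite_graph (link K f) \<and> g \<subseteq> f}"

abbreviation odd_complement :: "'a::euclidean_space set set \<Rightarrow> 'a topology" where
  "odd_complement K \<equiv> top_of_set (\<Union>K - \<Union>(odd_subcomplex K))"


section \<open>Projectivities\<close>

definition perspectivity :: "'a::euclidean_space set \<Rightarrow> 'a set \<Rightarrow> 'a \<Rightarrow> 'a" where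
  "perspectivity \<sigma> \<tau> =
     (\<lambda>v \<in> vertices \<sigma>. if v \<in> vertices \<tau> then v else THE w. w \<in> vertices \<tau> - vertices \<sigma>)"

text \<open>The empty list is not a facet path; the values of the other functions there are irrelevant.\<close>

fun facet_path :: "'a::euclidean_space set set \<Rightarrow> 'a set list \<Rightarrow> bool" where
  "facet_path K [] \<longleftrightarrow> False"
| "facet_path K [\<sigma>] \<longleftrightarrow> \<sigma> \<in> facets K"
| "facet_path K (\<sigma> # \<tau> # \<gamma>) \<longleftrightarrow> neighbouring_facets K \<sigma> \<tau> \<and> facet_path K (\<tau> # \<gamma>)"

fun projectivity :: "'a::euclidean_space set list \<Rightarrow> 'a \<Rightarrow> 'a" where
  "projectivity [] = undefined"
| "projectivity [\<sigma>] = (\<lambda>v \<in> vertices \<sigma>. v)"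
| "projectivity (\<sigma> # \<tau> # \<gamma>) = compose (vertices \<sigma>) (projectivity (\<tau> # \<gamma>)) (perspectivity \<sigma> \<tau>)"

fun barycentric_path :: "'a::euclidean_space set list \<Rightarrow> real \<Rightarrow> 'a" where
  "barycentric_path [] = undefined"
| "barycentric_path [\<sigma>] = linepath (barycenter \<sigma>) (barycenter \<sigma>)"
| "barycentric_path (\<sigma> # \<tau> # \<gamma>) =
     linepath (barycenter \<sigma>) (barycenter (\<sigma> \<inter> \<tau>)) +++
     linepath (barycenter (\<sigma> \<inter> \<tau>)) (barycenter \<tau>) +++ barycentric_path (\<tau> # \<gamma>)"

definition closed_facet_paths ::
    "'a::euclidean_space set set \<Rightarrow> 'a set \<Rightarrow> 'a set list set" where
  "closed_facet_paths K \<sigma>0 = {\<gamma>. facet_path K \<gamma> \<and> hd \<gamma> = \<sigma>0 \<and> last \<gamma> = \<sigma>0}"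

definition projectivity_group ::
    "'a::euclidean_space set set \<Rightarrow> 'a set \<Rightarrow> ('a \<Rightarrow> 'a) monoid" where
  "projectivity_group K \<sigma>0 =
     (BijGroup (vertices \<sigma>0)) \<lparr>carrier := projectivity ` closed_facet_paths K \<sigma>0\<rparr>"

text \<open>The homomorphism sending the class of \<open>barycentric_path \<gamma>\<close> to \<open>projectivity \<gamma>\<close>.
  Products of classes of closed facet paths are classes of concatenated facet paths, so when
  these classes generate the fundamental group they exhaust it.\<close>

definition projectivity_hom ::
    "'a::euclidean_space set set \<Rightarrow> 'a set \<Rightarrow> (real \<Rightarrow> 'a) set \<Rightarrow> 'a \<Rightarrow> 'a" where
  "projectivity_hom K \<sigma>0 c =
     (THE g. \<exists>\<gamma> \<in> closed_facet_paths K \<sigma>0.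
        c = loop_class (odd_complement K) (barycenter \<sigma>0) (barycentric_path \<gamma>) \<and>
        g = projectivity \<gamma>)"


section \<open>The partial unfolding\<close>

definition quotient_topology :: "'a topology \<Rightarrow> ('a \<times> 'a) set \<Rightarrow> 'a set topology" where
  "quotient_topology X R =
     topology (\<lambda>U. U \<subseteq> topspace X // R \<and> openin X {x \<in> topspace X. R `` {x} \<in> U})"

lemma openin_quotient_topology:
  "openin (quotient_topology X R) U \<longleftrightarrow>
     U \<subseteq> topspace X // R \<and> openin X {x \<in> topspace X. R `` {x} \<in> U}"
proof -
  have "istopology (\<lambda>U. U \<subseteq> topspace X // R \<and> openin X {x \<in> topspace X. R `` {x} \<in> U})"
  proof (unfold istopology_def, intro conjI allI impI)
    fix S T
    assume S: "S \<subseteq> topspace X // R \<and> openin X {x \<in> topspace X. R `` {x} \<in> S}"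
      and T: "T \<subseteq> topspace X // R \<and> openin X {x \<in> topspace X. R `` {x} \<in> T}"
    show "S \<inter> T \<subseteq> topspace X // R" using S by blast
    have "{x \<in> topspace X. R `` {x} \<in> S \<inter> T}
        = {x \<in> topspace X. R `` {x} \<in> S} \<inter> {x \<in> topspace X. R `` {x} \<in> T}" by blast
    then show "openin X {x \<in> topspace X. R `` {x} \<in> S \<inter> T}"
      using S T by (simp add: openin_Int)
  next
    fix \<K>
    assume K: "\<forall>S\<in>\<K>. S \<subseteq> topspace X // R \<and> openin X {x \<in> topspace X. R `` {x} \<in> S}"
    show "\<Union>\<K> \<subseteq> topspace X // R" using K by blast
    have "{x \<in> topspace X. R `` {x} \<in> \<Union>\<K>} = (\<Union>S\<in>\<K>. {x \<in> topspace X. R `` {x} \<in> S})" by blast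
    then show "openin X {x \<in> topspace X. R `` {x} \<in> \<Union>\<K>}"
      using K by auto
  qed
  then show ?thesis
    by (simp add: quotient_topology_def)
qed

lemma topspace_quotient_topology: "topspace (quotient_topology X R) = topspace X // R"
proof
  show "topspace (quotient_topology X R) \<subseteq> topspace X // R"
    using openin_quotient_topology by blast
  have "{x \<in> topspace X. R `` {x} \<in> topspace X // R} = topspace X"
    by (auto simp: quotient_def)
  then have "openin (quotient_topology X R) (topspace X // R)"
    by (simp add: openin_quotient_topology)
  then show "topspace X // R \<subseteq> topspace (quotient_topology X R)"
    by (rule openin_subset)
qed

lemma quotient_map_quotient_topology:
  "quotient_map X (quotient_topology X R) (\<lambda>x. R `` {x})"
  unfolding quotient_map_def topspace_quotient_topology openin_quotient_topology
  by (auto simp: quotient_def)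

text \<open>A point \<open>((\<sigma>, v), x)\<close> of the disjoint union is the point \<open>x\<close> of the copy \<open>(|\<sigma>|, v)\<close>.\<close>

definition unfolding_copies ::
    "'a::euclidean_space set set \<Rightarrow> (('a set \<times> 'a) \<times> 'a) topology" where
  "unfolding_copies K =
     sum_topology (\<lambda>(\<sigma>, v). top_of_set \<sigma>) {(\<sigma>, v). \<sigma> \<in> facets K \<and> v \<in> vertices \<sigma>}"

definition unfolding_glue ::
    "'a::euclidean_space set set \<Rightarrow> ((('a set \<times> 'a) \<times> 'a) \<times> (('a set \<times> 'a) \<times> 'a)) set" where
  "unfolding_glue K =
     {(((\<sigma>, v), x), ((\<tau>, w), x)) | \<sigma> v \<tau> w x.
        neighbouring_facets K \<sigma> \<tau> \<and> v \<in> vertices \<sigma> \<and> perspectivity \<sigma> \<tau> v = w \<and> x \<in> \<sigma> \<inter> \<tau>}"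

definition partial_unfolding ::
    "'a::euclidean_space set set \<Rightarrow> (('a set \<times> 'a) \<times> 'a) set topology" where
  "partial_unfolding K =
     quotient_topology (unfolding_copies K) ((unfolding_glue K \<union> (unfolding_glue K)\<inverse>)\<^sup>*)"

text \<open>Glued points have the same underlying point of \<open>|K|\<close>, so the image is a singleton.\<close>

definition unfolding_map :: "(('a set \<times> 'a) \<times> 'a) set \<Rightarrow> 'a::euclidean_space" where
  "unfolding_map P = the_elem (snd ` P)"


section \<open>Conjugation by a bijection\<close>

definition conjugate_perm :: "'x set \<Rightarrow> 'a set \<Rightarrow> ('x \<Rightarrow> 'a) \<Rightarrow> ('x \<Rightarrow> 'x) \<Rightarrow> 'a \<Rightarrow> 'a" where
  "conjugate_perm A B \<iota> g = (\<lambda>v \<in> B. \<iota> (g (inv_into A \<iota> v)))"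

end

theory Submission
  imports Defs
begin

text \<open>Fix a facet \<open>\<sigma>\<close> and write \<open>q = \<phi> \<circ> r\<close>. The relative interior of \<open>\<sigma>\<close> is convex and misses the
  branching set, so through each point of \<open>X\<close> over the barycenter of \<open>\<sigma>\<close> there is a section of
  \<open>q\<close> over it, and completeness of the spread extends this section to all of \<open>\<sigma>\<close>. Transporting
  sections across ridges is lifting barycentric paths, so the hypothesis on the monodromy allows
  the sections over all facets to be labelled by pairs \<open>(\<sigma>, v)\<close> compatibly with perspectivities,
  as soon as the projectivity of a closed facet path depends only on the homotopy class of its
  barycentric path. The labelled sections glue to a continuous map from the partial unfolding onto
  \<open>X\<close>. It is injective because the unbranched part of a small connected open set of \<open>X\<close> is
  connected; as the unfolding is compact and \<open>X\<close> is Hausdorff, it is a homeomorphism, and all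
  properties of \<open>r\<close> as a branched cover pass to the unfolding.

  Projectivities are homotopy invariant because the unfolding is a covering off the odd
  subcomplex. Locally this says that closed facet paths around a face \<open>f\<close> that is not odd have
  trivial projectivity. In codimension at most 2 the star of \<open>f\<close> is coloured by hand; in
  higher codimension, by induction, the unfolding restricts to a covering of a copy of the simply
  connected link of \<open>f\<close>.\<close>

section \<open>Lifting through covering maps\<close>

text \<open>Off the odd subcomplex the claim is the classification of coverings by monodromy. Over
  odd faces several sheets of \<open>X\<close> may meet, and they must meet exactly where the
  unfolding identifies its copies. Gluing never moves the underlying point, so over each point of
  |K| the identifications form a finite combinatorial relation, and \<open>trivial_holonomy\<close>
  says that it keeps the copies of each facet apart. This property serves twice: it makes the
  unfolding a covering where it holds, and through lifting it makes the description in
  \<open>projectivity_hom\<close> single-valued. Strongly connected stars enter as facet paths that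
  never leave a given point and carry a copy of one facet there to any other. Relative interiors of
  facets and ridges avoid the odd subcomplex, so a section over either is fixed by one value off it;
  comparing at barycenters therefore settles also the odd faces in the boundary. Of Fox's
  conditions, completeness lets sections reach the odd faces, and local connectedness of the
  unbranched part keeps unrelated sheets from touching there.\<close>

lemma covering_mapE:
  assumes "covering_map E B q" "z \<in> topspace B"
  obtains T \<V> where "openin B T" "z \<in> T" "\<Union>\<V> = preimage_in E q T" "\<And>U. U \<in> \<V> \<Longrightarrow> openin E U"
    "pairwise disjnt \<V>" "\<And>U. U \<in> \<V> \<Longrightarrow> homeomorphic_map (subtopology E U) (subtopology B T) q"
  using assms unfolding covering_map_def by meson

lemma homeomorphic_map_subtopology_inj:
  assumes "homeomorphic_map (subtopology E U) (subtopology B T) q" "openin E U" "x \<in> U" "y \<in> U" "q x = q y"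
  shows "x = y"
proof -
  have "U \<subseteq> topspace E" by (rule openin_subset[OF assms(2)])
  then show ?thesis using assms by (metis homeomorphic_imp_injective_map inj_on_def topspace_subtopology_subset)
qed

text \<open>Agreement of two lifts is locally constant: near a point they stay either in one sheet,
  where \<open>q\<close> is injective, or in two disjoint sheets. So the agreement set and its
  complement are both open, and connectedness decides.\<close>

lemma covering_lift_unique:
  assumes cov: "covering_map E B q" and A: "connected_space A"
    and f: "continuous_map A E f" and g: "continuous_map A E g"
    and eq: "\<And>x. x \<in> topspace A \<Longrightarrow> q (f x) = q (g x)"
    and a: "a \<in> topspace A" "f a = g a" and x: "x \<in> topspace A"
  shows "f x = g x"
proof -
  have qc: "continuous_map E B q" using cov by (simp add: covering_map_def)
  define D where "D = {x \<in> topspace A. f x = g x}"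
  have key: "\<exists>N. openin A N \<and> y \<in> N \<and> (\<forall>x\<in>N. f x = g x \<longleftrightarrow> f y = g y)" if y: "y \<in> topspace A" for y
  proof -
    have fy: "f y \<in> topspace E" "g y \<in> topspace E"
      using y f g by (auto simp: continuous_map_def)
    then have "q (f y) \<in> topspace B" using qc by (auto simp: continuous_map_def)
    from covering_mapE[OF cov this] obtain T \<V> where T: "openin B T" "q (f y) \<in> T"
      and V: "\<Union>\<V> = preimage_in E q T" "\<And>U. U \<in> \<V> \<Longrightarrow> openin E U" "pairwise disjnt \<V>"
        "\<And>U. U \<in> \<V> \<Longrightarrow> homeomorphic_map (subtopology E U) (subtopology B T) q"
      by metis
    have "f y \<in> \<Union>\<V>" "g y \<in> \<Union>\<V>"
      using fy T eq[OF y] by (auto simp: V(1) preimage_in_def)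
    then obtain U U' where U: "U \<in> \<V>" "f y \<in> U" "U' \<in> \<V>" "g y \<in> U'" by auto
    define N where "N = {x \<in> topspace A. f x \<in> U} \<inter> {x \<in> topspace A. g x \<in> U'}"
    have "openin A N"
      unfolding N_def using U V(2) f g by (intro openin_Int openin_continuous_map_preimage) auto
    moreover have "f x = g x \<longleftrightarrow> f y = g y" if "x \<in> N" for x
    proof (cases "U = U'")
      case True
      have "f y = g y"
        using homeomorphic_map_subtopology_inj[OF V(4)[OF U(1)] V(2)[OF U(1)]] U True eq[OF y] by metis
      moreover have "f x = g x"
        using homeomorphic_map_subtopology_inj[OF V(4)[OF U(1)] V(2)[OF U(1)], of "f x" "g x"]
          True eq[of x] that by (auto simp: N_def)
      ultimately show ?thesis by simp
    next
      case False
      then have "U \<inter> U' = {}" using V(3) U by (auto simp: pairwise_def disjnt_def)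
      then show ?thesis using that U by (auto simp: N_def)
    qed
    moreover have "y \<in> N" using y U by (simp add: N_def)
    ultimately show ?thesis by blast
  qed
  have DA: "D \<subseteq> topspace A" by (auto simp: D_def)
  have "\<exists>N. openin A N \<and> y \<in> N \<and> N \<subseteq> D" if "y \<in> D" for y
  proof -
    from that have "y \<in> topspace A" "f y = g y" by (auto simp: D_def)
    then obtain N where "openin A N" "y \<in> N" "\<forall>x\<in>N. f x = g x" using key by metis
    then show ?thesis using openin_subset[of A N] by (intro exI[of _ N]) (auto simp: D_def)
  qed
  then have "openin A D" by (subst openin_subopen) blast
  moreover have "\<exists>N. openin A N \<and> y \<in> N \<and> N \<subseteq> topspace A - D" if "y \<in> topspace A - D" for y
  proof -
    from that have "y \<in> topspace A" "f y \<noteq> g y" by (auto simp: D_def)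
    then obtain N where "openin A N" "y \<in> N" "\<forall>x\<in>N. f x \<noteq> g x" using key by metis
    then show ?thesis using openin_subset[of A N] by (intro exI[of _ N]) (auto simp: D_def)
  qed
  then have "openin A (topspace A - D)" by (subst openin_subopen) blast
  ultimately have "D = {} \<or> D = topspace A"
    using A DA by (auto simp: connected_space_clopen_in closedin_def)
  moreover have "a \<in> D" using a by (simp add: D_def)
  ultimately have "x \<in> D" using x by blast
  then show ?thesis by (simp add: D_def)
qed

text \<open>The neighbourhood of \<open>a\<close> has to shrink whenever a new evenly covered set is
  entered. In place of a subdivision of the interval, the existence of a lift up to time
  \<open>t\<close> over some neighbourhood is shown to be locally constant in
  \<open>t\<close>.\<close>

lemma covering_homotopy_lift_local:
  assumes cov: "covering_map E B q"
    and H: "continuous_map (prod_topology A (top_of_set {0..1::real})) B H"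
    and f: "continuous_map A E f" and start: "\<And>x. x \<in> topspace A \<Longrightarrow> q (f x) = H (x, 0)"
    and a: "a \<in> topspace A"
  shows "\<exists>N G. openin A N \<and> a \<in> N \<and> continuous_map (prod_topology (subtopology A N) (top_of_set {0..1})) E G \<and>
    (\<forall>x\<in>N. G (x, 0) = f x \<and> (\<forall>s\<in>{0..1}. q (G (x, s)) = H (x, s)))"
proof -
  define P where "P t \<longleftrightarrow> (\<exists>N G. openin A N \<and> a \<in> N \<and>
    continuous_map (prod_topology (subtopology A N) (top_of_set {0..t})) E G \<and>
    (\<forall>x\<in>N. G (x, 0) = f x \<and> (\<forall>s\<in>{0..t}. q (G (x, s)) = H (x, s))))" for t :: real
  have P0: "P 0"
    unfolding P_def
  proof (intro exI[of _ "topspace A"] exI[of _ "f \<circ> fst"] conjI ballI)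
    show "continuous_map (prod_topology (subtopology A (topspace A)) (top_of_set {0..0})) E (f \<circ> fst)"
      using f continuous_map_compose[OF continuous_map_fst] by (simp add: subtopology_topspace)
  qed (use a start in auto)
  have "\<exists>J. openin (top_of_set {0..1}) J \<and> s \<in> J \<and> (\<forall>t\<in>J. \<forall>t'\<in>J. P t \<longrightarrow> P t')" if s: "s \<in> {0..1}" for s :: real
  proof -
    have "(a, s) \<in> topspace (prod_topology A (top_of_set {0..1}))" using s a by simp
    then have "H (a, s) \<in> topspace B" using H by (auto simp: continuous_map_def)
    from covering_mapE[OF cov this] obtain T \<V> where T: "openin B T" "H (a, s) \<in> T"
      and V: "\<Union>\<V> = preimage_in E q T" "\<And>U. U \<in> \<V> \<Longrightarrow> openin E U"
        "\<And>U. U \<in> \<V> \<Longrightarrow> homeomorphic_map (subtopology E U) (subtopology B T) q"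
      by metis
    have "openin (prod_topology A (top_of_set {0..1})) {x \<in> topspace (prod_topology A (top_of_set {0..1})). H x \<in> T}"
      by (rule openin_continuous_map_preimage[OF H T(1)])
    moreover have "(a, s) \<in> {x \<in> topspace (prod_topology A (top_of_set {0..1})). H x \<in> T}"
      using s a T by simp
    ultimately obtain N0 J0 where N0: "openin A N0" "a \<in> N0" and J0: "openin (top_of_set {0..1}) J0" "s \<in> J0"
      and NJ: "N0 \<times> J0 \<subseteq> {x \<in> topspace (prod_topology A (top_of_set {0..1})). H x \<in> T}"
      unfolding openin_prod_topology_alt by meson
    obtain e where e: "e > 0" "ball s e \<inter> {0..1} \<subseteq> J0"
      using J0 by (meson openin_contains_ball)
    define J where "J = ball s e \<inter> {0..1}"
    have HT: "H (x, t) \<in> T" if "x \<in> N0" "t \<in> J" for x t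
    proof -
      have "(x, t) \<in> N0 \<times> J0" using that e by (auto simp: J_def)
      then show ?thesis using NJ by blast
    qed
    have Jint: "u \<in> J" if "t \<in> J" "t' \<in> J" "t \<le> u" "u \<le> t'" for t t' u
      using that by (auto simp: J_def dist_real_def)
    \<comment> \<open>Going back in time is a restriction; going forward continues the lift by the
      inverse \<open>k\<close> of \<open>q\<close> on the sheet containing
      \<open>G (a, t)\<close>.\<close>
    have "P t'" if t: "t \<in> J" "t' \<in> J" "P t" for t t'
    proof -
      obtain N G where N: "openin A N" "a \<in> N" and
         G: "continuous_map (prod_topology (subtopology A N) (top_of_set {0..t})) E G" and
         Gx: "\<And>x. x \<in> N \<Longrightarrow> G (x, 0) = f x" "\<And>x s. x \<in> N \<Longrightarrow> s \<in> {0..t} \<Longrightarrow> q (G (x, s)) = H (x, s)"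
        using t(3) unfolding P_def by blast
      have NA: "N \<subseteq> topspace A" using N openin_subset by auto
      have t01: "0 \<le> t" "t \<le> 1" "0 \<le> t'" "t' \<le> 1" using t by (auto simp: J_def)
      have sub: "prod_topology (subtopology A M) (top_of_set I) = subtopology (prod_topology A euclidean) (M \<times> I)" for M and I :: "real set"
        by (simp add: subtopology_Times)
      have H': "continuous_map (subtopology (prod_topology A euclidean) (topspace A \<times> {0..1})) B H"
        using H by (simp add: sub[symmetric])
      show ?thesis
      proof (cases "t' \<le> t")
        case True
        have "continuous_map (prod_topology (subtopology A N) (top_of_set {0..t'})) E G"
          using G unfolding sub by (rule continuous_map_from_subtopology_mono) (use True in auto)
        then show ?thesis unfolding P_def using N Gx True by (intro exI[of _ N] exI[of _ G]) auto
      next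
        case False
        have "(a, t) \<in> topspace (prod_topology (subtopology A N) (top_of_set {0..t}))"
          using N NA t01 by auto
        then have "G (a, t) \<in> topspace E" using G by (auto simp: continuous_map_def)
        moreover have "q (G (a, t)) \<in> T" using Gx(2)[OF N(2), of t] HT[OF N0(2) t(1)] t01 by auto
        ultimately have "G (a, t) \<in> \<Union>\<V>" by (auto simp: V(1) preimage_in_def)
        then obtain U where U: "U \<in> \<V>" "G (a, t) \<in> U" by auto
        have UE: "U \<subseteq> topspace E" using V(2)[OF U(1)] openin_subset by auto
        have TB: "T \<subseteq> topspace B" using T(1) openin_subset by auto
        obtain k where k: "homeomorphic_maps (subtopology E U) (subtopology B T) q k"
          using V(3)[OF U(1)] homeomorphic_map_maps by blast
        have kq: "k (q u) = u" if "u \<in> U" for u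
          using k that UE by (auto simp: homeomorphic_maps_def)
        have qk: "q (k u) = u" if "u \<in> T" for u
          using k that TB by (auto simp: homeomorphic_maps_def)
        have kc: "continuous_map (subtopology B T) E k"
          using k by (auto simp: homeomorphic_maps_def continuous_map_in_subtopology)
        have Gt: "continuous_map (subtopology A N) E (\<lambda>x. G (x, t))"
          using continuous_map_compose[OF _ G, of "subtopology A N" "\<lambda>x. (x, t)"] t01
          by (simp add: o_def continuous_map_pairwise)
        \<comment> \<open>Here \<open>k\<close> continues the given lift only where that lift at
          time \<open>t\<close> already lies in the sheet \<open>U\<close>; this open condition
          defines the smaller neighbourhood.\<close>
        define M where "M = {x \<in> topspace (subtopology A N). G (x, t) \<in> U} \<inter> N0"
        have MN: "M \<subseteq> N" "M \<subseteq> N0" "M \<subseteq> topspace A" by (auto simp: M_def)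
        have "openin (subtopology A N) {x \<in> topspace (subtopology A N). G (x, t) \<in> U}"
          by (rule openin_continuous_map_preimage[OF Gt V(2)[OF U(1)]])
        then have M: "openin A M" unfolding M_def using N(1) N0(1) by (metis openin_Int openin_trans_full)
        have aM: "a \<in> M" using a N N0 U by (auto simp: M_def)
        define G' where "G' x = (if snd x \<le> t then G x else k (H x))" for x
        have "continuous_map (prod_topology (subtopology A M) (top_of_set {0..t'})) E G'"
          unfolding G'_def
        proof (rule continuous_map_cases_le)
          show "continuous_map (prod_topology (subtopology A M) (top_of_set {0..t'})) euclideanreal snd"
            by (metis continuous_map_in_subtopology continuous_map_snd)
          show "continuous_map (prod_topology (subtopology A M) (top_of_set {0..t'})) euclideanreal (\<lambda>x. t)" by simp
          show "continuous_map (subtopology (prod_topology (subtopology A M) (top_of_set {0..t'}))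
             {x \<in> topspace (prod_topology (subtopology A M) (top_of_set {0..t'})). snd x \<le> t}) E G"
            unfolding sub subtopology_subtopology
            by (rule continuous_map_from_subtopology_mono[OF G[unfolded sub]]) (use MN in auto)
          have "continuous_map (subtopology (prod_topology (subtopology A M) (top_of_set {0..t'}))
             {x \<in> topspace (prod_topology (subtopology A M) (top_of_set {0..t'})). t \<le> snd x}) (subtopology B T) H"
            unfolding continuous_map_in_subtopology
          proof
            show "continuous_map (subtopology (prod_topology (subtopology A M) (top_of_set {0..t'}))
             {x \<in> topspace (prod_topology (subtopology A M) (top_of_set {0..t'})). t \<le> snd x}) B H"
              unfolding sub subtopology_subtopology
              by (rule continuous_map_from_subtopology_mono[OF H']) (use MN t01 in auto)
            show "H \<in> topspace (subtopology (prod_topology (subtopology A M) (top_of_set {0..t'}))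
             {x \<in> topspace (prod_topology (subtopology A M) (top_of_set {0..t'})). t \<le> snd x}) \<rightarrow> T"
              using MN t01 HT Jint[OF t(1,2)] by auto
          qed
          then show "continuous_map (subtopology (prod_topology (subtopology A M) (top_of_set {0..t'}))
             {x \<in> topspace (prod_topology (subtopology A M) (top_of_set {0..t'})). t \<le> snd x}) E (\<lambda>x. k (H x))"
            using continuous_map_compose[OF _ kc] by (simp add: o_def)
          fix x assume "x \<in> topspace (prod_topology (subtopology A M) (top_of_set {0..t'}))" "snd x = t"
          then obtain y where y: "x = (y, t)" "y \<in> M" by (cases x) auto
          then have "y \<in> N" "G (y, t) \<in> U" by (auto simp: M_def)
          then have "k (q (G (y, t))) = G (y, t)" "q (G (y, t)) = H (y, t)"
            using kq[of "G (y, t)"] Gx(2)[of y t] t01 by auto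
          then show "G x = k (H x)" using y by simp
        qed
        moreover have "G' (x, 0) = f x" if "x \<in> M" for x using that Gx(1)[of x] MN t01 by (auto simp: G'_def)
        moreover have "q (G' (x, u)) = H (x, u)" if "x \<in> M" "u \<in> {0..t'}" for x u
        proof (cases "u \<le> t")
          case True
          then show ?thesis using that Gx(2)[of x u] MN by (simp add: G'_def subset_iff)
        next
          case False
          then have "H (x, u) \<in> T" using that MN HT[of x u] Jint[OF t(1,2), of u] by auto
          then show ?thesis using False qk by (simp add: G'_def)
        qed
        ultimately have "continuous_map (prod_topology (subtopology A M) (top_of_set {0..t'})) E G' \<and>
            (\<forall>x\<in>M. G' (x, 0) = f x \<and> (\<forall>s\<in>{0..t'}. q (G' (x, s)) = H (x, s)))" by simp
        then show ?thesis unfolding P_def by (intro exI[of _ M] exI[of _ G'] conjI M aM) auto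
      qed
    qed
    moreover have "openin (top_of_set {0..1}) J"
      unfolding J_def Int_commute[of "ball s e"] by (rule openin_open_Int) simp
    moreover have "s \<in> J" using s e by (simp add: J_def)
    ultimately show ?thesis by blast
  qed
  then have "P 1"
    by (intro connected_induction_simple[of "{0..1::real}" 0 1 P] P0) auto
  then show ?thesis unfolding P_def .
qed

text \<open>Local lifts agree on overlaps by uniqueness along each single interval over a fixed
  \<open>x\<close>, so they paste together over the open cover of \<open>A\<close> by the
  neighbourhoods.\<close>

lemma covering_homotopy_lift:
  assumes cov: "covering_map E B q"
    and H: "continuous_map (prod_topology A (top_of_set {0..1::real})) B H"
    and f: "continuous_map A E f" and start: "\<And>x. x \<in> topspace A \<Longrightarrow> q (f x) = H (x, 0)"
  obtains G where "continuous_map (prod_topology A (top_of_set {0..1})) E G"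
    "\<And>x. x \<in> topspace A \<Longrightarrow> G (x, 0) = f x"
    "\<And>x s. x \<in> topspace A \<Longrightarrow> s \<in> {0..1} \<Longrightarrow> q (G (x, s)) = H (x, s)"
proof -
  define Q where "Q a N G \<longleftrightarrow> openin A N \<and> a \<in> N \<and> continuous_map (prod_topology (subtopology A N) (top_of_set {0..1})) E G \<and>
    (\<forall>x\<in>N. G (x, 0) = f x \<and> (\<forall>s\<in>{0..1}. q (G (x, s)) = H (x, s)))" for a N G
  have "\<forall>a\<in>topspace A. \<exists>N G. Q a N G"
    using covering_homotopy_lift_local[OF assms] unfolding Q_def by blast
  then obtain N G where NG: "\<And>a. a \<in> topspace A \<Longrightarrow> Q a (N a) (G a)"
    by metis
  then have N: "\<And>a. a \<in> topspace A \<Longrightarrow> openin A (N a)" "\<And>a. a \<in> topspace A \<Longrightarrow> a \<in> N a"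
    and G: "\<And>a. a \<in> topspace A \<Longrightarrow> continuous_map (prod_topology (subtopology A (N a)) (top_of_set {0..1})) E (G a)"
    and Gx: "\<And>a x. a \<in> topspace A \<Longrightarrow> x \<in> N a \<Longrightarrow> G a (x, 0) = f x"
      "\<And>a x s. a \<in> topspace A \<Longrightarrow> x \<in> N a \<Longrightarrow> s \<in> {0..1} \<Longrightarrow> q (G a (x, s)) = H (x, s)"
    unfolding Q_def by simp_all
  let ?P = "prod_topology A (top_of_set {0..1::real})"
  let ?T = "\<lambda>a. N a \<times> {0..1::real}"
  have agree: "G a (x, s) = G b (x, s)"
    if ab: "a \<in> topspace A" "b \<in> topspace A" and x: "x \<in> N a" "x \<in> N b" and s: "s \<in> {0..1}" for a b x s
  proof -
    have c: "continuous_map (top_of_set {0..1}) E (\<lambda>s. G c (x, s))" if "c \<in> topspace A" "x \<in> N c" for c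
      using continuous_map_compose[OF _ G[OF that(1)], of "top_of_set {0..1}" "\<lambda>s. (x, s)"] that
        openin_subset[OF N(1)[OF that(1)]] by (auto simp: o_def continuous_map_pairwise)
    show ?thesis
      by (rule covering_lift_unique[OF cov _ c[OF ab(1) x(1)] c[OF ab(2) x(2)], of 0])
        (use ab x s Gx in auto)
  qed
  obtain g where g: "continuous_map ?P E g"
    "\<And>x a. a \<in> topspace A \<Longrightarrow> x \<in> topspace ?P \<inter> ?T a \<Longrightarrow> g x = G a x"
  proof (rule pasting_lemma_exists[of ?P ?T "topspace A" E G])
    show "topspace ?P \<subseteq> \<Union> (?T ` topspace A)" using N by auto
    show "openin ?P (?T a)" if "a \<in> topspace A" for a
      using N(1)[OF that] by (simp add: openin_prod_Times_iff)
    show "continuous_map (subtopology ?P (?T a)) E (G a)" if "a \<in> topspace A" for a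
      using G[OF that] by (simp add: subtopology_Times subtopology_subtopology)
    show "G a x = G b x" if "a \<in> topspace A" "b \<in> topspace A" "x \<in> topspace ?P \<inter> ?T a \<inter> ?T b" for a b x
      by (cases x) (use agree[OF that(1,2), of "fst x" "snd x"] that(3) in simp)
  qed (rule that; assumption)
  have "g (x, s) = G x (x, s)" if "x \<in> topspace A" "s \<in> {0..1}" for x s
    using g(2)[OF that(1), of "(x, s)"] that N(2)[OF that(1)] by simp
  then show thesis using that[OF g(1)] Gx[OF _ N(2)] by (metis atLeastAtMost_iff order_refl zero_le_one)
qed

text \<open>The linear contraction of \<open>S\<close> to \<open>b\<close> gives a homotopy from the
  constant map \<open>f b\<close> to \<open>f\<close>; its lift starting at the constant
  \<open>e\<close> ends in a lift of \<open>f\<close>. The value at \<open>b\<close> is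
  \<open>e\<close> because the contraction fixes \<open>b\<close>.\<close>

lemma covering_lift_convex:
  fixes S :: "'b::real_normed_vector set"
  assumes cov: "covering_map E B q" and S: "convex S" and f: "continuous_map (top_of_set S) B f"
    and b: "b \<in> S" and e: "e \<in> topspace E" "q e = f b"
  obtains g where "continuous_map (top_of_set S) E g" "\<And>x. x \<in> S \<Longrightarrow> q (g x) = f x" "g b = e"
proof -
  have seg: "b + t *\<^sub>R (x - b) \<in> S" if "x \<in> S" "t \<in> {0..1}" for x t
    using convexD[OF S b that(1), of "1 - t" t] that(2) by (auto simp: algebra_simps)
  define H where "H = f \<circ> (\<lambda>(x, t). b + t *\<^sub>R (x - b))"
  have "continuous_map (prod_topology (top_of_set S) (top_of_set {0..1::real})) (top_of_set S) (\<lambda>(x, t). b + t *\<^sub>R (x - b))"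
    unfolding prod_topology_subtopology_eu using seg
    by (auto simp: case_prod_unfold intro!: continuous_intros)
  then have H: "continuous_map (prod_topology (top_of_set S) (top_of_set {0..1::real})) B H"
    unfolding H_def using f continuous_map_compose by blast
  obtain G where G: "continuous_map (prod_topology (top_of_set S) (top_of_set {0..1::real})) E G"
    "\<And>x. x \<in> S \<Longrightarrow> G (x, 0) = e"
    "\<And>x s. x \<in> S \<Longrightarrow> s \<in> {0..1} \<Longrightarrow> q (G (x, s)) = H (x, s)"
    using covering_homotopy_lift[OF cov H, of "\<lambda>x. e"] e by (auto simp: H_def)
  have c: "continuous_map (top_of_set {0..1}) E (\<lambda>s. G (b, s))"
    using continuous_map_compose[OF _ G(1), of "top_of_set {0..1}" "\<lambda>s. (b, s)"] b
    by (simp add: o_def continuous_map_pairwise continuous_on_Pair prod_topology_subtopology_eu)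
  show thesis
  proof (rule that[of "\<lambda>x. G (x, 1)"])
    show "continuous_map (top_of_set S) E (\<lambda>x. G (x, 1))"
      using continuous_map_compose[OF _ G(1), of "top_of_set S" "\<lambda>x. (x, 1)"]
      by (simp add: o_def continuous_on_Pair prod_topology_subtopology_eu)
    show "q (G (x, 1)) = f x" if "x \<in> S" for x using G(3)[OF that, of 1] by (simp add: H_def)
    have "G (b, 1) = G (b, 0)"
      by (rule covering_lift_unique[OF cov _ c, of "\<lambda>s. G (b, 0)" 0 1])
        (use G b e in \<open>auto simp: H_def\<close>)
    then show "G (b, 1) = e" using G(2) b by simp
  qed
qed

text \<open>The square is convex, so the homotopy lifts to it. Uniqueness along the four edges
  identifies two opposite edges with \<alpha>' and \<beta>' and makes the other two
  constant.\<close>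

lemma covering_lift_path_homotopic:
  assumes cov: "covering_map E B q" and hom: "path_homotopic B \<alpha> \<beta>"
    and a: "pathin E \<alpha>'" "\<And>t. t \<in> {0..1} \<Longrightarrow> q (\<alpha>' t) = \<alpha> t"
    and b: "pathin E \<beta>'" "\<And>t. t \<in> {0..1} \<Longrightarrow> q (\<beta>' t) = \<beta> t"
    and start: "\<alpha>' 0 = \<beta>' 0"
  shows "\<alpha>' 1 = \<beta>' 1"
proof -
  obtain H where H: "continuous_map (prod_topology (top_of_set {0..1}) (top_of_set {0..1::real})) B H"
     "\<And>x. H (0, x) = \<alpha> x" "\<And>x. H (1, x) = \<beta> x"
     and H01: "\<And>t. t \<in> {0..1::real} \<Longrightarrow> H (t, 0) = \<alpha> 0" "\<And>t. t \<in> {0..1} \<Longrightarrow> H (t, 1) = \<alpha> 1"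
    using hom unfolding path_homotopic_def homotopic_with_def by auto
  have a0: "\<alpha>' 0 \<in> topspace E" using a(1) by (auto simp: pathin_def continuous_map_def)
  obtain G where G: "continuous_map (top_of_set ({0..1::real} \<times> {0..1::real})) E G"
    "\<And>x. x \<in> {0..1::real} \<times> {0..1::real} \<Longrightarrow> q (G x) = H x" "G (0, 0) = \<alpha>' 0"
    by (rule covering_lift_convex[OF cov convex_Times[OF convex_real_interval(5) convex_real_interval(5)] H(1)[unfolded prod_topology_subtopology_eu], of "(0,0)" "\<alpha>' 0"])
      (use a0 a(2)[of 0] H(2) in auto)
  have G1: "continuous_map (top_of_set {0..1}) E (\<lambda>s. G (c, s))"
      "continuous_map (top_of_set {0..1}) E (\<lambda>s. G (s, c))" if "c \<in> {0..1}" for c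
    using continuous_map_compose[OF _ G(1), of "top_of_set {0..1}" "\<lambda>s. (c, s)"]
      continuous_map_compose[OF _ G(1), of "top_of_set {0..1}" "\<lambda>s. (s, c)"] that
    by (auto simp: o_def continuous_on_Pair intro!: continuous_intros)
  have con: "connected_space (top_of_set {0..1::real})" by simp
  note un = covering_lift_unique[OF cov con, where a = 0 and x = 1]
  have left: "G (0, 1) = \<alpha>' 1"
    by (rule un[OF G1(1)[of 0]]) (use a G H in \<open>auto simp: pathin_def\<close>)
  have bot: "G (1, 0) = G (0, 0)"
    by (rule un[OF G1(2)[of 0], of "\<lambda>_. G (0, 0)"]) (use a0 a H01 G H in \<open>auto\<close>)
  have right: "G (1, 1) = \<beta>' 1"
    by (rule un[OF G1(1)[of 1]]) (use b G H bot start in \<open>auto simp: pathin_def\<close>)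
  have "\<alpha>' 1 \<in> topspace E" using a(1) by (auto simp: pathin_def continuous_map_def)
  then have top: "G (1, 1) = G (0, 1)"
    by (intro un[OF G1(2)[of 1], of "\<lambda>_. G (0, 1)"]) (use a H01 G left H in \<open>auto\<close>)
  show ?thesis using left top right by simp
qed

section \<open>Loop classes\<close>

lemma path_homotopic_refl_on:
  assumes "pathin X \<alpha>" "\<And>t. t \<in> {0..1} \<Longrightarrow> \<alpha> t = \<beta> t"
  shows "path_homotopic X \<alpha> \<beta>"
  unfolding path_homotopic_def using assms by (intro homotopic_with_equal) (auto simp: pathin_def)

lemma path_homotopic_ends: "path_homotopic X \<alpha> \<beta> \<Longrightarrow> \<beta> 0 = \<alpha> 0 \<and> \<beta> 1 = \<alpha> 1"
  unfolding path_homotopic_def using homotopic_with_imp_property by blast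

lemma path_homotopic_sym: "path_homotopic X \<alpha> \<beta> \<Longrightarrow> path_homotopic X \<beta> \<alpha>"
  using path_homotopic_ends[of X \<alpha> \<beta>] unfolding path_homotopic_def by (simp add: homotopic_with_sym)

lemma path_homotopic_trans: "path_homotopic X \<alpha> \<beta> \<Longrightarrow> path_homotopic X \<beta> \<gamma> \<Longrightarrow> path_homotopic X \<alpha> \<gamma>"
  using path_homotopic_ends[of X \<alpha> \<beta>] unfolding path_homotopic_def by (simp add: homotopic_with_trans)

lemma path_homotopic_compose:
  assumes "path_homotopic X \<alpha> \<beta>" "continuous_map X Y f"
  shows "path_homotopic Y (f \<circ> \<alpha>) (f \<circ> \<beta>)"
  using assms unfolding path_homotopic_def
  by (auto intro: homotopic_with_compose_continuous_map_left)

lemma loop_class_eq: "path_homotopic X \<alpha> \<beta> \<Longrightarrow> loop_class X x0 \<alpha> = loop_class X x0 \<beta>"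
  unfolding loop_class_def using path_homotopic_trans path_homotopic_sym by blast

lemma loop_class_self: "\<alpha> \<in> loops X x0 \<Longrightarrow> \<alpha> \<in> loop_class X x0 \<alpha>"
  by (auto simp: loop_class_def loops_def intro: path_homotopic_refl_on)

section \<open>Spreads\<close>

lemma component_preimage_open:
  assumes "spread X Z r" "openin Z W" "C \<in> connected_components_of (subtopology X (preimage_in X r W))"
  shows "openin X C" "connectedin X C" "C \<subseteq> preimage_in X r W"
proof -
  have o: "openin X (preimage_in X r W)"
    using assms by (auto simp: spread_def preimage_in_def intro: openin_continuous_map_preimage)
  have "locally_connected_space (subtopology X (preimage_in X r W))"
    using assms(1) o by (simp add: spread_def locally_connected_space_open_subset)
  from openin_connected_components_of_locally_connected_space[OF this assms(3)]
  show "openin X C" using o by (simp add: openin_open_subtopology)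
  show "connectedin X C" "C \<subseteq> preimage_in X r W"
    using connectedin_connected_components_of[OF assms(3)] by (auto simp: connectedin_subtopology)
qed

lemma ex_component_superset:
  assumes "connectedin X S" "S \<subseteq> T" "S \<noteq> {}"
  obtains C where "C \<in> connected_components_of (subtopology X T)" "S \<subseteq> C"
proof -
  have S: "connectedin (subtopology X T) S" using assms by (simp add: connectedin_subtopology)
  then have "topspace (subtopology X T) \<noteq> {}" using assms connectedin_subset_topspace by blast
  then obtain C where "C \<in> connected_components_of (subtopology X T)" "S \<subseteq> C"
    using exists_connected_component_of_superset[OF S] by (metis null_topspace_iff_trivial)
  then show thesis by (rule that)
qed

lemma image_Collect_vimage: "f ` A = B \<Longrightarrow> T \<subseteq> B \<Longrightarrow> f ` {x \<in> A. f x \<in> T} = T"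
  by auto

lemma components_eq:
  assumes "C \<in> connected_components_of X" "C' \<in> connected_components_of X" "x \<in> C" "x \<in> C'"
  shows "C = C'"
  using assms connected_components_of_disjoint[of C X C'] by (auto simp: disjnt_def)

text \<open>Points in different fibres are separated downstairs. For two points of one fibre, T1
  gives a neighbourhood of the first that misses the second, the spread condition shrinks it to a
  component over some \<open>W\<close>, and the component of the second point over the same
  \<open>W\<close> is disjoint from it.\<close>

lemma spread_Hausdorff:
  assumes sp: "spread X Z r" and Z: "Hausdorff_space Z"
  shows "Hausdorff_space X"
  unfolding Hausdorff_space_def
proof (intro allI impI)
  fix x y assume xy: "x \<in> topspace X \<and> y \<in> topspace X \<and> x \<noteq> y"
  have r: "continuous_map X Z r" and t1: "t1_space X" using sp by (auto simp: spread_def)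
  show "\<exists>U V. openin X U \<and> openin X V \<and> x \<in> U \<and> y \<in> V \<and> disjnt U V"
  proof (cases "r x = r y")
    case False
    have "r x \<in> topspace Z" "r y \<in> topspace Z" using r xy by (auto simp: continuous_map_def)
    then obtain U V where "openin Z U" "openin Z V" "r x \<in> U" "r y \<in> V" "disjnt U V"
      using Z False unfolding Hausdorff_space_def by meson
    then show ?thesis using xy
      by (intro exI[of _ "{x \<in> topspace X. r x \<in> U}"] exI[of _ "{x \<in> topspace X. r x \<in> V}"] conjI
            openin_continuous_map_preimage[OF r]) (auto simp: disjnt_def)
  next
    case True
    obtain U where U: "openin X U" "x \<in> U" "y \<notin> U" using t1 xy unfolding t1_space_def by blast
    then obtain W C where W: "openin Z W" "C \<in> connected_components_of (subtopology X (preimage_in X r W))" "x \<in> C" "C \<subseteq> U"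
      using sp unfolding spread_def by blast
    then have rx: "r x \<in> W" using component_preimage_open[OF sp W(1,2)] by (auto simp: preimage_in_def)
    obtain C' where C': "C' \<in> connected_components_of (subtopology X (preimage_in X r W))" "{y} \<subseteq> C'"
      by (rule ex_component_superset[of X "{y}" "preimage_in X r W"]) (use xy rx True in \<open>auto simp: preimage_in_def connectedin_sing\<close>)
    then have "disjnt C C'" using connected_components_of_disjoint[OF W(2) C'(1)] W(4) U(3) by auto
    then show ?thesis using component_preimage_open(1)[OF sp W(1)] W C' by blast
  qed
qed

text \<open>A separation of \<open>C \<inter> A\<close> would extend to a separation of
  \<open>C\<close>. Here \<open>D E\<close> is the largest open part of \<open>C\<close> whose trace
  on \<open>A\<close> lies in \<open>E\<close>: local connectedness within \<open>A\<close> makes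
  \<open>D E1\<close> and \<open>D E2\<close> cover \<open>C\<close>, and density of
  \<open>A\<close> makes them disjoint.\<close>

lemma connectedin_Int_dense:
  assumes lc: "locally_connected_within X A" and dense: "X closure_of A = topspace X"
    and C: "openin X C" "connectedin X C"
  shows "connectedin X (C \<inter> A)"
  unfolding connectedin
proof (intro conjI notI)
  have CX: "C \<subseteq> topspace X" by (rule openin_subset[OF C(1)])
  then show "C \<inter> A \<subseteq> topspace X" by auto
  assume "\<exists>E1 E2. openin X E1 \<and> openin X E2 \<and> C \<inter> A \<subseteq> E1 \<union> E2 \<and> E1 \<inter> E2 \<inter> (C \<inter> A) = {} \<and>
            E1 \<inter> (C \<inter> A) \<noteq> {} \<and> E2 \<inter> (C \<inter> A) \<noteq> {}"
  then obtain E1 E2 where E: "openin X E1" "openin X E2" "C \<inter> A \<subseteq> E1 \<union> E2" "E1 \<inter> E2 \<inter> (C \<inter> A) = {}"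
            "E1 \<inter> (C \<inter> A) \<noteq> {}" "E2 \<inter> (C \<inter> A) \<noteq> {}" by blast
  define D where "D E = \<Union>{V. openin X V \<and> V \<subseteq> C \<and> V \<inter> A \<subseteq> E}" for E
  have Dop: "openin X (D E)" for E unfolding D_def by (rule openin_Union) blast
  have DC: "D E \<subseteq> C" "D E \<inter> A \<subseteq> E" for E unfolding D_def by auto
  have cover: "C \<subseteq> D E1 \<union> D E2"
  proof
    fix x assume x: "x \<in> C"
    obtain V where V: "openin X V" "x \<in> V" "V \<subseteq> C" "connectedin X (V \<inter> A)"
      using lc C(1) x unfolding locally_connected_within_def by blast
    have "V \<inter> A \<subseteq> E1 \<union> E2" "E1 \<inter> E2 \<inter> (V \<inter> A) = {}" using V(3) E(3,4) by auto
    then have "E1 \<inter> (V \<inter> A) = {} \<or> E2 \<inter> (V \<inter> A) = {}"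
      using V(4) E(1,2) unfolding connectedin by blast
    then have "V \<inter> A \<subseteq> E1 \<or> V \<inter> A \<subseteq> E2" using \<open>V \<inter> A \<subseteq> E1 \<union> E2\<close> by blast
    then show "x \<in> D E1 \<union> D E2" using V(1,2,3) unfolding D_def by blast
  qed
  have disj: "D E1 \<inter> D E2 = {}"
  proof (rule ccontr)
    assume "D E1 \<inter> D E2 \<noteq> {}"
    then have "A \<inter> (D E1 \<inter> D E2) \<noteq> {}"
      using dense Dop unfolding dense_intersects_open by blast
    then show False using DC E(4) by blast
  qed
  have "D E1 \<inter> C \<noteq> {}" "D E2 \<inter> C \<noteq> {}" using E(4-6) cover DC by blast+
  then show False using C(2) cover disj Dop unfolding connectedin by blast
qed

text \<open>Fox's completion argument: near a missing point the values of \<open>s0\<close> single out one component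
  over every neighbourhood, and completeness provides the limit.\<close>

lemma complete_spread_extend:
  fixes P D D0 :: "'a::metric_space set"
  assumes cs: "complete_spread X (top_of_set P) q" and D: "D \<subseteq> P" "D0 \<subseteq> D"
    and s0: "continuous_map (top_of_set D0) X s0" "\<And>x. x \<in> D0 \<Longrightarrow> q (s0 x) = x"
    and loc: "\<And>y e. y \<in> D \<Longrightarrow> e > 0 \<Longrightarrow> D0 \<inter> ball y e \<noteq> {} \<and> connected (D0 \<inter> ball y e)"
  obtains s where "continuous_map (top_of_set D) X s" "\<And>x. x \<in> D \<Longrightarrow> q (s x) = x"
    "\<And>x. x \<in> D0 \<Longrightarrow> s x = s0 x"
proof -
  let ?P = "top_of_set P"
  define comps where "comps W = connected_components_of (subtopology X (preimage_in X q W))" for W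
  have sp: "spread X ?P q" using cs by (simp add: complete_spread_def)
  have t1: "t1_space X" using sp by (simp add: spread_def)
  have s0X: "s0 x \<in> topspace X" if "x \<in> D0" for x using s0(1) that by (auto simp: continuous_map_def)
  \<comment> \<open>\<open>M\<close> is the component over \<open>W\<close> into which
    \<open>s0\<close> sends all points of \<open>D0\<close> near \<open>y\<close>. There is only
    one, because two punctured or full neighbourhoods of \<open>y\<close> share a point of
    \<open>D0\<close>.\<close>
  define good where "good y W M \<longleftrightarrow> M \<in> comps W \<and> (\<exists>e>0. s0 ` (D0 \<inter> ball y e) \<subseteq> M)" for y W M
  have ex: "\<exists>M. good y W M" if y: "y \<in> D" "openin ?P W" "y \<in> W" for y W
  proof -
    obtain e where e: "e > 0" "ball y e \<inter> P \<subseteq> W" using y by (meson openin_contains_ball)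
    have "connectedin (top_of_set D0) (D0 \<inter> ball y e)"
      using loc[OF y(1) e(1)] by (simp add: connectedin_subtopology)
    then have "connectedin X (s0 ` (D0 \<inter> ball y e))"
      by (rule connectedin_continuous_map_image[OF s0(1)])
    moreover have "s0 ` (D0 \<inter> ball y e) \<subseteq> preimage_in X q W"
    proof
      fix z assume "z \<in> s0 ` (D0 \<inter> ball y e)"
      then obtain x where x: "x \<in> D0" "x \<in> ball y e" "z = s0 x" by blast
      then have "x \<in> W" using e D by blast
      then show "z \<in> preimage_in X q W" using x s0(2) s0X by (simp add: preimage_in_def)
    qed
    ultimately obtain M where "M \<in> comps W" "s0 ` (D0 \<inter> ball y e) \<subseteq> M"
      unfolding comps_def using loc[OF y(1) e(1)] ex_component_superset by (metis image_is_empty)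
    then show ?thesis using e unfolding good_def by blast
  qed
  have meet: "\<exists>x\<in>D0. s0 x \<in> M \<and> s0 x \<in> M'" if g: "good y W M" "good y W' M'" and y: "y \<in> D" for y W W' M M'
  proof -
    obtain e e' where e: "e > 0" "s0 ` (D0 \<inter> ball y e) \<subseteq> M" "e' > 0" "s0 ` (D0 \<inter> ball y e') \<subseteq> M'"
      using g unfolding good_def by metis
    have "D0 \<inter> ball y (min e e') \<noteq> {}" using loc[OF y, of "min e e'"] e by simp
    then obtain x where "x \<in> D0" "x \<in> ball y e" "x \<in> ball y e'" by auto
    then show ?thesis using e by blast
  qed
  have uniq: "M = M'" if "good y W M" "good y W M'" "y \<in> D" for y W M M'
    using meet[OF that] that components_eq unfolding good_def comps_def by metis
  define N where "N y W = (SOME M. good y W M)" for y W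
  have N: "good y W (N y W)" if "y \<in> D" "openin ?P W" "y \<in> W" for y W
    unfolding N_def using ex[OF that] by (rule someI_ex)
  have mono: "N y W \<subseteq> N y W'" if "y \<in> D" "openin ?P W" "y \<in> W" "openin ?P W'" "W \<subseteq> W'" for y W W'
  proof -
    have g: "good y W (N y W)" "good y W' (N y W')" using N that by auto
    have c: "N y W \<in> comps W" "N y W' \<in> comps W'" using g by (auto simp: good_def)
    have "preimage_in X q W \<subseteq> preimage_in X q W'" using that(5) by (auto simp: preimage_in_def)
    then have "connectedin (subtopology X (preimage_in X q W')) (N y W)"
      using component_preimage_open[OF sp that(2) c(1)[unfolded comps_def]] by (auto simp: connectedin_subtopology)
    then show ?thesis
      using connected_components_of_maximal[OF c(2)[unfolded comps_def]] meet[OF g that(1)] by (auto simp: disjnt_def)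
  qed
  have "\<exists>x. \<forall>W. openin ?P W \<and> y \<in> W \<longrightarrow> x \<in> N y W" if "y \<in> D" for y
  proof -
    have "(\<Inter>W \<in> {W. openin ?P W \<and> y \<in> W}. N y W) \<noteq> {}"
    proof -
      have "y \<in> topspace ?P" using that D by auto
      moreover have "\<forall>W. openin ?P W \<and> y \<in> W \<longrightarrow> N y W \<in> connected_components_of (subtopology X (preimage_in X q W))"
        using N that unfolding good_def comps_def by blast
      moreover have "\<forall>W W'. openin ?P W \<and> openin ?P W' \<and> y \<in> W \<and> W \<subseteq> W' \<longrightarrow> N y W \<subseteq> N y W'"
        using mono that by blast
      ultimately show ?thesis using cs unfolding complete_spread_def by blast
    qed
    then show ?thesis by auto
  qed
  then obtain s where s: "\<And>y W. y \<in> D \<Longrightarrow> openin ?P W \<Longrightarrow> y \<in> W \<Longrightarrow> s y \<in> N y W" by metis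
  have sX: "s y \<in> topspace X \<and> q (s y) = y" if y: "y \<in> D" for y
  proof -
    have sub: "s y \<in> preimage_in X q W" if "openin ?P W" "y \<in> W" for W
      using s[OF y that] component_preimage_open(3)[OF sp that(1)] N[OF y that] by (auto simp: good_def comps_def)
    have "s y \<in> topspace X" using sub[of P] y D by (auto simp: preimage_in_def)
    moreover have "q (s y) = y"
    proof (rule ccontr)
      assume neq: "q (s y) \<noteq> y"
      \<comment> \<open>Points are closed in the base, so deleting \<open>q (s y)\<close> leaves a
        neighbourhood of \<open>y\<close> to test against.\<close>
      have "openin ?P (P - {q (s y)})" by (simp add: openin_delete)
      then show False using sub[of "P - {q (s y)}"] y D neq by (auto simp: preimage_in_def)
    qed
    ultimately show ?thesis by simp
  qed
  \<comment> \<open>By the spread condition \<open>s y\<close> has arbitrarily small components as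
    neighbourhoods, and the one over \<open>W\<close> must be \<open>N y W\<close>. Both the
    agreement with \<open>s0\<close> and the continuity of \<open>s\<close> come from this.\<close>
  have near: "\<exists>W M. openin ?P W \<and> y \<in> W \<and> good y W M \<and> s y \<in> M \<and> M \<subseteq> U" if y: "y \<in> D" "openin X U" "s y \<in> U" for y U
  proof -
    obtain W M where W: "openin ?P W" "M \<in> comps W" "s y \<in> M" "M \<subseteq> U"
      using sp y unfolding spread_def comps_def by blast
    have "s y \<in> preimage_in X q W" using component_preimage_open(3)[OF sp W(1)] W by (auto simp: comps_def)
    then have yW: "y \<in> W" using sX[OF y(1)] by (auto simp: preimage_in_def)
    have "N y W = M"
      by (rule components_eq[of _ "subtopology X (preimage_in X q W)" _ "s y"])
         (use N[OF y(1) W(1) yW] W s[OF y(1) W(1) yW] in \<open>auto simp: good_def comps_def\<close>)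
    then show ?thesis using W yW N[OF y(1) W(1) yW] by metis
  qed
  have eq: "s y = s0 y" if y: "y \<in> D0" for y
  proof (rule ccontr)
    assume neq: "s y \<noteq> s0 y"
    have yD: "y \<in> D" using y D by auto
    obtain U where U: "openin X U" "s y \<in> U" "s0 y \<notin> U"
      using t1 s0X[OF y] sX[OF yD] neq unfolding t1_space_def by blast
    obtain W M where "good y W M" "M \<subseteq> U" using near[OF yD U(1,2)] by blast
    then show False using U y unfolding good_def by (metis IntI centre_in_ball imageI subsetD)
  qed
  have "continuous_map (top_of_set D) X s"
    unfolding continuous_map_def
  proof (intro conjI allI impI)
    show "s \<in> topspace (top_of_set D) \<rightarrow> topspace X" using sX by auto
    fix U assume U: "openin X U"
    show "openin (top_of_set D) {x \<in> topspace (top_of_set D). s x \<in> U}"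
      unfolding openin_contains_ball
    proof (intro conjI ballI)
      fix y assume "y \<in> {x \<in> topspace (top_of_set D). s x \<in> U}"
      then have y: "y \<in> D" "s y \<in> U" by auto
      obtain W M where W: "openin ?P W" "y \<in> W" "good y W M" "M \<subseteq> U" using near[OF y(1) U y(2)] by blast
      obtain e1 where e1: "e1 > 0" "ball y e1 \<inter> P \<subseteq> W" using W by (meson openin_contains_ball)
      obtain e2 where e2: "e2 > 0" "s0 ` (D0 \<inter> ball y e2) \<subseteq> M" and M: "M \<in> comps W" using W(3) unfolding good_def by blast
      have "s y' \<in> U" if y': "y' \<in> D" "dist y y' < min e1 e2" for y'
      proof -
        have W': "y' \<in> W" using y' e1 D by auto
        have "ball y' (e2 - dist y y') \<subseteq> ball y e2" by (auto simp: dist_commute) (metis dist_commute dist_triangle add.commute less_diff_eq order_le_less_trans add_less_cancel_left diff_add_cancel)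
        \<comment> \<open>A ball around \<open>y'\<close> lies in the ball around \<open>y\<close>,
          so the same component is selected at all nearby points of \<open>D\<close>.\<close>
        then have "good y' W M" unfolding good_def using M e2 y'
          by (intro conjI exI[of _ "e2 - dist y y'"]) auto
        then have "N y' W = M" using uniq[OF N[OF y'(1) W(1) W']] y' by auto
        then show ?thesis using s[OF y'(1) W(1) W'] W(4) by auto
      qed
      then show "\<exists>e>0. ball y e \<inter> D \<subseteq> {x \<in> topspace (top_of_set D). s x \<in> U}"
        using e1 e2 by (intro exI[of _ "min e1 e2"]) auto
    qed auto
  qed
  then show thesis using that[of s] sX eq by blast
qed

section \<open>Invariance of branched covers\<close>

text \<open>Of \<open>p\<close> only the range is prescribed: its continuity and its properties as a
  spread, a covering or a branched cover are transferred from \<open>r\<close> along the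
  square.\<close>

definition cover_iso where
  "cover_iso X' Z' p X Z r \<Phi> \<Psi> \<longleftrightarrow> homeomorphic_map X' X \<Phi> \<and> homeomorphic_map Z' Z \<Psi> \<and>
     p \<in> topspace X' \<rightarrow> topspace Z' \<and> (\<forall>x\<in>topspace X'. r (\<Phi> x) = \<Psi> (p x))"

lemma cover_iso_sym:
  assumes "cover_iso X' Z' p X Z r \<Phi> \<Psi>"
  obtains \<Phi>' \<Psi>' where "cover_iso X Z r X' Z' p \<Phi>' \<Psi>'" "\<And>z. z \<in> topspace Z \<Longrightarrow> \<Psi> (\<Psi>' z) = z"
proof -
  obtain \<Phi>' \<Psi>' where P: "homeomorphic_maps X' X \<Phi> \<Phi>'" "homeomorphic_maps Z' Z \<Psi> \<Psi>'"
    using assms unfolding cover_iso_def homeomorphic_map_maps by blast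
  have h: "homeomorphic_map X X' \<Phi>'" "homeomorphic_map Z Z' \<Psi>'"
    and inv: "\<And>x. x \<in> topspace X \<Longrightarrow> \<Phi> (\<Phi>' x) = x" "\<And>z. z \<in> topspace Z' \<Longrightarrow> \<Psi>' (\<Psi> z) = z"
      "\<And>z. z \<in> topspace Z \<Longrightarrow> \<Psi> (\<Psi>' z) = z"
    using P unfolding homeomorphic_maps_map by auto
  have X': "\<Phi>' x \<in> topspace X'" if "x \<in> topspace X" for x
    using h(1) that homeomorphic_imp_surjective_map by blast
  have rx: "r x = \<Psi> (p (\<Phi>' x))" "p (\<Phi>' x) \<in> topspace Z'" if "x \<in> topspace X" for x
    using assms X'[OF that] inv(1)[OF that] unfolding cover_iso_def by (metis, auto)
  have "\<Psi> z \<in> topspace Z" if "z \<in> topspace Z'" for z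
    using assms that homeomorphic_imp_surjective_map unfolding cover_iso_def by blast
  then have "cover_iso X Z r X' Z' p \<Phi>' \<Psi>'"
    unfolding cover_iso_def using h rx inv by auto
  then show thesis using that inv by blast
qed

context
  fixes X' Z' p X Z r \<Phi> \<Psi>
  assumes iso: "cover_iso X' Z' p X Z r \<Phi> \<Psi>"
begin

lemma cover_isoD:
  shows "homeomorphic_map X' X \<Phi>" "homeomorphic_map Z' Z \<Psi>"
    "\<And>x. x \<in> topspace X' \<Longrightarrow> p x \<in> topspace Z'" "\<And>x. x \<in> topspace X' \<Longrightarrow> r (\<Phi> x) = \<Psi> (p x)"
    "\<Phi> ` topspace X' = topspace X" "\<Psi> ` topspace Z' = topspace Z"
    "inj_on \<Phi> (topspace X')" "inj_on \<Psi> (topspace Z')"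
  using iso unfolding cover_iso_def
  by (auto dest: homeomorphic_imp_surjective_map homeomorphic_imp_injective_map)

lemma cover_iso_continuous: "continuous_map X' Z' p \<longleftrightarrow> continuous_map X Z r"
proof -
  obtain \<Psi>' where P: "homeomorphic_maps Z' Z \<Psi> \<Psi>'" using cover_isoD(2) unfolding homeomorphic_map_maps by blast
  obtain \<Phi>' where Q: "homeomorphic_maps X' X \<Phi> \<Phi>'" using cover_isoD(1) unfolding homeomorphic_map_maps by blast
  have "continuous_map X' Z' p" if "continuous_map X Z r"
  proof (rule continuous_map_eq)
    show "continuous_map X' Z' (\<Psi>' \<circ> (r \<circ> \<Phi>))"
      using that P Q by (auto simp: homeomorphic_maps_def intro!: continuous_map_compose)
    show "(\<Psi>' \<circ> (r \<circ> \<Phi>)) x = p x" if "x \<in> topspace X'" for x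
      using that P cover_isoD(3,4)[OF that] by (auto simp: homeomorphic_maps_def)
  qed
  moreover have "continuous_map X Z r" if "continuous_map X' Z' p"
  proof (rule continuous_map_eq)
    show "continuous_map X Z (\<Psi> \<circ> (p \<circ> \<Phi>'))"
      using that P Q by (auto simp: homeomorphic_maps_def intro!: continuous_map_compose)
    show "(\<Psi> \<circ> (p \<circ> \<Phi>')) x = r x" if "x \<in> topspace X" for x
    proof -
      have "\<Phi>' x \<in> topspace X'" "\<Phi> (\<Phi>' x) = x" using that Q by (auto simp: homeomorphic_maps_def continuous_map_def)
      then show ?thesis using cover_isoD(4)[of "\<Phi>' x"] by simp
    qed
  qed
  ultimately show ?thesis by blast
qed

lemma cover_iso_preimage:
  assumes "W \<subseteq> topspace Z'"
  shows "homeomorphic_map (subtopology X' (preimage_in X' p W)) (subtopology X (preimage_in X r (\<Psi> ` W))) \<Phi>"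
    "\<Phi> ` preimage_in X' p W = preimage_in X r (\<Psi> ` W)"
proof -
  have *: "\<Phi> x \<in> preimage_in X r (\<Psi> ` W) \<longleftrightarrow> x \<in> preimage_in X' p W" if "x \<in> topspace X'" for x
  proof -
    have "\<Psi> (p x) \<in> \<Psi> ` W \<longleftrightarrow> p x \<in> W"
      using assms cover_isoD(3)[OF that] cover_isoD(8) by (meson inj_on_image_mem_iff)
    moreover have "\<Phi> x \<in> topspace X" using that cover_isoD(5) by blast
    ultimately show ?thesis using that cover_isoD(4)[OF that] by (simp add: preimage_in_def)
  qed
  then show "homeomorphic_map (subtopology X' (preimage_in X' p W)) (subtopology X (preimage_in X r (\<Psi> ` W))) \<Phi>"
    by (intro homeomorphic_map_subtopologies_alt[OF cover_isoD(1)]) auto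
  show "\<Phi> ` preimage_in X' p W = preimage_in X r (\<Psi> ` W)"
  proof (intro subset_antisym subsetI)
    fix x assume "x \<in> \<Phi> ` preimage_in X' p W"
    then show "x \<in> preimage_in X r (\<Psi> ` W)" using * by (auto simp: preimage_in_def)
  next
    fix x assume x: "x \<in> preimage_in X r (\<Psi> ` W)"
    then obtain x' where "x' \<in> topspace X'" "x = \<Phi> x'" using cover_isoD(5) by (auto simp: preimage_in_def)
    then show "x \<in> \<Phi> ` preimage_in X' p W" using * x by auto
  qed
qed

lemma cover_iso_subtopology:
  assumes "W \<subseteq> topspace Z'"
  shows "cover_iso (subtopology X' (preimage_in X' p W)) (subtopology Z' W) p
     (subtopology X (preimage_in X r (\<Psi> ` W))) (subtopology Z (\<Psi> ` W)) r \<Phi> \<Psi>"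
  unfolding cover_iso_def
proof (intro conjI ballI)
  show "homeomorphic_map (subtopology Z' W) (subtopology Z (\<Psi> ` W)) \<Psi>"
    by (rule homeomorphic_map_subtopologies[OF cover_isoD(2)])
       (use assms cover_isoD(6) in \<open>auto simp: Int_absorb1\<close>)
qed (use cover_iso_preimage[OF assms] cover_isoD(3,4) in \<open>auto simp: preimage_in_def\<close>)

lemma cover_iso_covering_map:
  assumes cov: "covering_map X Z r"
  shows "covering_map X' Z' p"
  unfolding covering_map_def
proof (intro conjI ballI)
  show "continuous_map X' Z' p" using cov cover_iso_continuous by (simp add: covering_map_def)
  show "p ` topspace X' = topspace Z'"
  proof (intro subset_antisym subsetI)
    fix z assume z: "z \<in> topspace Z'"
    then have "\<Psi> z \<in> topspace Z" using cover_isoD(6) by blast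
    then obtain x where "x \<in> topspace X'" "r (\<Phi> x) = \<Psi> z"
      using cov cover_isoD(5) unfolding covering_map_def by (metis imageE)
    then have "p x = z" using cover_isoD(3,4,8) z by (metis inj_onD)
    then show "z \<in> p ` topspace X'" using \<open>x \<in> topspace X'\<close> by auto
  qed (use cover_isoD(3) in auto)
  fix z assume z: "z \<in> topspace Z'"
  then have "\<Psi> z \<in> topspace Z" using cover_isoD(6) by blast
  from covering_mapE[OF cov this] obtain T \<V> where T: "openin Z T" "\<Psi> z \<in> T"
    and V: "\<Union>\<V> = preimage_in X r T" "\<And>U. U \<in> \<V> \<Longrightarrow> openin X U" "pairwise disjnt \<V>"
      "\<And>U. U \<in> \<V> \<Longrightarrow> homeomorphic_map (subtopology X U) (subtopology Z T) r"
    by metis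
  define T' where "T' = {z \<in> topspace Z'. \<Psi> z \<in> T}"
  define pull where "pull U = {x \<in> topspace X'. \<Phi> x \<in> U}" for U
  have \<Psi>c: "continuous_map Z' Z \<Psi>" and \<Phi>c: "continuous_map X' X \<Phi>"
    using cover_isoD(1,2) homeomorphic_imp_continuous_map by auto
  have T'im: "\<Psi> ` T' = T" unfolding T'_def by (rule image_Collect_vimage[OF cover_isoD(6) openin_subset[OF T(1)]])
  have T'Z: "T' \<subseteq> topspace Z'" by (auto simp: T'_def)
  have "openin Z' T'" unfolding T'_def by (rule openin_continuous_map_preimage[OF \<Psi>c T(1)])
  moreover have "z \<in> T'" using z T by (simp add: T'_def)
  moreover have "\<Union>(pull ` \<V>) = preimage_in X' p T'"
  proof -
    have "\<Union>(pull ` \<V>) = {x \<in> topspace X'. \<Phi> x \<in> preimage_in X r T}"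
      unfolding V(1)[symmetric] pull_def by blast
    also have "\<dots> = preimage_in X' p T'"
      using cover_isoD(3,4,5) unfolding preimage_in_def T'_def by auto
    finally show ?thesis .
  qed
  moreover have "\<forall>U\<in>pull ` \<V>. openin X' U"
    unfolding pull_def using V(2) openin_continuous_map_preimage[OF \<Phi>c] by blast
  moreover have "pairwise disjnt (pull ` \<V>)"
    using V(3) unfolding pairwise_def disjnt_def pull_def by blast
  moreover have "homeomorphic_map (subtopology X' (pull U)) (subtopology Z' T') p" if U: "U \<in> \<V>" for U
  proof -
    obtain \<Psi>' where P: "homeomorphic_maps Z' Z \<Psi> \<Psi>'" using cover_isoD(2) unfolding homeomorphic_map_maps by blast
    have P': "homeomorphic_map Z Z' \<Psi>'" "\<And>z. z \<in> topspace Z' \<Longrightarrow> \<Psi>' (\<Psi> z) = z"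
      using P unfolding homeomorphic_maps_map by auto
    have UX: "U \<subseteq> topspace X" using V(2)[OF U] openin_subset by auto
    have "\<Phi> ` pull U = U" unfolding pull_def by (rule image_Collect_vimage[OF cover_isoD(5) UX])
    then have 1: "homeomorphic_map (subtopology X' (pull U)) (subtopology X U) \<Phi>"
      by (intro homeomorphic_map_subtopologies[OF cover_isoD(1)])
        (use UX in \<open>auto simp: pull_def Int_absorb1\<close>)
    have "\<Psi>' ` T = T'" unfolding T'im[symmetric] using P'(2) T'Z by force
    then have 2: "homeomorphic_map (subtopology Z T) (subtopology Z' T') \<Psi>'"
      by (intro homeomorphic_map_subtopologies[OF P'(1)])
        (use openin_subset[OF T(1)] T'Z in \<open>auto simp: Int_absorb1\<close>)
    show ?thesis
    proof (rule homeomorphic_map_eq)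
      show "homeomorphic_map (subtopology X' (pull U)) (subtopology Z' T') (\<Psi>' \<circ> (r \<circ> \<Phi>))"
        using homeomorphic_map_compose[OF homeomorphic_map_compose[OF 1 V(4)[OF U]] 2] .
      show "(\<Psi>' \<circ> (r \<circ> \<Phi>)) x = p x" if "x \<in> topspace (subtopology X' (pull U))" for x
        using that cover_isoD(3,4) P'(2) by auto
    qed
  qed
  ultimately show "\<exists>T. openin Z' T \<and> z \<in> T \<and> (\<exists>\<V>. \<Union>\<V> = preimage_in X' p T \<and> (\<forall>U\<in>\<V>. openin X' U) \<and>
      pairwise disjnt \<V> \<and> (\<forall>U\<in>\<V>. homeomorphic_map (subtopology X' U) (subtopology Z' T) p))"
    by blast
qed

lemma cover_iso_spread:
  assumes sp: "spread X Z r"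
  shows "spread X' Z' p"
proof -
  have hs: "X' homeomorphic_space X" "Z' homeomorphic_space Z"
    using cover_isoD(1,2) homeomorphic_map_imp_homeomorphic_space by blast+
  have \<Psi>c: "continuous_map Z' Z \<Psi>" using cover_isoD(2) homeomorphic_imp_continuous_map by auto
  have "\<exists>W. openin Z' W \<and> (\<exists>C \<in> connected_components_of (subtopology X' (preimage_in X' p W)). x \<in> C \<and> C \<subseteq> U)"
    if U: "openin X' U" "x \<in> U" for U x
  proof -
    have UX: "U \<subseteq> topspace X'" using U openin_subset by auto
    have "openin X (\<Phi> ` U)" using U homeomorphic_map_openness_eq[OF cover_isoD(1)] by blast
    moreover have "\<Phi> x \<in> \<Phi> ` U" using U by blast
    ultimately obtain W C where W: "openin Z W" "C \<in> connected_components_of (subtopology X (preimage_in X r W))"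
      "\<Phi> x \<in> C" "C \<subseteq> \<Phi> ` U" using sp unfolding spread_def by blast
    define W' where "W' = {z \<in> topspace Z'. \<Psi> z \<in> W}"
    have W'im: "\<Psi> ` W' = W" unfolding W'_def by (rule image_Collect_vimage[OF cover_isoD(6) openin_subset[OF W(1)]])
    have "W' \<subseteq> topspace Z'" by (auto simp: W'_def)
    from homeomorphic_map_connected_components_of[OF cover_iso_preimage(1)[OF this]]
    obtain C' where C': "C' \<in> connected_components_of (subtopology X' (preimage_in X' p W'))" "C = \<Phi> ` C'"
      using W(2) unfolding W'im by auto
    have "C' \<subseteq> topspace X'" using connected_components_of_subset[OF C'(1)] by auto
    then have "x \<in> C'" "C' \<subseteq> U"
      using W(3,4) cover_isoD(7) UX U C'(2) by (meson inj_on_image_mem_iff subsetD, meson inj_on_image_subset_iff)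
    then show ?thesis using C'(1) openin_continuous_map_preimage[OF \<Psi>c W(1)] unfolding W'_def by blast
  qed
  then show ?thesis
    using sp cover_iso_continuous homeomorphic_locally_connected_space[OF hs(1)] homeomorphic_t1_space[OF hs(1)]
      homeomorphic_locally_connected_space[OF hs(2)] homeomorphic_t1_space[OF hs(2)]
    unfolding spread_def by blast
qed

text \<open>A nested choice of components \<open>C'\<close> around \<open>z\<close> becomes a nested
  choice around the image of \<open>z\<close>, namely the \<Phi>-images of the components
  \<open>C' (pull W)\<close>. Completeness of \<open>r\<close> yields a common point, which is
  pulled back by \<Phi>.\<close>

lemma cover_iso_complete_spread:
  assumes cs: "complete_spread X Z r"
  shows "complete_spread X' Z' p"
  unfolding complete_spread_def
proof (intro conjI ballI allI impI)
  show sp: "spread X' Z' p" using cover_iso_spread cs by (simp add: complete_spread_def)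
  have \<Psi>c: "continuous_map Z' Z \<Psi>" using cover_isoD(2) homeomorphic_imp_continuous_map by auto
  fix z C'
  assume z: "z \<in> topspace Z'" and "(\<forall>W. openin Z' W \<and> z \<in> W \<longrightarrow>
           C' W \<in> connected_components_of (subtopology X' (preimage_in X' p W))) \<and>
        (\<forall>W W'. openin Z' W \<and> openin Z' W' \<and> z \<in> W \<and> W \<subseteq> W' \<longrightarrow> C' W \<subseteq> C' W')"
  then have C': "\<And>W. openin Z' W \<Longrightarrow> z \<in> W \<Longrightarrow> C' W \<in> connected_components_of (subtopology X' (preimage_in X' p W))"
    "\<And>W W'. openin Z' W \<Longrightarrow> openin Z' W' \<Longrightarrow> z \<in> W \<Longrightarrow> W \<subseteq> W' \<Longrightarrow> C' W \<subseteq> C' W'" by blast+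
  define pull where "pull W = {z \<in> topspace Z'. \<Psi> z \<in> W}" for W
  have pull: "openin Z' (pull W)" if "openin Z W" for W
    unfolding pull_def by (rule openin_continuous_map_preimage[OF \<Psi>c that])
  have pullZ: "pull W \<subseteq> topspace Z'" for W by (auto simp: pull_def)
  have pull_im: "\<Psi> ` pull W = W" if "openin Z W" for W
    unfolding pull_def by (rule image_Collect_vimage[OF cover_isoD(6) openin_subset[OF that]])
  have im_pull: "pull (\<Psi> ` W) = W" if "W \<subseteq> topspace Z'" for W
    using that cover_isoD(8) unfolding pull_def by (auto simp: inj_on_def)
  have \<Psi>z: "\<Psi> z \<in> topspace Z" using z cover_isoD(6) by blast
  have "(\<Inter>W \<in> {W. openin Z W \<and> \<Psi> z \<in> W}. \<Phi> ` C' (pull W)) \<noteq> {}"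
  proof -
    have "\<Phi> ` C' (pull W) \<in> connected_components_of (subtopology X (preimage_in X r W))" if "openin Z W" "\<Psi> z \<in> W" for W
    proof -
      have "z \<in> pull W" using z that by (simp add: pull_def)
      then have "C' (pull W) \<in> connected_components_of (subtopology X' (preimage_in X' p (pull W)))"
        using C'(1) pull that by blast
      then show ?thesis
        using homeomorphic_map_connected_components_of[OF cover_iso_preimage(1)[OF pullZ[of W]]]
        unfolding pull_im[OF that(1)] by blast
    qed
    moreover have "\<Phi> ` C' (pull W) \<subseteq> \<Phi> ` C' (pull W')" if "openin Z W" "openin Z W'" "\<Psi> z \<in> W" "W \<subseteq> W'" for W W'
    proof (intro image_mono C'(2) pull that)
      show "z \<in> pull W" "pull W \<subseteq> pull W'" using z that by (auto simp: pull_def)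
    qed
    ultimately show ?thesis using cs \<Psi>z unfolding complete_spread_def
      by (auto dest!: bspec[where x="\<Psi> z"] spec[where x = "\<lambda>W. \<Phi> ` C' (pull W)"])
  qed
  then obtain x where x: "\<And>W. openin Z W \<Longrightarrow> \<Psi> z \<in> W \<Longrightarrow> x \<in> \<Phi> ` C' (pull W)" by blast
  have sub: "C' W \<subseteq> topspace X'" if "openin Z' W" "z \<in> W" for W
    using connected_components_of_subset[OF C'(1)[OF that]] by auto
  have pz: "pull (topspace Z) = topspace Z'" using cover_isoD(6) by (auto simp: pull_def)
  then obtain x' where x': "x' \<in> topspace X'" "x = \<Phi> x'" using x[of "topspace Z"] \<Psi>z sub[of "topspace Z'"] z by auto
  have "x' \<in> C' W" if W: "openin Z' W" "z \<in> W" for W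
  proof -
    have "openin Z (\<Psi> ` W)" using W(1) homeomorphic_map_openness_eq[OF cover_isoD(2)] by blast
    then have "x \<in> \<Phi> ` C' W" using x[of "\<Psi> ` W"] W im_pull[OF openin_subset[OF W(1)]] by auto
    then show ?thesis using x' sub[OF W] cover_isoD(7) by (metis inj_on_image_mem_iff)
  qed
  then show "(\<Inter>W \<in> {W. openin Z' W \<and> z \<in> W}. C' W) \<noteq> {}" by blast
qed

end

text \<open>Closed sets off which \<open>r\<close> is a covering pull back along \<Psi> to closed
  sets off which \<open>p\<close> is one. The opposite inclusion will be this lemma for the inverse
  square.\<close>

lemma cover_iso_branching_subset:
  assumes iso: "cover_iso X' Z' p X Z r \<Phi> \<Psi>"
  shows "\<Psi> ` branching_set X' Z' p \<subseteq> branching_set X Z r"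
proof
  note cover_isoD = cover_isoD[OF iso]
  fix y assume "y \<in> \<Psi> ` branching_set X' Z' p"
  then obtain z where z: "z \<in> branching_set X' Z' p" "y = \<Psi> z" by blast
  have \<Psi>c: "continuous_map Z' Z \<Psi>" using cover_isoD(2) homeomorphic_imp_continuous_map by auto
  have "y \<in> T" if T: "closedin Z T" "covering_off X Z r T" for T
  proof -
    define S where "S = {z \<in> topspace Z'. \<Psi> z \<in> T}"
    have S: "closedin Z' S" unfolding S_def by (rule closedin_continuous_map_preimage[OF \<Psi>c T(1)])
    have "topspace Z' - S = {z \<in> topspace Z'. \<Psi> z \<in> topspace Z - T}" using cover_isoD(6) unfolding S_def by auto
    then have im: "\<Psi> ` (topspace Z' - S) = topspace Z - T"
      using image_Collect_vimage[OF cover_isoD(6), of "topspace Z - T"] by (metis Diff_subset)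
    have "covering_map (subtopology X' (preimage_in X' p (topspace Z' - S))) (subtopology Z' (topspace Z' - S)) p"
      using cover_iso_covering_map[OF cover_iso_subtopology[OF iso, of "topspace Z' - S"]] T(2) im
      unfolding covering_off_def by simp
    then have "z \<in> S" using z(1) S unfolding branching_set_def covering_off_def by blast
    then show ?thesis using z by (simp add: S_def)
  qed
  then show "y \<in> branching_set X Z r" unfolding branching_set_def by blast
qed

lemma cover_iso_locally_connected_within:
  assumes iso: "cover_iso X' Z' p X Z r \<Phi> \<Psi>"
    and "A \<subseteq> topspace X'" and lc: "locally_connected_within X (\<Phi> ` A)"
  shows "locally_connected_within X' A"
  unfolding locally_connected_within_def
proof (intro allI impI)
  note cover_isoD = cover_isoD[OF iso]
  fix U x assume Ux: "openin X' U \<and> x \<in> U"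
  then have U: "openin X (\<Phi> ` U)" "U \<subseteq> topspace X'"
    using homeomorphic_map_openness_eq[OF cover_isoD(1), of U] by auto
  with Ux have "\<Phi> x \<in> \<Phi> ` U" and xX: "x \<in> topspace X'" by auto
  with U(1)
  obtain V where V: "openin X V" "\<Phi> x \<in> V" "V \<subseteq> \<Phi> ` U" "connectedin X (V \<inter> \<Phi> ` A)"
    using lc unfolding locally_connected_within_def by blast
  define V' where "V' = {x \<in> topspace X'. \<Phi> x \<in> V}"
  have im: "\<Phi> ` (V' \<inter> A) = V \<inter> \<Phi> ` A" using assms(2) unfolding V'_def by auto
  have "openin X' V'" unfolding V'_def
    by (rule openin_continuous_map_preimage[OF homeomorphic_imp_continuous_map[OF cover_isoD(1)] V(1)])
  moreover have "x \<in> V'" using xX V by (simp add: V'_def)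
  moreover have "V' \<subseteq> U"
  proof
    fix y assume "y \<in> V'"
    then have "y \<in> topspace X'" "\<Phi> y \<in> \<Phi> ` U" using V by (auto simp: V'_def)
    then show "y \<in> U" using U(2) cover_isoD(7) by (meson inj_on_image_mem_iff)
  qed
  moreover have "connectedin X' (V' \<inter> A)"
    using V(4) im homeomorphic_map_connectedness[OF cover_isoD(1), of "V' \<inter> A"] assms(2) by (simp add: le_infI2)
  ultimately show "\<exists>V. openin X' V \<and> x \<in> V \<and> V \<subseteq> U \<and> connectedin X' (V \<inter> A)" by blast
qed

lemma cover_iso_branching_set:
  assumes iso: "cover_iso X' Z' p X Z r \<Phi> \<Psi>"
  shows "\<Psi> ` branching_set X' Z' p = branching_set X Z r"
proof
  show "\<Psi> ` branching_set X' Z' p \<subseteq> branching_set X Z r" by (rule cover_iso_branching_subset[OF iso])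
  obtain \<Phi>' \<Psi>' where s: "cover_iso X Z r X' Z' p \<Phi>' \<Psi>'" "\<And>z. z \<in> topspace Z \<Longrightarrow> \<Psi> (\<Psi>' z) = z"
    using cover_iso_sym[OF iso] by blast
  show "branching_set X Z r \<subseteq> \<Psi> ` branching_set X' Z' p"
  proof
    fix y assume y: "y \<in> branching_set X Z r"
    then have "\<Psi>' y \<in> branching_set X' Z' p" using cover_iso_branching_subset[OF s(1)] by blast
    moreover have "\<Psi> (\<Psi>' y) = y" using y s(2) closedin_subset[OF closedin_branching_set[of Z X r]] by blast
    ultimately show "y \<in> \<Psi> ` branching_set X' Z' p" by force
  qed
qed

lemma cover_iso_branched_cover:
  assumes iso: "cover_iso X' Z' p X Z r \<Phi> \<Psi>" and br: "branched_cover X Z r"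
  shows "branched_cover X' Z' p"
proof -
  note D = cover_isoD[OF iso]
  define Z0 where "Z0 = topspace Z - branching_set X Z r"
  define Z0' where "Z0' = topspace Z' - branching_set X' Z' p"
  have sub: "branching_set X' Z' p \<subseteq> topspace Z'" using closedin_subset[OF closedin_branching_set] .
  have Z0: "\<Psi> ` Z0' = Z0"
    unfolding Z0_def Z0'_def cover_iso_branching_set[OF iso, symmetric] D(6)[symmetric]
    using D(8) sub by (intro inj_on_image_set_diff) auto
  have Z0s: "Z0' \<subseteq> topspace Z'" by (auto simp: Z0'_def)
  have X0: "\<Phi> ` preimage_in X' p Z0' = preimage_in X r Z0"
    using cover_iso_preimage(2)[OF iso Z0s] Z0 by simp
  have X0s: "preimage_in X' p Z0' \<subseteq> topspace X'" by (auto simp: preimage_in_def)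
  have b: "complete_spread X Z r" "r ` topspace X = topspace Z" "Z closure_of Z0 = topspace Z" "locally_connected_within Z Z0"
    "X closure_of (preimage_in X r Z0) = topspace X" "locally_connected_within X (preimage_in X r Z0)"
    using br unfolding branched_cover_def Let_def Z0_def by auto
  \<comment> \<open>The base, seen as a cover of itself by the identity, lets the transfer lemma for
    subspaces of \<open>X'\<close> serve for \<open>Z0'\<close> as well.\<close>
  have isoZ: "cover_iso Z' Z' id Z Z id \<Psi> \<Psi>" using D(2) by (simp add: cover_iso_def)
  have "Z' closure_of Z0' = topspace Z'"
  proof -
    have "\<Psi> ` (Z' closure_of Z0') = \<Psi> ` topspace Z'"
      using homeomorphic_map_closure_of[OF D(2) Z0s] b(3) D(6) Z0 by simp
    then show ?thesis using D(8) closure_of_subset_topspace by (metis inj_on_image_eq_iff subset_refl)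
  qed
  moreover have "X' closure_of (preimage_in X' p Z0') = topspace X'"
  proof -
    have "\<Phi> ` (X' closure_of (preimage_in X' p Z0')) = \<Phi> ` topspace X'"
      using homeomorphic_map_closure_of[OF D(1) X0s] b(5) D(5) X0 by simp
    then show ?thesis using D(7) closure_of_subset_topspace by (metis inj_on_image_eq_iff subset_refl)
  qed
  moreover have "p ` topspace X' = topspace Z'"
  proof -
    have "\<Psi> ` (p ` topspace X') = r ` (\<Phi> ` topspace X')" using D(4) by (auto simp: image_image)
    also have "\<dots> = \<Psi> ` topspace Z'" using b(2) D(5,6) by simp
    finally show ?thesis using D(3,8) by (metis image_subset_iff inj_on_image_eq_iff subset_refl)
  qed
  moreover have "locally_connected_within Z' Z0'"
    using cover_iso_locally_connected_within[OF isoZ Z0s] b(4) Z0 by simp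
  moreover have "locally_connected_within X' (preimage_in X' p Z0')"
    using cover_iso_locally_connected_within[OF iso X0s] b(6) X0 by simp
  ultimately show ?thesis
    using cover_iso_complete_spread[OF iso b(1)] unfolding branched_cover_def Let_def Z0'_def by blast
qed

section \<open>Faces of geometric simplicial complexes\<close>

locale geometric_complex =
  fixes K :: "'a::euclidean_space set set"
  assumes complex: "simplicial_complex K"
begin

lemma finite_complex: "finite K"
  using complex by (simp add: simplicial_complex_def)

text \<open>Geometry becomes combinatorics of vertex sets here: the extreme points of a simplex are
  the affinely independent points that span it. The empty simplex is included, with dimension
  -1.\<close>

lemma simplex_vertices:
  assumes "\<sigma> \<in> K"
  shows "finite (vertices \<sigma>)" "\<not> affine_dependent (vertices \<sigma>)" "convex hull (vertices \<sigma>) = \<sigma>"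
    "aff_dim \<sigma> = int (card (vertices \<sigma>)) - 1"
proof -
  obtain n where "n simplex \<sigma>" using complex assms by (auto simp: simplicial_complex_def)
  then obtain C where C: "finite C" "\<not> affine_dependent C" "int (card C) = n + 1" "\<sigma> = convex hull C"
    unfolding simplex by blast
  have "vertices \<sigma> = C"
    unfolding vertices_def C(4) extreme_point_of_convex_hull_affine_independent[OF C(2)] by simp
  then show "finite (vertices \<sigma>)" "\<not> affine_dependent (vertices \<sigma>)" "convex hull (vertices \<sigma>) = \<sigma>"
    "aff_dim \<sigma> = int (card (vertices \<sigma>)) - 1"
    using C aff_dim_convex_hull[of C] aff_dim_affine_independent[OF C(2)] by auto
qed

lemma vertices_subset: "\<sigma> \<in> K \<Longrightarrow> vertices \<sigma> \<subseteq> \<sigma>"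
  by (auto simp: vertices_def extreme_point_of_def)

lemma convex_face: "\<sigma> \<in> K \<Longrightarrow> convex \<sigma>"
  using simplex_vertices(3) convex_convex_hull by metis

lemma compact_face: "\<sigma> \<in> K \<Longrightarrow> compact \<sigma>"
  using simplex_vertices(1,3) finite_imp_compact_convex_hull by metis

lemma closed_face: "\<sigma> \<in> K \<Longrightarrow> closed \<sigma>"
  using compact_face compact_imp_closed by blast

lemma face_of_mem: "\<sigma> \<in> K \<Longrightarrow> f face_of \<sigma> \<Longrightarrow> f \<in> K"
  using complex by (auto simp: simplicial_complex_def)

lemma Int_face_of: "f \<in> K \<Longrightarrow> g \<in> K \<Longrightarrow> f \<inter> g face_of f"
  using complex by (auto simp: simplicial_complex_def)

lemma Int_mem: "f \<in> K \<Longrightarrow> g \<in> K \<Longrightarrow> f \<inter> g \<in> K"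
  using Int_face_of face_of_mem by blast

lemma subset_face_of: "f \<in> K \<Longrightarrow> g \<in> K \<Longrightarrow> f \<subseteq> g \<Longrightarrow> f face_of g"
  using Int_face_of[of g f] by (simp add: Int_absorb1)

lemma hull_mem:
  assumes "\<sigma> \<in> K" "S \<subseteq> vertices \<sigma>"
  shows "convex hull S \<in> K" "vertices (convex hull S) = S"
proof -
  have "convex hull S face_of convex hull (vertices \<sigma>)"
    using face_of_convex_hull_affine_independent[OF simplex_vertices(2)[OF assms(1)]] assms(2) by blast
  then show "convex hull S \<in> K" using face_of_mem[OF assms(1)] simplex_vertices(3)[OF assms(1)] by simp
  have "\<not> affine_dependent S" using assms simplex_vertices(2) affine_dependent_subset by blast
  then show "vertices (convex hull S) = S"
    unfolding vertices_def by (simp add: extreme_point_of_convex_hull_affine_independent)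
qed

lemma vertices_face: "f face_of g \<Longrightarrow> vertices f = vertices g \<inter> f"
  unfolding vertices_def by (auto simp: extreme_point_of_face)

lemma vertices_mono: "f \<in> K \<Longrightarrow> g \<in> K \<Longrightarrow> f \<subseteq> g \<Longrightarrow> vertices f \<subseteq> vertices g"
  using vertices_face[OF subset_face_of] by blast

lemma vertices_Int: "f \<in> K \<Longrightarrow> g \<in> K \<Longrightarrow> vertices (f \<inter> g) = vertices f \<inter> vertices g"
  using vertices_face[OF Int_face_of, of f g] vertices_face[OF Int_face_of, of g f] vertices_subset
  by (auto simp: Int_commute)

lemma face_subset_iff: "f \<in> K \<Longrightarrow> g \<in> K \<Longrightarrow> f \<subseteq> g \<longleftrightarrow> vertices f \<subseteq> vertices g"
  using vertices_mono hull_mono[of "vertices f" "vertices g" convex] simplex_vertices(3) by metis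

lemma face_eq_iff: "f \<in> K \<Longrightarrow> g \<in> K \<Longrightarrow> f = g \<longleftrightarrow> vertices f = vertices g"
  using simplex_vertices(3) by metis

lemma vertices_empty_iff: "f \<in> K \<Longrightarrow> vertices f = {} \<longleftrightarrow> f = {}"
  using simplex_vertices(3)[of f] by auto

lemma card_vertices_mono: "f \<in> K \<Longrightarrow> g \<in> K \<Longrightarrow> f \<subset> g \<Longrightarrow> card (vertices f) < card (vertices g)"
  using face_subset_iff face_eq_iff simplex_vertices(1) by (metis psubset_card_mono psubset_eq)

text \<open>The face \<open>f \<inter> g\<close> of \<open>f\<close> contains a relative interior
  point of \<open>f\<close>, hence is all of \<open>f\<close>.\<close>

lemma rel_interior_subset_face:
  assumes "f \<in> K" "g \<in> K" "x \<in> rel_interior f" "x \<in> g"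
  shows "f \<subseteq> g"
proof -
  have "x \<in> f" using assms(3) rel_interior_subset by blast
  then have "f \<subseteq> f \<inter> g" using subset_of_face_of[OF Int_face_of[OF assms(1,2)], of f] assms by auto
  then show ?thesis by blast
qed

lemma barycenter_rel_interior:
  assumes "f \<in> K" "f \<noteq> {}"
  shows "barycenter f \<in> rel_interior f"
proof -
  let ?V = "vertices f"
  have fin: "finite ?V" and ne: "?V \<noteq> {}" using assms simplex_vertices vertices_empty_iff by auto
  then have c: "card ?V > 0" by (simp add: card_gt_0_iff)
  have "barycenter f \<in> rel_interior (convex hull ?V)"
    unfolding rel_interior_convex_hull_explicit[OF simplex_vertices(2)[OF assms(1)]] barycenter_def
    by (rule CollectI, rule exI[of _ "\<lambda>_. 1 / real (card ?V)"])
       (use c in \<open>auto simp: scaleR_sum_right divide_inverse_commute scaleR_conv_of_real\<close>)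
  then show ?thesis using simplex_vertices(3)[OF assms(1)] by simp
qed

lemma barycenter_mem: "f \<in> K \<Longrightarrow> f \<noteq> {} \<Longrightarrow> barycenter f \<in> f"
  using barycenter_rel_interior rel_interior_subset by blast

text \<open>The carrier of \<open>y\<close>, obtained as a face through \<open>y\<close> with the
  fewest vertices: intersecting it with another face through \<open>y\<close> cannot make it
  smaller. It reduces questions about the faces at a point to inclusions between faces.\<close>

lemma carrier_exists:
  assumes "y \<in> \<Union>K"
  obtains f where "f \<in> K" "\<And>g. g \<in> K \<Longrightarrow> y \<in> g \<longleftrightarrow> f \<subseteq> g"
proof -
  obtain h where "h \<in> K \<and> y \<in> h" using assms by blast
  then obtain f where f: "f \<in> K" "y \<in> f" and
    least: "\<And>g. g \<in> K \<Longrightarrow> y \<in> g \<Longrightarrow> card (vertices f) \<le> card (vertices g)"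
    using ex_has_least_nat[of "\<lambda>h. h \<in> K \<and> y \<in> h" h "card \<circ> vertices"] by auto
  have "f \<subseteq> g" if g: "g \<in> K" "y \<in> g" for g
  proof (rule ccontr)
    assume "\<not> f \<subseteq> g"
    then have "f \<inter> g \<subset> f" by blast
    then have "card (vertices (f \<inter> g)) < card (vertices f)" using card_vertices_mono Int_mem f g by blast
    then show False using least[of "f \<inter> g"] Int_mem f g by auto
  qed
  then show thesis using that[of f] f by blast
qed

lemma facet_exists:
  assumes "g \<in> K"
  obtains \<sigma> where "\<sigma> \<in> facets K" "g \<subseteq> \<sigma>"
proof -
  obtain \<sigma> where "\<sigma> \<in> K" "g \<subseteq> \<sigma>" "\<And>\<tau>. \<tau> \<in> K \<Longrightarrow> \<sigma> \<subseteq> \<tau> \<Longrightarrow> \<sigma> = \<tau>"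
    using finite_has_maximal2[OF finite_complex assms] by metis
  then show thesis using that[of \<sigma>] by (auto simp: facets_def)
qed

lemma facet_at: "y \<in> \<Union>K \<Longrightarrow> \<exists>\<sigma>\<in>facets K. y \<in> \<sigma>"
  using facet_exists by (metis UnionE subsetD)

lemma facets_mem: "\<sigma> \<in> facets K \<Longrightarrow> \<sigma> \<in> K"
  by (simp add: facets_def)

lemma finite_facets: "finite (facets K)"
  using finite_complex by (rule finite_subset[rotated]) (auto simp: facets_def)

lemma rel_interior_facet: "\<sigma> \<in> facets K \<Longrightarrow> x \<in> rel_interior \<sigma> \<Longrightarrow> g \<in> K \<Longrightarrow> x \<in> g \<Longrightarrow> g = \<sigma>"
  using rel_interior_subset_face[of \<sigma> g x] by (auto simp: facets_def)

lemma odd_subcomplex_down: "g \<in> odd_subcomplex K \<Longrightarrow> f \<in> K \<Longrightarrow> f \<subseteq> g \<Longrightarrow> f \<in> odd_subcomplex K"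
  by (auto simp: odd_subcomplex_def)

lemma odd_subcomplex_mem: "g \<in> odd_subcomplex K \<Longrightarrow> g \<in> K"
  by (auto simp: odd_subcomplex_def)

lemma odd_carrier_iff:
  assumes "f \<in> K" "\<And>g. g \<in> K \<Longrightarrow> y \<in> g \<longleftrightarrow> f \<subseteq> g"
  shows "y \<in> \<Union>(odd_subcomplex K) \<longleftrightarrow> f \<in> odd_subcomplex K"
  using assms odd_subcomplex_down odd_subcomplex_mem by (metis Union_iff subset_refl)

text \<open>The set is the open star of \<open>y\<close>: what remains after removing the finitely
  many closed faces that miss \<open>y\<close>.\<close>

lemma openin_open_star: "openin (top_of_set (\<Union>K)) (\<Union>K - \<Union>{g \<in> K. y \<notin> g})"
proof -
  have "closed (\<Union>{g \<in> K. y \<notin> g})" using finite_complex closed_face by (intro closed_Union) auto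
  then show ?thesis by (metis Diff_eq open_Compl openin_open_Int)
qed

end

section \<open>Pure complexes: facets, ridges and perspectivities\<close>

locale pure_geometric_complex = geometric_complex +
  assumes pure: "pure_complex K" and nontrivial: "\<Union>K \<noteq> {}"
begin

definition dim_K :: int where "dim_K = Max (aff_dim ` K)"

lemma aff_dim_facet: "\<sigma> \<in> facets K \<Longrightarrow> aff_dim \<sigma> = dim_K"
  using pure by (auto simp: pure_complex_def codim_def dim_K_def)

lemma card_facet: "\<sigma> \<in> facets K \<Longrightarrow> int (card (vertices \<sigma>)) = dim_K + 1"
  using aff_dim_facet simplex_vertices(4) facets_mem by fastforce

lemma codim_eq: "f \<in> K \<Longrightarrow> codim K f = dim_K + 1 - int (card (vertices f))"
  using simplex_vertices(4) by (simp add: codim_def dim_K_def)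

lemma dim_K_nonneg: "dim_K \<ge> 0"
proof -
  obtain h where h: "h \<in> K" "h \<noteq> {}" using nontrivial by blast
  obtain \<sigma> where s: "\<sigma> \<in> facets K" "h \<subseteq> \<sigma>" by (rule facet_exists[OF h(1)])
  then have "vertices \<sigma> \<noteq> {}" using h vertices_empty_iff facets_mem by blast
  then have "card (vertices \<sigma>) > 0" using simplex_vertices(1)[OF facets_mem[OF s(1)]] by (simp add: card_gt_0_iff)
  then show ?thesis using card_facet[OF s(1)] by linarith
qed

lemma facet_nonempty: "\<sigma> \<in> facets K \<Longrightarrow> \<sigma> \<noteq> {}"
  using card_facet[of \<sigma>] dim_K_nonneg vertices_empty_iff[OF facets_mem, of \<sigma>] by (metis add_nonneg_eq_0_iff card.empty int_eq_iff of_nat_0 zero_le_one zero_neq_one)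

lemma neighbouring_sym: "neighbouring_facets K \<sigma> \<tau> \<Longrightarrow> neighbouring_facets K \<tau> \<sigma>"
  by (auto simp: neighbouring_facets_def Int_commute)

lemma neighbouring_mem: "neighbouring_facets K \<sigma> \<tau> \<Longrightarrow> \<sigma> \<in> facets K \<and> \<tau> \<in> facets K"
  by (auto simp: neighbouring_facets_def)

lemma neighbouring_card:
  assumes "neighbouring_facets K \<sigma> \<tau>"
  shows "int (card (vertices \<sigma> \<inter> vertices \<tau>)) = dim_K"
  using assms codim_eq[OF Int_mem, of \<sigma> \<tau>] vertices_Int[of \<sigma> \<tau>] facets_mem
  by (auto simp: neighbouring_facets_def)

text \<open>A facet has \<open>dim_K + 1\<close> vertices and a ridge has \<open>dim_K\<close>, so
  crossing a ridge exchanges exactly one vertex.\<close>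

lemma neighbouring_Diff:
  assumes "neighbouring_facets K \<sigma> \<tau>"
  obtains v where "vertices \<sigma> - vertices \<tau> = {v}"
proof -
  have s: "\<sigma> \<in> facets K" "\<sigma> \<in> K" "\<tau> \<in> K" using assms facets_mem neighbouring_mem by auto
  have "card (vertices \<sigma> - vertices \<tau>) = card (vertices \<sigma>) - card (vertices \<sigma> \<inter> vertices \<tau>)"
    using simplex_vertices(1)[OF s(2)] by (simp add: card_Diff_subset_Int)
  then have "card (vertices \<sigma> - vertices \<tau>) = 1"
    using neighbouring_card[OF assms] card_facet[OF s(1)] by linarith
  then show thesis using that by (auto simp: card_1_singleton_iff)
qed

lemma perspectivity_common:
  "v \<in> vertices \<sigma> \<Longrightarrow> v \<in> vertices \<tau> \<Longrightarrow> perspectivity \<sigma> \<tau> v = v"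
  by (simp add: perspectivity_def)

lemma perspectivity_other:
  assumes "neighbouring_facets K \<sigma> \<tau>" "v \<in> vertices \<sigma>" "v \<notin> vertices \<tau>"
  shows "vertices \<sigma> - vertices \<tau> = {v}" "vertices \<tau> - vertices \<sigma> = {perspectivity \<sigma> \<tau> v}"
proof -
  obtain a where a: "vertices \<sigma> - vertices \<tau> = {a}" using neighbouring_Diff[OF assms(1)] .
  then show "vertices \<sigma> - vertices \<tau> = {v}" using assms by auto
  obtain b where b: "vertices \<tau> - vertices \<sigma> = {b}" using neighbouring_Diff[OF neighbouring_sym[OF assms(1)]] .
  then have "(THE w. w \<in> vertices \<tau> - vertices \<sigma>) = b" by (metis singletonD singletonI the_equality)
  then show "vertices \<tau> - vertices \<sigma> = {perspectivity \<sigma> \<tau> v}" using assms b by (simp add: perspectivity_def)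
qed

lemma perspectivity_mem:
  "neighbouring_facets K \<sigma> \<tau> \<Longrightarrow> v \<in> vertices \<sigma> \<Longrightarrow> perspectivity \<sigma> \<tau> v \<in> vertices \<tau>"
  using perspectivity_common[of v \<sigma> \<tau>] perspectivity_other(2)[of \<sigma> \<tau> v] by (cases "v \<in> vertices \<tau>") auto

lemma perspectivity_inv:
  assumes "neighbouring_facets K \<sigma> \<tau>" "v \<in> vertices \<sigma>"
  shows "perspectivity \<tau> \<sigma> (perspectivity \<sigma> \<tau> v) = v"
proof (cases "v \<in> vertices \<tau>")
  case True
  then show ?thesis using assms perspectivity_common by metis
next
  case False
  have 1: "vertices \<sigma> - vertices \<tau> = {v}" "vertices \<tau> - vertices \<sigma> = {perspectivity \<sigma> \<tau> v}"
    using perspectivity_other[OF assms False] by auto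
  then have "perspectivity \<sigma> \<tau> v \<in> vertices \<tau>" "perspectivity \<sigma> \<tau> v \<notin> vertices \<sigma>" by auto
  from perspectivity_other(2)[OF neighbouring_sym[OF assms(1)] this] show ?thesis using 1 by auto
qed

text \<open>A face through a relative interior point of a facet is that facet, and a facet, having
  codimension 0, lies in no face of codimension 2.\<close>

lemma facet_not_odd:
  assumes "\<sigma> \<in> facets K" "x \<in> rel_interior \<sigma>"
  shows "x \<in> \<Union>K - \<Union>(odd_subcomplex K)"
proof -
  have "\<sigma> \<notin> odd_subcomplex K"
  proof
    assume "\<sigma> \<in> odd_subcomplex K"
    then obtain f where f: "f \<in> K" "codim K f = 2" "\<sigma> \<subseteq> f" by (auto simp: odd_subcomplex_def)
    then have "f = \<sigma>" using assms by (auto simp: facets_def)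
    then show False using f pure assms by (auto simp: pure_complex_def)
  qed
  then show ?thesis
    using rel_interior_facet[OF assms] odd_subcomplex_mem assms rel_interior_subset facets_mem by blast
qed

lemma ridge_not_odd:
  assumes "neighbouring_facets K \<sigma> \<tau>" "x \<in> rel_interior (\<sigma> \<inter> \<tau>)"
  shows "x \<in> \<Union>K - \<Union>(odd_subcomplex K)"
proof -
  have s: "\<sigma> \<in> K" "\<tau> \<in> K" "codim K (\<sigma> \<inter> \<tau>) = 1" using assms facets_mem by (auto simp: neighbouring_facets_def)
  have "False" if "g \<in> odd_subcomplex K" "x \<in> g" for g
  proof -
    obtain f where f: "f \<in> K" "codim K f = 2" "g \<subseteq> f" using \<open>g \<in> _\<close> by (auto simp: odd_subcomplex_def)
    then have "\<sigma> \<inter> \<tau> \<subseteq> f" using rel_interior_subset_face[OF Int_mem[OF s(1,2)] f(1) assms(2)] that by blast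
    then have "aff_dim (\<sigma> \<inter> \<tau>) \<le> aff_dim f" by (rule aff_dim_subset)
    then show False using s f by (auto simp: codim_def)
  qed
  then show ?thesis using assms rel_interior_subset s by blast
qed

text \<open>Strong connectedness of a star speaks of facets and codimensions inside the star; this
  lemma and \<open>codim_star\<close> translate both to \<open>K\<close>.\<close>

lemma facets_star: "f \<in> K \<Longrightarrow> facets (star K f) = {\<sigma> \<in> facets K. f \<subseteq> \<sigma>}"
proof (intro subset_antisym subsetI)
  fix \<sigma> assume f: "f \<in> K" and s: "\<sigma> \<in> facets (star K f)"
  then obtain \<rho> where \<rho>: "\<rho> \<in> K" "f \<subseteq> \<rho>" "\<sigma> \<subseteq> \<rho>" by (auto simp: facets_def star_def)
  obtain \<tau> where \<tau>: "\<tau> \<in> facets K" "\<rho> \<subseteq> \<tau>" by (rule facet_exists[OF \<rho>(1)])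
  then have "\<tau> \<in> star K f" using \<rho> facets_mem[OF \<tau>(1)] unfolding star_def by blast
  moreover have "\<sigma> \<subseteq> \<tau>" using \<rho> \<tau> by blast
  ultimately have "\<sigma> = \<tau>" using s unfolding facets_def by blast
  then show "\<sigma> \<in> {\<sigma> \<in> facets K. f \<subseteq> \<sigma>}" using \<tau> \<rho> by auto
next
  fix \<sigma> assume f: "f \<in> K" and s: "\<sigma> \<in> {\<sigma> \<in> facets K. f \<subseteq> \<sigma>}"
  then have "\<sigma> \<in> star K f" using facets_mem unfolding star_def by blast
  moreover have "\<sigma> = \<tau>" if "\<tau> \<in> star K f" "\<sigma> \<subseteq> \<tau>" for \<tau>
    using that s unfolding facets_def star_def by blast
  ultimately show "\<sigma> \<in> facets (star K f)" unfolding facets_def by blast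
qed

lemma codim_star:
  assumes "f \<in> K"
  shows "codim (star K f) g = codim K g"
proof -
  obtain \<sigma> where s: "\<sigma> \<in> facets K" "f \<subseteq> \<sigma>" by (rule facet_exists[OF assms])
  have sub: "star K f \<subseteq> K" by (auto simp: star_def)
  have "Max (aff_dim ` star K f) = dim_K"
  proof (rule Max_eqI)
    show "finite (aff_dim ` star K f)" using finite_subset[OF sub finite_complex] by simp
    show "y \<le> dim_K" if "y \<in> aff_dim ` star K f" for y
      using that sub finite_complex unfolding dim_K_def by (intro Max_ge) auto
    have "\<sigma> \<in> star K f" using s facets_mem unfolding star_def by blast
    then show "dim_K \<in> aff_dim ` star K f" using aff_dim_facet[OF s(1)] by (metis imageI)
  qed
  then show ?thesis by (simp add: codim_def dim_K_def)
qed

end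

section \<open>Complexes with strongly connected stars\<close>

locale locally_strongly_connected_complex = pure_geometric_complex +
  assumes star_connected: "\<And>f. f \<in> K \<Longrightarrow> f \<noteq> {} \<Longrightarrow> strongly_connected (star K f)"
begin

lemma facets_connected_star:
  assumes f: "f \<in> K" "f \<noteq> {}" and s: "\<sigma> \<in> facets K" "f \<subseteq> \<sigma>" and t: "\<tau> \<in> facets K" "f \<subseteq> \<tau>"
  shows "(\<lambda>a b. neighbouring_facets K a b \<and> f \<subseteq> a \<inter> b)\<^sup>*\<^sup>* \<sigma> \<tau>"
proof -
  have "(neighbouring_facets (star K f))\<^sup>*\<^sup>* \<sigma> \<tau>"
    using star_connected[OF f] s t unfolding strongly_connected_def facets_star[OF f(1)] by blast
  moreover have "neighbouring_facets (star K f) \<le> (\<lambda>a b. neighbouring_facets K a b \<and> f \<subseteq> a \<inter> b)"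
    by (auto simp: neighbouring_facets_def facets_star[OF f(1)] codim_star[OF f(1)])
  ultimately show ?thesis using rtranclp_mono by blast
qed

text \<open>The facets through \<open>y\<close> are those that contain its carrier, so the star of
  the carrier provides a facet path that never leaves \<open>y\<close>.\<close>

lemma facets_connected_at:
  assumes "y \<in> \<sigma>" "y \<in> \<tau>" "\<sigma> \<in> facets K" "\<tau> \<in> facets K"
  shows "(\<lambda>a b. neighbouring_facets K a b \<and> y \<in> a \<inter> b)\<^sup>*\<^sup>* \<sigma> \<tau>"
proof -
  have "y \<in> \<Union>K" using assms facets_mem by blast
  then obtain f where f: "f \<in> K" "\<And>g. g \<in> K \<Longrightarrow> y \<in> g \<longleftrightarrow> f \<subseteq> g" using carrier_exists by metis
  then have yf: "y \<in> f" by blast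
  have "(\<lambda>a b. neighbouring_facets K a b \<and> f \<subseteq> a \<inter> b)\<^sup>*\<^sup>* \<sigma> \<tau>"
    by (rule facets_connected_star) (use f yf assms facets_mem in auto)
  moreover have "(\<lambda>a b. neighbouring_facets K a b \<and> f \<subseteq> a \<inter> b) \<le> (\<lambda>a b. neighbouring_facets K a b \<and> y \<in> a \<inter> b)"
    using yf by blast
  ultimately show ?thesis using rtranclp_mono by blast
qed

text \<open>The facets reachable from \<sigma> and the unreachable ones have closed unions that
  cover |K|. At a common point, \<open>facets_connected_at\<close> would join a reachable facet to
  an unreachable one.\<close>

lemma strongly_connected_if_connected:
  assumes con: "connected (\<Union>K)" and s: "\<sigma> \<in> facets K" and t: "\<tau> \<in> facets K"
  shows "(neighbouring_facets K)\<^sup>*\<^sup>* \<sigma> \<tau>"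
proof (rule ccontr)
  assume no: "\<not> ?thesis"
  define A where "A = {\<rho> \<in> facets K. (neighbouring_facets K)\<^sup>*\<^sup>* \<sigma> \<rho>}"
  define B where "B = {\<rho> \<in> facets K. \<not> (neighbouring_facets K)\<^sup>*\<^sup>* \<sigma> \<rho>}"
  have cl: "closed (\<Union>A)" "closed (\<Union>B)"
    using finite_facets closed_face facets_mem unfolding A_def B_def by (auto intro!: closed_Union)
  have "\<Union>K \<subseteq> \<Union>A \<union> \<Union>B"
  proof
    fix x assume "x \<in> \<Union>K"
    then obtain g where "g \<in> K" "x \<in> g" by blast
    moreover obtain \<rho> where "\<rho> \<in> facets K" "g \<subseteq> \<rho>" by (rule facet_exists[OF \<open>g \<in> K\<close>])
    ultimately show "x \<in> \<Union>A \<union> \<Union>B" unfolding A_def B_def by blast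
  qed
  moreover have "\<Union>A \<inter> \<Union>B \<inter> \<Union>K = {}"
  proof (rule ccontr)
    assume "\<Union>A \<inter> \<Union>B \<inter> \<Union>K \<noteq> {}"
    then obtain x a b where x: "x \<in> a" "x \<in> b" "a \<in> A" "b \<in> B" by blast
    have "(neighbouring_facets K)\<^sup>*\<^sup>* a b"
      using facets_connected_at[OF x(1,2)] x(3,4) rtranclp_mono[of "\<lambda>a b. neighbouring_facets K a b \<and> x \<in> a \<inter> b" "neighbouring_facets K"]
      unfolding A_def B_def by blast
    moreover have "(neighbouring_facets K)\<^sup>*\<^sup>* \<sigma> a" "\<not> (neighbouring_facets K)\<^sup>*\<^sup>* \<sigma> b" using x by (auto simp: A_def B_def)
    ultimately show False using rtranclp_trans by metis
  qed
  moreover have "\<sigma> \<in> A" "\<tau> \<in> B" using s t no by (auto simp: A_def B_def)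
  then have "\<Union>A \<inter> \<Union>K \<noteq> {}" "\<Union>B \<inter> \<Union>K \<noteq> {}" using s t facet_nonempty facets_mem by blast+
  ultimately show False using con cl unfolding connected_closed by blast
qed

end

section \<open>The partial unfolding\<close>

context locally_strongly_connected_complex
begin

abbreviation glued where "glued \<equiv> (unfolding_glue K \<union> (unfolding_glue K)\<inverse>)\<^sup>*"

text \<open>This parametrizes the copy of \<sigma> labelled \<open>v\<close> inside the unfolding;
  for a facet and one of its vertices it is a section of \<open>unfolding_map\<close> over
  \<sigma>.\<close>

definition sheet where "sheet \<sigma> v x = glued `` {((\<sigma>, v), x)}"

lemma glue_iff:
  "(((\<sigma>, v), x), ((\<tau>, w), y)) \<in> unfolding_glue K \<longleftrightarrow>
     neighbouring_facets K \<sigma> \<tau> \<and> v \<in> vertices \<sigma> \<and> w = perspectivity \<sigma> \<tau> v \<and> x \<in> \<sigma> \<inter> \<tau> \<and> y = x"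
  by (auto simp: unfolding_glue_def)

lemma glue_sym: "(unfolding_glue K)\<inverse> \<subseteq> unfolding_glue K"
proof
  fix e assume "e \<in> (unfolding_glue K)\<inverse>"
  moreover obtain \<sigma> v x \<tau> w y where e: "e = (((\<sigma>, v), x), ((\<tau>, w), y))" by (metis prod.collapse)
  ultimately have "(((\<tau>, w), y), ((\<sigma>, v), x)) \<in> unfolding_glue K" by simp
  then show "e \<in> unfolding_glue K"
    unfolding e glue_iff using neighbouring_sym perspectivity_inv perspectivity_mem by auto
qed

lemma glued_eq: "glued = (unfolding_glue K)\<^sup>*"
  using glue_sym by (simp add: Un_absorb2)

lemma glued_refl: "(a, a) \<in> glued" by simp

lemma glued_sym: "(a, b) \<in> glued \<Longrightarrow> (b, a) \<in> glued"
  by (meson sym_Un_converse sym_rtrancl symD)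

lemma glued_trans: "(a, b) \<in> glued \<Longrightarrow> (b, c) \<in> glued \<Longrightarrow> (a, c) \<in> glued"
  by (rule rtrancl_trans)

lemma glued_step:
  assumes "neighbouring_facets K \<sigma> \<tau>" "v \<in> vertices \<sigma>" "x \<in> \<sigma>" "x \<in> \<tau>"
  shows "(((\<sigma>, v), x), ((\<tau>, perspectivity \<sigma> \<tau> v), x)) \<in> glued"
  unfolding glued_eq by (rule r_into_rtrancl) (use assms in \<open>simp add: glue_iff\<close>)

lemma sheet_eq_iff: "sheet \<sigma> v x = sheet \<tau> w y \<longleftrightarrow> (((\<sigma>, v), x), ((\<tau>, w), y)) \<in> glued"
  unfolding sheet_def using glued_refl glued_sym glued_trans by blast

text \<open>A chain of gluings moves only the facet and the vertex, never the underlying point. The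
  membership facts about the end of the chain are proved along with \<open>P\<close>, because each
  step needs them of the preceding copy.\<close>

lemma glued_induct [consumes 4, case_names base step]:
  assumes G: "(((\<sigma>, v), x), ((\<tau>, w), y)) \<in> glued" and "\<sigma> \<in> facets K" "v \<in> vertices \<sigma>" "x \<in> \<sigma>"
    and base: "P \<sigma> v"
    and step: "\<And>\<rho> u \<rho>'. neighbouring_facets K \<rho> \<rho>' \<Longrightarrow> u \<in> vertices \<rho> \<Longrightarrow> x \<in> \<rho> \<Longrightarrow> x \<in> \<rho>' \<Longrightarrow> P \<rho> u \<Longrightarrow>
      (((\<sigma>, v), x), ((\<rho>, u), x)) \<in> glued \<Longrightarrow> P \<rho>' (perspectivity \<rho> \<rho>' u)"
  shows "P \<tau> w \<and> \<tau> \<in> facets K \<and> w \<in> vertices \<tau> \<and> x \<in> \<tau> \<and> y = x"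
proof -
  have "(\<lambda>((\<tau>, w), y). P \<tau> w \<and> \<tau> \<in> facets K \<and> w \<in> vertices \<tau> \<and> x \<in> \<tau> \<and> y = x) ((\<tau>, w), y)"
    using G[unfolded glued_eq]
  proof (induction rule: rtrancl_induct)
    case base
    then show ?case using assms by simp
  next
    case (step a b)
    obtain \<rho> u z \<rho>' u' z' where ab: "a = ((\<rho>, u), z)" "b = ((\<rho>', u'), z')" by (metis prod.collapse)
    have "P \<rho>' (perspectivity \<rho> \<rho>' u)"
      using step assms(6)[of \<rho> \<rho>' u] unfolding ab glue_iff glued_eq by auto
    then show ?case
      using step unfolding ab glue_iff using neighbouring_mem perspectivity_mem by auto
  qed
  then show ?thesis by simp
qed

lemma glued_dest:
  assumes "(((\<sigma>, v), x), ((\<tau>, w), y)) \<in> glued" and "\<sigma> \<in> facets K" "v \<in> vertices \<sigma>" "x \<in> \<sigma>"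
  shows "\<tau> \<in> facets K" "w \<in> vertices \<tau>" "x \<in> \<tau>" "y = x"
  using glued_induct[OF assms, of "\<lambda>_ _. True"] by auto

text \<open>A copy of \<sigma> is followed by perspectivities along facets through \<open>x\<close>
  until \<tau> is reached; strong connectedness of the star supplies these facets.\<close>

lemma glued_transport:
  assumes "\<sigma> \<in> facets K" "\<tau> \<in> facets K" "x \<in> \<sigma>" "x \<in> \<tau>" "v \<in> vertices \<sigma>"
  obtains w where "w \<in> vertices \<tau>" "(((\<sigma>, v), x), ((\<tau>, w), x)) \<in> glued"
proof -
  have "\<exists>w\<in>vertices \<tau>. (((\<sigma>, v), x), ((\<tau>, w), x)) \<in> glued"
    using facets_connected_at[OF assms(3,4,1,2)]
  proof (induction rule: rtranclp_induct)
    case base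
    then show ?case using assms glued_refl by blast
  next
    case (step \<rho> \<rho>')
    then obtain w where "w \<in> vertices \<rho>" "(((\<sigma>, v), x), ((\<rho>, w), x)) \<in> glued" by blast
    then show ?case using step glued_step[of \<rho> \<rho>' w x] glued_trans perspectivity_mem by blast
  qed
  then show thesis using that by blast
qed

text \<open>A chain of gluings over \<open>x\<close> uses only facets through \<open>x\<close>,
  hence is also a chain over \<open>y\<close>. In the applications \<open>x\<close> lies in the open
  star of \<open>y\<close>.\<close>

lemma glued_move:
  assumes "(((\<sigma>, v), x), ((\<tau>, w), x)) \<in> glued" "\<sigma> \<in> facets K" "v \<in> vertices \<sigma>" "x \<in> \<sigma>"
    and "\<And>\<rho>. \<rho> \<in> facets K \<Longrightarrow> x \<in> \<rho> \<Longrightarrow> y \<in> \<rho>"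
  shows "(((\<sigma>, v), y), ((\<tau>, w), y)) \<in> glued"
proof -
  have "(((\<sigma>, v), y), ((\<tau>, w), y)) \<in> glued \<and> \<tau> \<in> facets K \<and> w \<in> vertices \<tau> \<and> x \<in> \<tau> \<and> x = x"
    using assms(1-4)
  proof (induction rule: glued_induct)
    case base
    then show ?case by simp
  next
    case (step \<rho> u \<rho>')
    then show ?case using glued_step[of \<rho> \<rho>' u y] assms(5) neighbouring_mem glued_trans by blast
  qed
  then show ?thesis by blast
qed

text \<open>In terms of facet paths: closed paths through facets containing \<open>y\<close> have
  the identity as their projectivity. Phrased by gluing, no two copies of a facet are identified
  over \<open>y\<close>.\<close>

definition trivial_holonomy where
  "trivial_holonomy y \<longleftrightarrow> (\<forall>\<sigma>\<in>facets K. \<forall>v\<in>vertices \<sigma>. \<forall>w\<in>vertices \<sigma>.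
     y \<in> \<sigma> \<and> (((\<sigma>, v), y), ((\<sigma>, w), y)) \<in> glued \<longrightarrow> v = w)"

lemma topspace_copies:
  "topspace (unfolding_copies K) = {((\<sigma>, v), x). \<sigma> \<in> facets K \<and> v \<in> vertices \<sigma> \<and> x \<in> \<sigma>}"
  by (auto simp: unfolding_copies_def topspace_sum_topology)

lemma topspace_unfolding:
  "topspace (partial_unfolding K) = {sheet \<sigma> v x | \<sigma> v x. \<sigma> \<in> facets K \<and> v \<in> vertices \<sigma> \<and> x \<in> \<sigma>}"
  unfolding partial_unfolding_def topspace_quotient_topology quotient_def topspace_copies sheet_def
  by auto

lemma sheet_mem: "\<sigma> \<in> facets K \<Longrightarrow> v \<in> vertices \<sigma> \<Longrightarrow> x \<in> \<sigma> \<Longrightarrow> sheet \<sigma> v x \<in> topspace (partial_unfolding K)"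
  unfolding topspace_unfolding by blast

lemma unfolding_map_sheet:
  assumes "\<sigma> \<in> facets K" "v \<in> vertices \<sigma>" "x \<in> \<sigma>"
  shows "unfolding_map (sheet \<sigma> v x) = x"
proof -
  have "snd ` sheet \<sigma> v x = {x}"
  proof (intro subset_antisym subsetI)
    fix y assume "y \<in> snd ` sheet \<sigma> v x"
    then obtain \<tau> w where "(((\<sigma>, v), x), ((\<tau>, w), y)) \<in> glued" by (auto simp: sheet_def)
    then show "y \<in> {x}" using glued_dest(4) assms by auto
  next
    fix y assume "y \<in> {x}"
    then show "y \<in> snd ` sheet \<sigma> v x" unfolding sheet_def by (force intro: glued_refl)
  qed
  then show ?thesis by (simp add: unfolding_map_def)
qed

lemma quotient_map_unfolding:
  "quotient_map (unfolding_copies K) (partial_unfolding K) (\<lambda>x. glued `` {x})"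
  unfolding partial_unfolding_def by (rule quotient_map_quotient_topology)

lemma continuous_sheet:
  assumes "\<sigma> \<in> facets K" "v \<in> vertices \<sigma>"
  shows "continuous_map (top_of_set \<sigma>) (partial_unfolding K) (sheet \<sigma> v)"
proof -
  have "continuous_map (top_of_set \<sigma>) (unfolding_copies K) (\<lambda>x. ((\<sigma>, v), x))"
    unfolding unfolding_copies_def using continuous_map_component_injection[of "(\<sigma>, v)"
        "{(\<sigma>, v). \<sigma> \<in> facets K \<and> v \<in> vertices \<sigma>}" "\<lambda>(\<sigma>, v). top_of_set \<sigma>"] assms by simp
  from continuous_map_compose[OF this quotient_imp_continuous_map[OF quotient_map_unfolding]]
  show ?thesis by (simp add: o_def sheet_def[abs_def])
qed

lemma continuous_from_unfolding:
  assumes f: "\<And>\<sigma> v. \<sigma> \<in> facets K \<Longrightarrow> v \<in> vertices \<sigma> \<Longrightarrow> continuous_map (top_of_set \<sigma>) X (\<lambda>x. f (sheet \<sigma> v x))"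
  shows "continuous_map (partial_unfolding K) X f"
proof (rule continuous_compose_quotient_map[OF quotient_map_unfolding])
  let ?g = "f \<circ> (\<lambda>x. glued `` {x})"
  show "continuous_map (unfolding_copies K) X ?g"
    unfolding continuous_map_def
  proof (intro conjI allI impI)
    show "?g \<in> topspace (unfolding_copies K) \<rightarrow> topspace X"
    proof (clarsimp simp: topspace_copies)
      fix \<sigma> v x assume s: "\<sigma> \<in> facets K" "v \<in> vertices \<sigma>" "x \<in> \<sigma>"
      show "f (glued `` {((\<sigma>, v), x)}) \<in> topspace X"
        using continuous_map_image_subset_topspace[OF f[OF s(1,2)]] s(3) unfolding sheet_def by auto
    qed
    fix U assume U: "openin X U"
    have "openin (top_of_set \<sigma>) {x \<in> \<sigma>. f (sheet \<sigma> v x) \<in> U}" if "\<sigma> \<in> facets K" "v \<in> vertices \<sigma>" for \<sigma> v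
      using openin_continuous_map_preimage[OF f[OF that] U] by simp
    then show "openin (unfolding_copies K) {x \<in> topspace (unfolding_copies K). ?g x \<in> U}"
      unfolding topspace_copies unfolding unfolding_copies_def openin_sum_topology
      by (auto simp: sheet_def)
  qed
qed

lemma continuous_unfolding_map: "continuous_map (partial_unfolding K) (top_of_set (\<Union>K)) unfolding_map"
proof (rule continuous_from_unfolding)
  fix \<sigma> v assume s: "\<sigma> \<in> facets K" "v \<in> vertices \<sigma>"
  show "continuous_map (top_of_set \<sigma>) (top_of_set (\<Union>K)) (\<lambda>x. unfolding_map (sheet \<sigma> v x))"
    by (rule continuous_map_eq[of _ _ id]) (use facets_mem[OF s(1)] unfolding_map_sheet[OF s] in auto)
qed

lemma compact_unfolding: "compact_space (partial_unfolding K)"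
proof -
  define I where "I = Sigma (facets K) vertices"
  have "finite I" unfolding I_def using finite_facets simplex_vertices(1)[OF facets_mem] by blast
  moreover have "compactin (partial_unfolding K) ((\<lambda>(\<sigma>, v). sheet \<sigma> v ` \<sigma>) i)" if iI: "i \<in> I" for i
  proof -
    obtain \<sigma> v where i: "i = (\<sigma>, v)" "\<sigma> \<in> facets K" "v \<in> vertices \<sigma>" using iI unfolding I_def by blast
    have "compactin (top_of_set \<sigma>) \<sigma>" using compact_face[OF facets_mem[OF i(2)]] by (simp add: compactin_subtopology)
    then show ?thesis using image_compactin[OF _ continuous_sheet[OF i(2,3)]] i by simp
  qed
  ultimately have "compactin (partial_unfolding K) (\<Union>((\<lambda>(\<sigma>, v). sheet \<sigma> v ` \<sigma>) ` I))"
    by (intro compactin_Union) auto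
  moreover have "\<Union>((\<lambda>(\<sigma>, v). sheet \<sigma> v ` \<sigma>) ` I) = topspace (partial_unfolding K)"
    unfolding topspace_unfolding I_def by auto
  ultimately show ?thesis by (simp add: compact_space_def)
qed

text \<open>The evenly covered set at \<open>y\<close> is the trace on \<open>Y\<close> of its open
  star, and the sheets are numbered by the vertices of one facet \<sigma> at \<open>y\<close>.
  Trivial holonomy puts exactly one copy of each facet through \<open>y\<close> into each sheet. The
  set \<open>Y\<close> is general because the lemma serves the complement of the odd subcomplex as
  well as pushed copies of links.\<close>

lemma covering_unfolding:
  assumes Y: "Y \<subseteq> \<Union>K" and triv: "\<And>y. y \<in> Y \<Longrightarrow> trivial_holonomy y"
  shows "covering_map (subtopology (partial_unfolding K) (preimage_in (partial_unfolding K) unfolding_map Y))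
    (top_of_set Y) unfolding_map"
proof -
  let ?U = "partial_unfolding K"
  let ?p = "unfolding_map :: (('a set \<times> 'a) \<times> 'a) set \<Rightarrow> 'a"
  define E where "E = subtopology ?U (preimage_in ?U ?p Y)"
  have tE: "topspace E = preimage_in ?U ?p Y" by (auto simp: E_def preimage_in_def)
  have memE: "P \<in> topspace E \<longleftrightarrow> (\<exists>\<sigma> v x. \<sigma> \<in> facets K \<and> v \<in> vertices \<sigma> \<and> x \<in> \<sigma> \<and> x \<in> Y \<and> P = sheet \<sigma> v x)" for P
    unfolding tE preimage_in_def topspace_unfolding mem_Collect_eq using unfolding_map_sheet by metis
  have vert: "vertices \<sigma> \<noteq> {}" if "\<sigma> \<in> facets K" for \<sigma>
    using that facet_nonempty facets_mem vertices_empty_iff by blast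
  have cont: "continuous_map E (top_of_set Y) ?p"
    unfolding E_def continuous_map_in_subtopology
    using continuous_map_from_subtopology[OF continuous_unfolding_map]
    by (auto simp: continuous_map_in_subtopology preimage_in_def)
  have im: "?p ` topspace E = topspace (top_of_set Y)"
  proof (intro subset_antisym subsetI)
    fix y assume "y \<in> topspace (top_of_set Y)"
    then have y: "y \<in> Y" by simp
    then obtain \<sigma> v where "\<sigma> \<in> facets K" "y \<in> \<sigma>" "v \<in> vertices \<sigma>" using facet_at Y vert by blast
    then show "y \<in> ?p ` topspace E"
      using y unfolding_map_sheet memE by (metis imageI)
  qed (auto simp: tE preimage_in_def)
  have "\<exists>T. openin (top_of_set Y) T \<and> y \<in> T \<and> (\<exists>\<V>. \<Union>\<V> = preimage_in E ?p T \<and> (\<forall>U\<in>\<V>. openin E U) \<and>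
     pairwise disjnt \<V> \<and> (\<forall>U\<in>\<V>. homeomorphic_map (subtopology E U) (subtopology (top_of_set Y) T) ?p))"
    if y: "y \<in> Y" for y
  proof -
    obtain \<sigma> where s: "\<sigma> \<in> facets K" "y \<in> \<sigma>" using y Y facet_at by blast
    have LT: "v = w" if "\<tau> \<in> facets K" "v \<in> vertices \<tau>" "w \<in> vertices \<tau>" "y \<in> \<tau>" "(((\<tau>, v), y), ((\<tau>, w), y)) \<in> glued" for \<tau> v w
      using triv[OF y] that unfolding trivial_holonomy_def by blast
    define T0 where "T0 = \<Union>K - \<Union>{g \<in> K. y \<notin> g}"
    define T where "T = Y \<inter> T0"
    have T0: "openin (top_of_set (\<Union>K)) T0" unfolding T0_def by (rule openin_open_star)
    have T0m: "y \<in> \<rho>" if "x \<in> T0" "\<rho> \<in> facets K" "x \<in> \<rho>" for x \<rho>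
      using that facets_mem unfolding T0_def by blast
    have To: "openin (top_of_set Y) T" using T0 Y unfolding T_def by (metis openin_subtopology_Int2 openin_subtopology_Int subtopology_subtopology inf.absorb_iff2 inf_commute)
    have yT: "y \<in> T" using y Y by (auto simp: T_def T0_def)
    \<comment> \<open>Membership is decided by gluing over the centre \<open>y\<close> instead of
      over \<open>x\<close>; \<open>glued_move\<close> makes this independent of the
      representative.\<close>
    define Uv where "Uv v = {sheet \<tau> w x | \<tau> w x. \<tau> \<in> facets K \<and> w \<in> vertices \<tau> \<and> x \<in> \<tau> \<and> x \<in> T0 \<and>
        (((\<tau>, w), y), ((\<sigma>, v), y)) \<in> glued}" for v
    have Uv_iff: "sheet \<tau> w x \<in> Uv v \<longleftrightarrow> x \<in> T0 \<and> (((\<tau>, w), y), ((\<sigma>, v), y)) \<in> glued"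
      if t: "\<tau> \<in> facets K" "w \<in> vertices \<tau>" "x \<in> \<tau>" for \<tau> w x v
    proof
      assume "sheet \<tau> w x \<in> Uv v"
      then obtain \<tau>' w' x' where t': "\<tau>' \<in> facets K" "w' \<in> vertices \<tau>'" "x' \<in> \<tau>'" "x' \<in> T0"
        "(((\<tau>', w'), y), ((\<sigma>, v), y)) \<in> glued" "(((\<tau>, w), x), ((\<tau>', w'), x')) \<in> glued"
        unfolding Uv_def sheet_eq_iff[symmetric] by blast
      have x': "x' = x" using glued_dest(4)[OF t'(6) t] .
      have "(((\<tau>, w), y), ((\<tau>', w'), y)) \<in> glued"
        by (rule glued_move[OF t'(6)[unfolded x'] t]) (use T0m t' x' in blast)
      then show "x \<in> T0 \<and> (((\<tau>, w), y), ((\<sigma>, v), y)) \<in> glued" using t' x' glued_trans by blast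
    qed (use t in \<open>auto simp: Uv_def\<close>)
    have Uv_open: "openin ?U (Uv v)" for v
      unfolding partial_unfolding_def openin_quotient_topology
    proof
      show "Uv v \<subseteq> topspace (unfolding_copies K) // glued"
        unfolding Uv_def sheet_def topspace_copies quotient_def by auto
      have "openin (top_of_set \<tau>) {x \<in> \<tau>. sheet \<tau> w x \<in> Uv v}" if "\<tau> \<in> facets K" "w \<in> vertices \<tau>" for \<tau> w
      proof -
        have "{x \<in> \<tau>. sheet \<tau> w x \<in> Uv v} = (if (((\<tau>, w), y), ((\<sigma>, v), y)) \<in> glued then \<tau> \<inter> T0 else {})"
          using Uv_iff[OF that] by auto
        moreover have "openin (top_of_set \<tau>) (\<tau> \<inter> T0)"
          using T0 facets_mem[OF that(1)] by (metis Union_upper inf.absorb_iff2 openin_subtopology_Int2 subtopology_subtopology)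
        ultimately show ?thesis by simp
      qed
      then show "openin (unfolding_copies K) {x \<in> topspace (unfolding_copies K). glued `` {x} \<in> Uv v}"
        unfolding topspace_copies unfolding unfolding_copies_def openin_sum_topology
        by (auto simp: sheet_def)
    qed
    have TE: "preimage_in E ?p T = {sheet \<tau> w x | \<tau> w x. \<tau> \<in> facets K \<and> w \<in> vertices \<tau> \<and> x \<in> \<tau> \<and> x \<in> T}"
    proof -
      have "P \<in> preimage_in E ?p T \<longleftrightarrow> (\<exists>\<sigma> v x. \<sigma> \<in> facets K \<and> v \<in> vertices \<sigma> \<and> x \<in> \<sigma> \<and> x \<in> T \<and> P = sheet \<sigma> v x)" for P
        unfolding preimage_in_def mem_Collect_eq memE T_def Int_iff using unfolding_map_sheet by metis
      then show ?thesis by blast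
    qed
    define U where "U v = Uv v \<inter> topspace E" for v
    have "\<exists>w\<in>vertices \<tau>. (((\<tau>, w), y), ((\<sigma>, v), y)) \<in> glued" if "v \<in> vertices \<sigma>" "\<tau> \<in> facets K" "y \<in> \<tau>" for v \<tau>
      using glued_transport[OF s(1) that(2) s(2) that(3,1)] glued_sym by metis
    then obtain W where W: "\<And>v \<tau>. v \<in> vertices \<sigma> \<Longrightarrow> \<tau> \<in> facets K \<Longrightarrow> y \<in> \<tau> \<Longrightarrow> W v \<tau> \<in> vertices \<tau> \<and> (((\<tau>, W v \<tau>), y), ((\<sigma>, v), y)) \<in> glued"
      by metis
    have U_eq: "U v = {sheet \<tau> (W v \<tau>) x | \<tau> x. \<tau> \<in> facets K \<and> x \<in> \<tau> \<and> x \<in> T}" if v: "v \<in> vertices \<sigma>" for v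
    proof (intro subset_antisym subsetI)
      fix P assume "P \<in> U v"
      then obtain \<tau> w x where t: "\<tau> \<in> facets K" "w \<in> vertices \<tau>" "x \<in> \<tau>" "x \<in> Y" "P = sheet \<tau> w x" "P \<in> Uv v"
        unfolding U_def memE Int_iff by blast
      then have x: "x \<in> T0" "(((\<tau>, w), y), ((\<sigma>, v), y)) \<in> glued" using Uv_iff[OF t(1-3)] by auto
      have yt: "y \<in> \<tau>" using T0m x t by blast
      have "w = W v \<tau>"
        by (rule LT[OF t(1,2) _ yt glued_trans[OF x(2)]]) (use W[OF v t(1) yt] glued_sym in auto)
      then show "P \<in> {sheet \<tau> (W v \<tau>) x | \<tau> x. \<tau> \<in> facets K \<and> x \<in> \<tau> \<and> x \<in> T}" using t x by (auto simp: T_def)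
    next
      fix P assume "P \<in> {sheet \<tau> (W v \<tau>) x | \<tau> x. \<tau> \<in> facets K \<and> x \<in> \<tau> \<and> x \<in> T}"
      then obtain \<tau> x where t: "\<tau> \<in> facets K" "x \<in> \<tau>" "x \<in> Y" "x \<in> T0" "P = sheet \<tau> (W v \<tau>) x" by (auto simp: T_def)
      have yt: "y \<in> \<tau>" using T0m t by blast
      have w: "W v \<tau> \<in> vertices \<tau>" "(((\<tau>, W v \<tau>), y), ((\<sigma>, v), y)) \<in> glued" using W[OF v t(1) yt] by auto
      show "P \<in> U v" unfolding U_def Int_iff memE
        using Uv_iff[OF t(1) w(1) t(2)] t w by blast
    qed
    have Uo: "openin E (U v)" for v
    proof -
      have "openin E (topspace E \<inter> Uv v)"
        unfolding tE unfolding E_def by (rule openin_subtopology_Int2[OF Uv_open])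
      then show ?thesis by (simp add: U_def Int_commute)
    qed
    have "\<Union>(U ` vertices \<sigma>) = preimage_in E ?p T"
    proof (intro subset_antisym subsetI)
      fix P assume "P \<in> \<Union>(U ` vertices \<sigma>)"
      then obtain v where v: "v \<in> vertices \<sigma>" "P \<in> U v" by blast
      then obtain \<tau> x where t: "\<tau> \<in> facets K" "x \<in> \<tau>" "x \<in> T" "P = sheet \<tau> (W v \<tau>) x" using U_eq by blast
      then have "y \<in> \<tau>" using T0m by (auto simp: T_def)
      then have "W v \<tau> \<in> vertices \<tau>" using W[OF v(1) t(1)] by blast
      then show "P \<in> preimage_in E ?p T" unfolding TE using t by blast
    next
      fix P assume "P \<in> preimage_in E ?p T"
      then obtain \<tau> w x where t: "\<tau> \<in> facets K" "w \<in> vertices \<tau>" "x \<in> \<tau>" "x \<in> T" "P = sheet \<tau> w x" unfolding TE by blast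
      then have yt: "y \<in> \<tau>" and xY: "x \<in> Y" "x \<in> T0" using T0m by (auto simp: T_def)
      obtain v where v: "v \<in> vertices \<sigma>" "(((\<tau>, w), y), ((\<sigma>, v), y)) \<in> glued"
        by (rule glued_transport[OF t(1) s(1) yt s(2) t(2)])
      have "P \<in> U v" unfolding U_def Int_iff memE using Uv_iff[OF t(1-3)] t v xY by blast
      then show "P \<in> \<Union>(U ` vertices \<sigma>)" using v by blast
    qed
    moreover have "pairwise disjnt (U ` vertices \<sigma>)"
    proof -
      have "v = v'" if vv: "v \<in> vertices \<sigma>" "v' \<in> vertices \<sigma>" and P: "P \<in> U v" "P \<in> U v'" for v v' P
      proof -
        obtain \<tau> w x where t: "\<tau> \<in> facets K" "w \<in> vertices \<tau>" "x \<in> \<tau>" "P = sheet \<tau> w x"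
          using P(1) unfolding U_def Int_iff memE by blast
        have "(((\<tau>, w), y), ((\<sigma>, v), y)) \<in> glued" "(((\<tau>, w), y), ((\<sigma>, v'), y)) \<in> glued"
          using P Uv_iff[OF t(1-3)] t(4) unfolding U_def by auto
        then have "(((\<sigma>, v), y), ((\<sigma>, v'), y)) \<in> glued" using glued_sym glued_trans by blast
        then show ?thesis using LT s vv by blast
      qed
      then show ?thesis unfolding pairwise_def disjnt_def by blast
    qed
    moreover have "homeomorphic_map (subtopology E (U v)) (subtopology (top_of_set Y) T) ?p" if v: "v \<in> vertices \<sigma>" for v
    proof (rule bijective_closed_imp_homeomorphic_map)
      let ?S = "subtopology E (U v)"
      have tS: "topspace ?S = U v" using openin_subset[OF Uo] by auto
      have YT: "subtopology (top_of_set Y) T = top_of_set T"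
        by (simp add: subtopology_subtopology T_def Int_absorb1 Int_assoc[symmetric])
      have pU: "?p (sheet \<tau> (W v \<tau>) x) = x" if "\<tau> \<in> facets K" "x \<in> \<tau>" "x \<in> T" for \<tau> x
        using unfolding_map_sheet W[OF v that(1)] T0m that by (auto simp: T_def)
      show ctn: "continuous_map ?S (subtopology (top_of_set Y) T) ?p"
      proof (rule continuous_map_into_subtopology)
        show "continuous_map (subtopology E (U v)) (top_of_set Y) ?p" using continuous_map_from_subtopology[OF cont] .
        show "?p \<in> topspace ?S \<rightarrow> T" unfolding tS U_eq[OF v] using pU by auto
      qed
      show "?p ` topspace ?S = topspace (subtopology (top_of_set Y) T)"
      proof (intro subset_antisym subsetI)
        fix x assume "x \<in> topspace (subtopology (top_of_set Y) T)"
        then have x: "x \<in> T" "x \<in> \<Union>K" using Y by (auto simp: T_def)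
        then obtain \<tau> where t: "\<tau> \<in> facets K" "x \<in> \<tau>" using facet_at by blast
        then have "sheet \<tau> (W v \<tau>) x \<in> U v" unfolding U_eq[OF v] using x by blast
        then show "x \<in> ?p ` topspace ?S" unfolding tS using pU[OF t x(1)] by (metis imageI)
      qed (use ctn in \<open>auto simp: continuous_map_def\<close>)
      show "inj_on ?p (topspace ?S)"
      proof (rule inj_onI)
        fix P P' assume PP: "P \<in> topspace ?S" "P' \<in> topspace ?S" and eq: "?p P = ?p P'"
        obtain \<tau> x \<tau>' x' where t: "\<tau> \<in> facets K" "x \<in> \<tau>" "x \<in> T" "P = sheet \<tau> (W v \<tau>) x"
          and t': "\<tau>' \<in> facets K" "x' \<in> \<tau>'" "x' \<in> T" "P' = sheet \<tau>' (W v \<tau>') x'"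
          using PP[unfolded tS, unfolded U_eq[OF v]] by blast
        have x: "x' = x" using eq pU[OF t(1-3)] pU[OF t'(1-3)] t t' by simp
        have xT0: "x \<in> T0" using t by (simp add: T_def)
        have yt: "y \<in> \<tau>" "y \<in> \<tau>'" using T0m xT0 t t' x by auto
        note w = W[OF v t(1) yt(1)] and w' = W[OF v t'(1) yt(2)]
        obtain w1 where w1: "w1 \<in> vertices \<tau>'" "(((\<tau>, W v \<tau>), x), ((\<tau>', w1), x)) \<in> glued"
          by (rule glued_transport[OF t(1) t'(1) t(2) t'(2)[unfolded x]]) (use w in auto)
        have "(((\<tau>, W v \<tau>), y), ((\<tau>', w1), y)) \<in> glued"
          by (rule glued_move[OF w1(2) t(1) _ t(2)]) (use w T0m xT0 in auto)
        then have "(((\<tau>', w1), y), ((\<tau>', W v \<tau>'), y)) \<in> glued"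
          using w w' glued_sym glued_trans by blast
        then have "w1 = W v \<tau>'" using LT t'(1) w1(1) w' yt by blast
        then show "P = P'" unfolding t(4) t'(4) sheet_eq_iff x using w1 by simp
      qed
      \<comment> \<open>Closedness can be checked facet by facet: the image of \<open>C\<close> is a
        finite union of pieces, each the preimage of \<open>C\<close> under one sheet map.\<close>
      show "closed_map ?S (subtopology (top_of_set Y) T) ?p"
        unfolding closed_map_def YT
      proof (intro allI impI)
        fix C assume C: "closedin ?S C"
        then have CU: "C \<subseteq> U v" using closedin_subset tS by blast
        let ?A = "\<lambda>\<tau>. {x \<in> \<tau> \<inter> T. sheet \<tau> (W v \<tau>) x \<in> C}"
        have "?p ` C = \<Union>(?A ` facets K)"
        proof (intro subset_antisym subsetI)
          fix x assume "x \<in> ?p ` C"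
          then obtain P where P: "P \<in> C" "x = ?p P" by blast
          then obtain \<tau> x' where t: "\<tau> \<in> facets K" "x' \<in> \<tau>" "x' \<in> T" "P = sheet \<tau> (W v \<tau>) x'"
            using CU U_eq[OF v] by blast
          then have "x = x'" using pU[OF t(1-3)] P(2) by simp
          then have "x \<in> ?A \<tau>" using t P(1) by simp
          then show "x \<in> \<Union>(?A ` facets K)" using t(1) by blast
        next
          fix x assume "x \<in> \<Union>(?A ` facets K)"
          then obtain \<tau> where t: "\<tau> \<in> facets K" "x \<in> \<tau>" "x \<in> T" "sheet \<tau> (W v \<tau>) x \<in> C" by blast
          then show "x \<in> ?p ` C" using pU[OF t(1-3)] by (metis imageI)
        qed
        moreover have "closedin (top_of_set T) (?A \<tau>)" if t: "\<tau> \<in> facets K" for \<tau>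
        \<comment> \<open>The choice \<open>W v \<tau>\<close> is a vertex of \<tau> only for facets
          through \<open>y\<close>; a facet that misses \<open>y\<close> does not meet
          \<open>T\<close>, so its piece is empty.\<close>
        proof (cases "y \<in> \<tau>")
          case False
          then have "?A \<tau> = {}" using T0m t by (auto simp: T_def)
          then show ?thesis by (simp only: closedin_empty)
        next
          case True
          have "continuous_map (top_of_set (\<tau> \<inter> T)) ?U (sheet \<tau> (W v \<tau>))"
            by (rule continuous_map_from_subtopology_mono[OF continuous_sheet]) (use t W[OF v t True] in auto)
          moreover have "sheet \<tau> (W v \<tau>) \<in> \<tau> \<inter> T \<rightarrow> U v" using t U_eq[OF v] by blast
          moreover have "U v \<subseteq> preimage_in ?U ?p Y" unfolding U_def tE by blast
          ultimately have "continuous_map (top_of_set (\<tau> \<inter> T)) ?S (sheet \<tau> (W v \<tau>))"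
            unfolding E_def by (intro continuous_map_into_subtopology) auto
          from closedin_continuous_map_preimage[OF this C]
          have "closedin (top_of_set (\<tau> \<inter> T)) (?A \<tau>)" by simp
          moreover have "closedin (top_of_set T) (\<tau> \<inter> T)"
            using closed_face[OF facets_mem[OF t]] by (metis closedin_closed_Int inf_commute)
          moreover have "subtopology (top_of_set T) (\<tau> \<inter> T) = top_of_set (\<tau> \<inter> T)"
            by (simp add: subtopology_subtopology Int_absorb1 Int_absorb2)
          ultimately show ?thesis using closedin_trans_full by metis
        qed
        ultimately show "closedin (top_of_set T) (?p ` C)"
          using finite_facets by (auto intro!: closedin_Union)
      qed
    qed
    ultimately show ?thesis using To yT Uo by (intro exI[of _ T] conjI exI[of _ "U ` vertices \<sigma>"]) auto
  qed
  then show ?thesis using cont im unfolding E_def[symmetric] covering_map_def by simp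
qed

end

section \<open>Holonomy around the faces of a nice complex\<close>

context locally_strongly_connected_complex
begin

text \<open>A chain of gluings that returns to \<sigma> ends in a vertex of the same colour, and the
  colours tell the vertices of \<sigma> apart.\<close>

lemma trivial_holonomy_if_colouring:
  assumes pres: "\<And>\<sigma> \<tau> v. neighbouring_facets K \<sigma> \<tau> \<Longrightarrow> y \<in> \<sigma> \<Longrightarrow> y \<in> \<tau> \<Longrightarrow> v \<in> vertices \<sigma> \<Longrightarrow>
      \<kappa> (perspectivity \<sigma> \<tau> v) = \<kappa> v"
    and inj: "\<And>\<sigma>. \<sigma> \<in> facets K \<Longrightarrow> y \<in> \<sigma> \<Longrightarrow> inj_on \<kappa> (vertices \<sigma>)"
  shows "trivial_holonomy y"
  unfolding trivial_holonomy_def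
proof (intro ballI impI)
  fix \<sigma> v w assume s: "\<sigma> \<in> facets K" "v \<in> vertices \<sigma>" "w \<in> vertices \<sigma>"
    and g: "y \<in> \<sigma> \<and> (((\<sigma>, v), y), ((\<sigma>, w), y)) \<in> glued"
  from g have g': "(((\<sigma>, v), y), ((\<sigma>, w), y)) \<in> glued" "y \<in> \<sigma>" by auto
  have "\<kappa> w = \<kappa> v \<and> \<sigma> \<in> facets K \<and> w \<in> vertices \<sigma> \<and> y \<in> \<sigma> \<and> y = y"
    using g'(1) s(1,2) g'(2)
  proof (induction rule: glued_induct)
    case base
    then show ?case by simp
  next
    case (step \<rho> u \<rho>')
    then show ?case using pres by simp
  qed
  then show "v = w" using inj[OF s(1) g'(2)] s by (metis inj_onD)
qed

lemma hull_in_link: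
  assumes "f \<in> K" "\<sigma> \<in> K" "f \<subseteq> \<sigma>" "S \<subseteq> vertices \<sigma> - vertices f"
  shows "convex hull S \<in> link K f"
proof -
  have S: "convex hull S \<in> K" "vertices (convex hull S) = S" using hull_mem[OF assms(2)] assms(4) by auto
  have "vertices (f \<inter> convex hull S) = {}" using vertices_Int[OF assms(1) S(1)] S(2) assms(4) by auto
  then have "f \<inter> convex hull S = {}" using vertices_empty_iff[OF Int_mem[OF assms(1) S(1)]] by simp
  moreover have "convex hull S \<subseteq> \<sigma>"
    using face_subset_iff[OF S(1) assms(2)] S(2) assms(4) by auto
  ultimately show ?thesis using S(1) assms unfolding link_def star_def by blast
qed

lemma card_vertices_Diff:
  assumes "f \<in> K" "\<sigma> \<in> facets K" "f \<subseteq> \<sigma>"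
  shows "int (card (vertices \<sigma> - vertices f)) = codim K f"
proof -
  have "vertices f \<subseteq> vertices \<sigma>" "finite (vertices \<sigma>)"
    using vertices_mono assms facets_mem simplex_vertices(1) by auto
  then have "int (card (vertices \<sigma> - vertices f)) = int (card (vertices \<sigma>)) - int (card (vertices f))"
    by (simp add: card_Diff_subset finite_subset card_mono of_nat_diff)
  then show ?thesis using card_facet[OF assms(2)] codim_eq[OF assms(1)] by simp
qed

text \<open>Each vertex of the carrier \<open>f\<close> gets a colour of its own, and a facet has at
  most two further vertices. If there are two, they span an edge of the link and receive the two
  colours of its bipartition.\<close>

lemma trivial_holonomy_low_codim:
  assumes f: "f \<in> K" "\<And>g. g \<in> K \<Longrightarrow> y \<in> g \<longleftrightarrow> f \<subseteq> g"
    and cd: "codim K f \<le> 2" and bip: "codim K f = 2 \<Longrightarrow> bipartite_graph (link K f)"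
  shows "trivial_holonomy y"
proof -
  \<comment> \<open>Below codimension 2 a facet has at most one vertex off \<open>f\<close>, so a
    single extra colour, given by the empty set, is enough.\<close>
  obtain A where A: "codim K f = 2 \<Longrightarrow> \<forall>u v. u \<noteq> v \<and> convex hull {u, v} \<in> link K f \<longrightarrow> (u \<in> A \<longleftrightarrow> v \<notin> A)"
    "codim K f \<noteq> 2 \<Longrightarrow> A = {}"
    using bip unfolding bipartite_graph_def by (cases "codim K f = 2") auto
  have two: "codim K f = 2 \<and> (u \<in> A \<longleftrightarrow> v \<notin> A)"
    if s: "\<sigma> \<in> facets K" "y \<in> \<sigma>" and uv: "u \<in> vertices \<sigma> - vertices f" "v \<in> vertices \<sigma> - vertices f" "u \<noteq> v" for \<sigma> u v
  proof -
    have fs: "f \<subseteq> \<sigma>" "\<sigma> \<in> K" using f(2) s facets_mem by auto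
    have "finite (vertices \<sigma> - vertices f)" using simplex_vertices(1)[OF fs(2)] by simp
    then have "card {u, v} \<le> card (vertices \<sigma> - vertices f)" using uv by (intro card_mono) auto
    then have c: "codim K f = 2" using card_vertices_Diff[OF f(1) s(1) fs(1)] cd uv(3) by simp
    have "convex hull {u, v} \<in> link K f" by (rule hull_in_link[OF f(1) fs(2,1)]) (use uv in auto)
    then show ?thesis using A(1)[OF c] c uv(3) by blast
  qed
  define \<kappa> where "\<kappa> v = (if v \<in> vertices f then Inl v else Inr (v \<in> A))" for v
  show ?thesis
  proof (rule trivial_holonomy_if_colouring[of y \<kappa>])
    fix \<sigma> assume s: "\<sigma> \<in> facets K" "y \<in> \<sigma>"
    show "inj_on \<kappa> (vertices \<sigma>)"
      using two[OF s] unfolding inj_on_def \<kappa>_def by (auto split: if_splits)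
  next
    fix \<sigma> \<tau> v assume n: "neighbouring_facets K \<sigma> \<tau>" and y: "y \<in> \<sigma>" "y \<in> \<tau>" and v: "v \<in> vertices \<sigma>"
    have s: "\<sigma> \<in> facets K" "\<tau> \<in> facets K" using neighbouring_mem[OF n] by auto
    have fst: "f \<subseteq> \<sigma>" "f \<subseteq> \<tau>" using f(2) y s facets_mem by auto
    then have vf: "vertices f \<subseteq> vertices \<sigma>" "vertices f \<subseteq> vertices \<tau>" using vertices_mono f(1) s facets_mem by auto
    show "\<kappa> (perspectivity \<sigma> \<tau> v) = \<kappa> v"
    proof (cases "v \<in> vertices \<tau>")
      case True
      then show ?thesis using perspectivity_common[OF v] by simp
    next
      case False
      define w where "w = perspectivity \<sigma> \<tau> v"
      have d: "vertices \<sigma> - vertices \<tau> = {v}" "vertices \<tau> - vertices \<sigma> = {w}"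
        using perspectivity_other[OF n v False] by (auto simp: w_def)
      have vw: "v \<notin> vertices f" "w \<notin> vertices f" using d vf by auto
      have "v \<in> A \<longleftrightarrow> w \<in> A"
      proof (cases "codim K f = 2")
        case c: True
        then have "card (vertices \<sigma> - vertices f) = 2" using card_vertices_Diff[OF f(1) s(1) fst(1)] by simp
        \<comment> \<open>The perspectivity keeps the other vertex \<open>u\<close> off
          \<open>f\<close>. In the link both \<open>v\<close> and \<open>w\<close> are joined to
          \<open>u\<close>, so both have the colour opposite to that of \<open>u\<close>.\<close>
        then obtain u where u: "u \<in> vertices \<sigma> - vertices f" "u \<noteq> v"
          using v vw by (metis DiffI card_2_iff' )
        then have "u \<in> vertices \<tau> - vertices f" "u \<noteq> w" using d by auto
        then show ?thesis using two[OF s(1) y(1) u(1), of v] two[OF s(2) y(2), of u w] u v vw d by auto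
      qed (use A in simp)
      then show ?thesis using vw unfolding \<kappa>_def w_def[symmetric] by simp
    qed
  qed
qed

text \<open>The link of \<open>f\<close> is pushed halfway towards the barycenter of \<open>f\<close>: there its points have
  carriers strictly larger than \<open>f\<close>, so the unfolding is a covering of a copy of the link.\<close>

lemma trivial_holonomy_high_codim:
  assumes f: "f \<in> K" "f \<noteq> {}" "\<And>g. g \<in> K \<Longrightarrow> y \<in> g \<longleftrightarrow> f \<subseteq> g"
    and cd: "codim K f \<ge> 3" and sc: "simply_connected (\<Union>(link K f))"
    and IH: "\<And>f' y'. f' \<in> K \<Longrightarrow> f \<subset> f' \<Longrightarrow> (\<And>g. g \<in> K \<Longrightarrow> y' \<in> g \<longleftrightarrow> f' \<subseteq> g) \<Longrightarrow> trivial_holonomy y'"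
  shows "trivial_holonomy y"
proof -
  define L where "L = \<Union>(link K f)"
  define b where "b = barycenter f"
  define j where "j u = (1/2) *\<^sub>R b + (1/2) *\<^sub>R u" for u
  define Y where "Y = j ` L"
  let ?U = "partial_unfolding K"
  define E where "E = subtopology ?U (preimage_in ?U unfolding_map Y)"
  have b: "b \<in> rel_interior f" "b \<in> f" using barycenter_rel_interior barycenter_mem f by (auto simp: b_def)
  have join: "j u \<in> g \<longleftrightarrow> f \<subseteq> g \<and> u \<in> g" if u: "u \<in> L" and g: "g \<in> K" for u g
  proof
    assume "f \<subseteq> g \<and> u \<in> g"
    then show "j u \<in> g" using convexD[OF convex_face[OF g], of b u "1/2" "1/2"] b by (auto simp: j_def)
  next
    assume ju: "j u \<in> g"
    obtain l h where l: "l \<in> K" "u \<in> l" "f \<inter> l = {}" "h \<in> K" "f \<subseteq> h" "l \<subseteq> h"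
      using u unfolding L_def link_def star_def by blast
    have uh: "u \<in> h" "b \<in> h" using l b by auto
    have "u \<noteq> b" using l b by auto
    then have seg: "j u \<in> open_segment b u"
      unfolding in_segment j_def by (auto intro!: exI[of _ "1/2"])
    have "j u \<in> h" using convexD[OF convex_face[OF l(4)], of b u "1/2" "1/2"] uh by (auto simp: j_def)
    \<comment> \<open>As a face of \<open>h\<close>, the set \<open>h \<inter> g\<close> contains
      with an inner point of a segment in \<open>h\<close> also its ends \<open>b\<close> and
      \<open>u\<close>. Since \<open>b\<close> is a relative interior point of \<open>f\<close>, all
      of \<open>f\<close> then lies in \<open>g\<close>.\<close>
    then have "b \<in> h \<inter> g" "u \<in> h \<inter> g"
      using Int_face_of[OF l(4) g] ju seg uh unfolding face_of_def by blast+
    then show "f \<subseteq> g \<and> u \<in> g" using rel_interior_subset_face[OF f(1) g b(1)] by auto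
  qed
  have uf: "u \<notin> f" if "u \<in> L" for u using that unfolding L_def link_def by blast
  have jK: "j u \<in> \<Union>K" if u: "u \<in> L" for u
  proof -
    obtain l h where "l \<in> K" "u \<in> l" "h \<in> K" "f \<subseteq> h" "l \<subseteq> h"
      using u unfolding L_def link_def star_def by blast
    then have "j u \<in> h" using join[OF u] by blast
    then show ?thesis using \<open>h \<in> K\<close> by blast
  qed
  have triv: "trivial_holonomy (j u)" if u: "u \<in> L" for u
  proof -
    obtain f' where f': "f' \<in> K" "\<And>g. g \<in> K \<Longrightarrow> j u \<in> g \<longleftrightarrow> f' \<subseteq> g" using carrier_exists[OF jK[OF u]] by metis
    then have "f \<subseteq> f'" "u \<in> f'" using join[OF u f'(1)] by auto
    then have "f \<subset> f'" using uf[OF u] by blast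
    then show ?thesis using IH f' by blast
  qed
  have YK: "Y \<subseteq> \<Union>K" using jK by (auto simp: Y_def)
  have cov: "covering_map E (top_of_set Y) unfolding_map"
    unfolding E_def by (rule covering_unfolding[OF YK]) (use triv in \<open>auto simp: Y_def\<close>)
  have scY: "simply_connected Y"
    using homeomorphic_affinity[of "1/2::real" L "(1/2) *\<^sub>R b"] sc homeomorphic_simply_connected_eq
    unfolding Y_def L_def[symmetric] j_def by (metis (no_types, lifting) image_cong zero_neq_numeral divide_eq_0_iff zero_neq_one)
  \<comment> \<open>Inside a facet the link of \<open>f\<close> is the face opposite to
    \<open>f\<close>, hence convex; so each copy can be crossed along straight segments.\<close>
  have LS: "L \<inter> \<sigma> = convex hull (vertices \<sigma> - vertices f)" if s: "\<sigma> \<in> facets K" "f \<subseteq> \<sigma>" for \<sigma>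
  proof
    have "convex hull (vertices \<sigma> - vertices f) \<subseteq> convex hull (vertices \<sigma>)" by (rule hull_mono) auto
    then show "convex hull (vertices \<sigma> - vertices f) \<subseteq> L \<inter> \<sigma>"
      using hull_in_link[OF f(1) facets_mem[OF s(1)] s(2) order_refl] simplex_vertices(3)[OF facets_mem[OF s(1)]]
      unfolding L_def by blast
    show "L \<inter> \<sigma> \<subseteq> convex hull (vertices \<sigma> - vertices f)"
    proof
      fix u assume "u \<in> L \<inter> \<sigma>"
      then obtain l where l: "l \<in> K" "u \<in> l" "f \<inter> l = {}" "u \<in> \<sigma>"
        unfolding L_def link_def star_def by blast
      have "vertices f \<inter> vertices l = {}" using vertices_Int[OF f(1) l(1)] l(3) vertices_empty_iff[OF Int_mem[OF f(1) l(1)]] by simp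
      then have "vertices (l \<inter> \<sigma>) \<subseteq> vertices \<sigma> - vertices f"
        using vertices_Int[OF l(1) facets_mem[OF s(1)]] by auto
      then have "convex hull (vertices (l \<inter> \<sigma>)) \<subseteq> convex hull (vertices \<sigma> - vertices f)" by (rule hull_mono)
      then show "u \<in> convex hull (vertices \<sigma> - vertices f)"
        using simplex_vertices(3)[OF Int_mem[OF l(1) facets_mem[OF s(1)]]] l by auto
    qed
  qed
  have tE: "sheet \<sigma> v (j u) \<in> topspace E" if "\<sigma> \<in> facets K" "v \<in> vertices \<sigma>" "f \<subseteq> \<sigma>" "u \<in> L \<inter> \<sigma>" for \<sigma> v u
    using that join[of u \<sigma>] facets_mem[of \<sigma>] unfolding_map_sheet[of \<sigma> v "j u"] sheet_mem[of \<sigma> v "j u"]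
    by (auto simp: E_def preimage_in_def Y_def)
  have same: "path_component_of E (sheet \<sigma> v (j u)) (sheet \<sigma> v (j u'))"
    if s: "\<sigma> \<in> facets K" "v \<in> vertices \<sigma>" "f \<subseteq> \<sigma>" "u \<in> L \<inter> \<sigma>" "u' \<in> L \<inter> \<sigma>" for \<sigma> v u u'
    unfolding path_component_of_def
  proof (intro exI[of _ "\<lambda>t. sheet \<sigma> v (j (linepath u u' t))"] conjI)
    have lin: "linepath u u' t \<in> L \<inter> \<sigma>" if "t \<in> {0..1}" for t
    proof -
      have "closed_segment u u' \<subseteq> L \<inter> \<sigma>" using s LS[OF s(1,3)] by (simp add: closed_segment_subset)
      then show ?thesis using that linepath_in_path[of t u u'] by blast
    qed
    have "continuous_map (top_of_set {0..1}) (top_of_set \<sigma>) (\<lambda>t. j (linepath u u' t))"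
      using lin join facets_mem[OF s(1)] s(3) by (auto simp: j_def linepath_def intro!: continuous_intros)
    then have "continuous_map (top_of_set {0..1}) ?U (\<lambda>t. sheet \<sigma> v (j (linepath u u' t)))"
      using continuous_map_compose[OF _ continuous_sheet[OF s(1,2)], unfolded o_def] by blast
    moreover have "sheet \<sigma> v (j (linepath u u' t)) \<in> preimage_in ?U unfolding_map Y" if "t \<in> {0..1}" for t
      using tE[OF s(1-3) lin[OF that]] by (simp add: E_def)
    ultimately show "pathin E (\<lambda>t. sheet \<sigma> v (j (linepath u u' t)))"
      unfolding pathin_def E_def by (intro continuous_map_into_subtopology) auto
  qed (auto simp: linepath_def)
  have walk: "path_component_of E (sheet \<rho> w (j u)) (sheet \<rho>' (perspectivity \<rho> \<rho>' w) (j u'))"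
    if n: "neighbouring_facets K \<rho> \<rho>'" and w: "w \<in> vertices \<rho>" and fr: "f \<subseteq> \<rho>" "f \<subseteq> \<rho>'"
      and u: "u \<in> L \<inter> \<rho>" "u' \<in> L \<inter> \<rho>'" for \<rho> \<rho>' w u u'
  proof -
    have r: "\<rho> \<in> facets K" "\<rho>' \<in> facets K" using neighbouring_mem[OF n] by auto
    have rK: "\<rho> \<in> K" "\<rho>' \<in> K" using r facets_mem by auto
    \<comment> \<open>The ridge has \<open>dim_K\<close> vertices and \<open>f\<close> at most
      \<open>dim_K - 2\<close>, so some vertex \<open>x\<close> of the ridge lies off
      \<open>f\<close>. Over its pushed image \<open>j x\<close> the two copies are glued, which
      joins their paths.\<close>
    have "\<exists>x. x \<in> vertices \<rho> \<inter> vertices \<rho>' - vertices f"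
    proof (rule ccontr)
      assume "\<not> ?thesis"
      then have "vertices \<rho> \<inter> vertices \<rho>' \<subseteq> vertices f" by blast
      then have "card (vertices \<rho> \<inter> vertices \<rho>') \<le> card (vertices f)"
        using simplex_vertices(1)[OF f(1)] by (simp add: card_mono)
      then show False using neighbouring_card[OF n] codim_eq[OF f(1)] cd by simp
    qed
    then obtain x where x: "x \<in> vertices \<rho>" "x \<in> vertices \<rho>'" "x \<notin> vertices f" by blast
    have xL: "x \<in> L \<inter> \<rho>" "x \<in> L \<inter> \<rho>'" using x LS[OF r(1) fr(1)] LS[OF r(2) fr(2)] by (auto simp: hull_inc)
    have jx: "j x \<in> \<rho>" "j x \<in> \<rho>'" using join xL fr rK by auto
    have p: "perspectivity \<rho> \<rho>' w \<in> vertices \<rho>'" by (rule perspectivity_mem[OF n w])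
    have "sheet \<rho> w (j x) = sheet \<rho>' (perspectivity \<rho> \<rho>' w) (j x)"
      unfolding sheet_eq_iff by (rule glued_step[OF n w jx])
    then show ?thesis
      using same[OF r(1) w fr(1) u(1) xL(1)] same[OF r(2) p fr(2) xL(2) u(2)] by (metis path_component_of_trans)
  qed
  show ?thesis
    unfolding trivial_holonomy_def
  proof (intro ballI impI)
    fix \<sigma> v w assume s: "\<sigma> \<in> facets K" "v \<in> vertices \<sigma>" "w \<in> vertices \<sigma>"
      and "y \<in> \<sigma> \<and> (((\<sigma>, v), y), ((\<sigma>, w), y)) \<in> glued"
    then have g: "(((\<sigma>, v), y), ((\<sigma>, w), y)) \<in> glued" "y \<in> \<sigma>" by auto
    have fs: "f \<subseteq> \<rho>" if "\<rho> \<in> facets K" "y \<in> \<rho>" for \<rho> using f(3)[OF facets_mem[OF that(1)]] that(2) by simp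
    have "vertices \<sigma> - vertices f \<noteq> {}"
      using card_vertices_Diff[OF f(1) s(1) fs[OF s(1) g(2)]] cd by (intro notI) simp
    then obtain u where u: "u \<in> L \<inter> \<sigma>" using LS[OF s(1) fs[OF s(1) g(2)]] by (metis equals0I hull_inc ex_in_conv)
    have "(\<forall>u'\<in>L \<inter> \<tau>. path_component_of E (sheet \<sigma> v (j u)) (sheet \<tau> w' (j u'))) \<and> \<tau> \<in> facets K \<and> w' \<in> vertices \<tau> \<and> y \<in> \<tau> \<and> y = y"
      if "(((\<sigma>, v), y), ((\<tau>, w'), y)) \<in> glued" for \<tau> w'
      using that s(1,2) g(2)
    proof (induction rule: glued_induct)
      case base
      then show ?case using same[OF s(1,2) fs[OF s(1) g(2)] u] by blast
    next
      case (step \<rho> x \<rho>')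
      note n = neighbouring_mem[OF step(1)]
      have fr: "f \<subseteq> \<rho>" "f \<subseteq> \<rho>'" using fs n step by auto
      obtain z where z: "z \<in> L \<inter> \<rho>"
      proof -
        have "vertices \<rho> - vertices f \<noteq> {}" using card_vertices_Diff[OF f(1) _ fr(1)] n cd by (intro notI) simp
        then show thesis using that LS[OF _ fr(1)] n by (metis equals0I hull_inc ex_in_conv)
      qed
      show ?case
      proof
        fix u' assume u': "u' \<in> L \<inter> \<rho>'"
        have xr: "x \<in> vertices \<rho>" and P: "\<forall>u'\<in>L \<inter> \<rho>. path_component_of E (sheet \<sigma> v (j u)) (sheet \<rho> x (j u'))"
          using step by blast+
        show "path_component_of E (sheet \<sigma> v (j u)) (sheet \<rho>' (perspectivity \<rho> \<rho>' x) (j u'))"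
          using path_component_of_trans[OF bspec[OF P z] walk[OF step(1) xr fr z u']] .
      qed
    qed
    \<comment> \<open>The chain of gluings over \<open>y\<close> has become a path in the covering
      \<open>E\<close>. Its projection is a loop in the simply connected set \<open>Y\<close>, so
      the path closes up; both labels are then glued over \<open>j u\<close>, where the holonomy is
      already known to be trivial.\<close>
    then have "path_component_of E (sheet \<sigma> v (j u)) (sheet \<sigma> w (j u))" using u g(1) by blast
    then obtain \<alpha> where \<alpha>: "pathin E \<alpha>" "\<alpha> 0 = sheet \<sigma> v (j u)" "\<alpha> 1 = sheet \<sigma> w (j u)"
      unfolding path_component_of_def by blast
    have ju: "j u \<in> \<sigma>" using join u facets_mem[OF s(1)] fs[OF s(1) g(2)] by blast
    define \<beta> where "\<beta> = unfolding_map \<circ> \<alpha>"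
    have "pathin (top_of_set Y) \<beta>"
      unfolding pathin_def \<beta>_def
      by (rule continuous_map_compose[OF \<alpha>(1)[unfolded pathin_def]]) (use cov in \<open>simp add: covering_map_def\<close>)
    then have \<beta>: "path \<beta>" "path_image \<beta> \<subseteq> Y" by (auto simp: pathin_def path_def path_image_def)
    have \<beta>01: "\<beta> 0 = j u" "\<beta> 1 = j u" unfolding \<beta>_def using \<alpha> unfolding_map_sheet s ju by auto
    have "homotopic_paths Y \<beta> (linepath (j u) (j u))"
      using scY \<beta> \<beta>01 unfolding simply_connected_eq_contractible_path by (auto simp: pathstart_def pathfinish_def)
    then have hom: "path_homotopic (top_of_set Y) \<beta> (\<lambda>_. j u)"
      unfolding path_homotopic_iff_homotopic_paths by (simp add: linepath_refl)
    have c: "pathin E (\<lambda>_. sheet \<sigma> v (j u))"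
      using tE[OF s(1,2) fs[OF s(1) g(2)] u] by (simp add: pathin_def)
    have "\<alpha> 1 = sheet \<sigma> v (j u)"
      by (rule covering_lift_path_homotopic[OF cov hom \<alpha>(1) _ c _ \<alpha>(2)])
        (use unfolding_map_sheet[OF s(1,2) ju] in \<open>auto simp: \<beta>_def\<close>)
    then have "(((\<sigma>, v), j u), ((\<sigma>, w), j u)) \<in> glued" using \<alpha>(3) sheet_eq_iff by metis
    then show "v = w" using triv u s ju unfolding trivial_holonomy_def by blast
  qed
qed

text \<open>Induction on the codimension of the carrier \<open>f\<close>. The faces properly
  containing \<open>f\<close> have smaller codimension, and they are not odd because the odd
  subcomplex is closed under taking faces.\<close>

lemma trivial_holonomy_off_odd:
  assumes links: "\<And>f. f \<in> K \<Longrightarrow> f \<noteq> {} \<Longrightarrow> codim K f \<ge> 3 \<Longrightarrow> simply_connected (\<Union>(link K f))"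
    and y: "y \<in> \<Union>K - \<Union>(odd_subcomplex K)"
  shows "trivial_holonomy y"
proof -
  have main: "trivial_holonomy y"
    if "f \<in> K" "\<And>g. g \<in> K \<Longrightarrow> y \<in> g \<longleftrightarrow> f \<subseteq> g" "f \<notin> odd_subcomplex K" for f y
    using that
  proof (induction "nat (codim K f)" arbitrary: f y rule: less_induct)
    case less
    have ne: "f \<noteq> {}" using less(3)[OF less(2)] by blast
    show ?case
    proof (cases "codim K f \<le> 2")
      case True
      show ?thesis
        by (rule trivial_holonomy_low_codim[OF less(2,3) True])
           (use less(2,4) in \<open>auto simp: odd_subcomplex_def\<close>)
    next
      case False
      show ?thesis
      proof (rule trivial_holonomy_high_codim[OF less(2) ne less(3)])
        show "3 \<le> codim K f" using False by simp
        then show "simply_connected (\<Union>(link K f))" using links less(2) ne by blast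
        fix f' y' assume f': "f' \<in> K" "f \<subset> f'" "\<And>g. g \<in> K \<Longrightarrow> y' \<in> g \<longleftrightarrow> f' \<subseteq> g"
        have "codim K f' < codim K f"
          using codim_eq[OF less(2)] codim_eq[OF f'(1)] card_vertices_mono[OF less(2) f'(1,2)] by linarith
        then have "nat (codim K f') < nat (codim K f)" using False by linarith
        moreover have "f' \<notin> odd_subcomplex K" using odd_subcomplex_down[of f' f] less(2,4) f'(2) by blast
        ultimately show "trivial_holonomy y'" using less(1)[of f' y'] f' by blast
      qed
    qed
  qed
  obtain f where "f \<in> K" "\<And>g. g \<in> K \<Longrightarrow> y \<in> g \<longleftrightarrow> f \<subseteq> g" using carrier_exists[of y] y by auto
  then show ?thesis using main[of f y] odd_carrier_iff[of f y] y by blast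
qed

end

section \<open>Lifting barycentric paths\<close>

lemma pathin_concat:
  assumes g: "pathin X g" and h: "pathin X h" and gh: "g 1 = h 0"
  shows "pathin X (concat_paths g h)"
  unfolding pathin_def concat_paths_def
proof (rule continuous_map_cases_le)
  let ?I = "top_of_set {0..1::real}"
  have "continuous_map (subtopology ?I {x \<in> topspace ?I. x \<le> 1/2}) ?I (\<lambda>t. 2 * t)"
    by (auto simp: continuous_map_in_subtopology intro!: continuous_intros continuous_map_from_subtopology)
  from continuous_map_compose[OF this g[unfolded pathin_def]]
  show "continuous_map (subtopology ?I {x \<in> topspace ?I. x \<le> 1/2}) X (\<lambda>t. g (2 * t))" by (simp add: o_def)
  have "continuous_map (subtopology ?I {x \<in> topspace ?I. 1/2 \<le> x}) ?I (\<lambda>t. 2 * t - 1)"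
    by (auto simp: continuous_map_in_subtopology intro!: continuous_intros continuous_map_from_subtopology)
  from continuous_map_compose[OF this h[unfolded pathin_def]]
  show "continuous_map (subtopology ?I {x \<in> topspace ?I. 1/2 \<le> x}) X (\<lambda>t. h (2 * t - 1))" by (simp add: o_def)
  fix t :: real assume "t = 1/2"
  then have "2 * t = 1" "2 * t - 1 = 0" by simp_all
  then show "g (2 * t) = h (2 * t - 1)" using gh by simp
qed (auto simp: continuous_map_in_subtopology)

context geometric_complex
begin

definition section_over where
  "section_over X q \<sigma> s \<longleftrightarrow> continuous_map (top_of_set \<sigma>) X s \<and> (\<forall>x\<in>\<sigma>. q (s x) = x)"

text \<open>A lift of a facet path facet by facet, with labels for the sections at its start and its
  end. It is used with two families: the copies in the unfolding, labelled by vertices, and the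
  sections of \<open>X\<close>, labelled by points of the fibres over barycenters.\<close>

inductive section_chain for X q s where
  single: "\<sigma> \<in> facets K \<Longrightarrow> section_over X q \<sigma> (s \<sigma> a) \<Longrightarrow> section_chain X q s [\<sigma>] a a"
| cons: "neighbouring_facets K \<sigma> \<tau> \<Longrightarrow> section_over X q \<sigma> (s \<sigma> a) \<Longrightarrow>
    s \<sigma> a (barycenter (\<sigma> \<inter> \<tau>)) = s \<tau> b (barycenter (\<sigma> \<inter> \<tau>)) \<Longrightarrow>
    section_chain X q s (\<tau> # \<gamma>) b c \<Longrightarrow> section_chain X q s (\<sigma> # \<tau> # \<gamma>) a c"

lemma section_chain_hd: "section_chain X q s \<gamma> a b \<Longrightarrow> section_over X q (hd \<gamma>) (s (hd \<gamma>) a)"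
  by (induction rule: section_chain.induct) auto

lemma section_linepath:
  assumes s: "section_over X q \<sigma> s" and "convex \<sigma>" "x \<in> \<sigma>" "y \<in> \<sigma>"
  shows "pathin X (s \<circ> linepath x y)" "t \<in> {0..1} \<Longrightarrow> q (s (linepath x y t)) = linepath x y t"
proof -
  have seg: "linepath x y t \<in> \<sigma>" if "t \<in> {0..1}" for t
    using closed_segment_subset[OF assms(3,4,2)] linepath_in_path[OF that] by blast
  have "continuous_map (top_of_set {0..1}) (top_of_set \<sigma>) (linepath x y)"
    using seg by auto
  then show "pathin X (s \<circ> linepath x y)"
    unfolding pathin_def by (rule continuous_map_compose) (use s in \<open>simp add: section_over_def\<close>)
  show "q (s (linepath x y t)) = linepath x y t" if "t \<in> {0..1}"
    using s seg[OF that] by (simp add: section_over_def)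
qed

end

locale nice_geometric_complex = locally_strongly_connected_complex +
  assumes link_simply_connected:
    "\<And>f. f \<in> K \<Longrightarrow> f \<noteq> {} \<Longrightarrow> codim K f \<ge> 3 \<Longrightarrow> simply_connected (\<Union>(link K f))"
    and connected_complex: "connected (\<Union>K)"
begin

abbreviation Y where "Y \<equiv> \<Union>K - \<Union>(odd_subcomplex K)"

lemma barycenter_facet:
  assumes "\<sigma> \<in> facets K"
  shows "barycenter \<sigma> \<in> rel_interior \<sigma>" "barycenter \<sigma> \<in> \<sigma>" "barycenter \<sigma> \<in> Y"
proof -
  show 1: "barycenter \<sigma> \<in> rel_interior \<sigma>" "barycenter \<sigma> \<in> \<sigma>"
    using barycenter_rel_interior barycenter_mem facet_nonempty facets_mem assms by auto
  show "barycenter \<sigma> \<in> Y" using facet_not_odd[OF assms 1(1)] .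
qed

text \<open>In a zero-dimensional complex two distinct facets share only the empty ridge; connectedness
  of \<open>|K|\<close> rules this out.\<close>

lemma ridge_nonempty:
  assumes n: "neighbouring_facets K \<sigma> \<tau>"
  shows "\<sigma> \<inter> \<tau> \<noteq> {}"
proof
  assume e: "\<sigma> \<inter> \<tau> = {}"
  have s: "\<sigma> \<in> facets K" "\<tau> \<in> facets K" "\<sigma> \<noteq> \<tau>" using n by (auto simp: neighbouring_facets_def)
  have "vertices \<sigma> \<inter> vertices \<tau> = {}" using e vertices_subset facets_mem s by blast
  then have d: "dim_K = 0" using neighbouring_card[OF n] by simp
  \<comment> \<open>In dimension 0 a facet meeting \<sigma> is \<sigma> itself, so \<sigma> would
    split off from the rest of |K|.\<close>
  have disj: "x \<notin> \<rho>" if "\<rho> \<in> facets K" "\<rho> \<noteq> \<sigma>" "x \<in> \<sigma>" for x \<rho>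
  proof
    assume "x \<in> \<rho>"
    have "\<sigma> \<inter> \<rho> \<subset> \<sigma>" using that s facets_mem unfolding facets_def by blast
    then have "card (vertices (\<sigma> \<inter> \<rho>)) < card (vertices \<sigma>)"
      using card_vertices_mono[OF Int_mem] s that facets_mem by blast
    then have "card (vertices (\<sigma> \<inter> \<rho>)) = 0" using card_facet[OF s(1)] d by simp
    then have "\<sigma> \<inter> \<rho> = {}"
      using vertices_empty_iff[OF Int_mem] simplex_vertices(1)[OF Int_mem] s that facets_mem by (metis card_0_eq)
    then show False using \<open>x \<in> \<rho>\<close> that by blast
  qed
  define B where "B = \<Union>(facets K - {\<sigma>})"
  have "closed B" unfolding B_def using finite_facets closed_face facets_mem by (intro closed_Union) auto
  moreover have "closed \<sigma>" using closed_face facets_mem s by blast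
  moreover have "\<Union>K \<subseteq> \<sigma> \<union> B"
  proof
    fix x assume "x \<in> \<Union>K"
    then obtain g where g: "g \<in> K" "x \<in> g" by blast
    obtain \<rho> where "\<rho> \<in> facets K" "g \<subseteq> \<rho>" by (rule facet_exists[OF g(1)])
    then show "x \<in> \<sigma> \<union> B" using g unfolding B_def by blast
  qed
  moreover have "\<sigma> \<inter> B \<inter> \<Union>K = {}" using disj unfolding B_def by blast
  moreover have "\<sigma> \<inter> \<Union>K \<noteq> {}" "B \<inter> \<Union>K \<noteq> {}"
    using s facet_nonempty facets_mem unfolding B_def by blast+
  ultimately show False using connected_complex unfolding connected_closed by blast
qed

lemma barycenter_ridge:
  assumes "neighbouring_facets K \<sigma> \<tau>"
  shows "barycenter (\<sigma> \<inter> \<tau>) \<in> rel_interior (\<sigma> \<inter> \<tau>)" "barycenter (\<sigma> \<inter> \<tau>) \<in> \<sigma>" "barycenter (\<sigma> \<inter> \<tau>) \<in> \<tau>"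
    "barycenter (\<sigma> \<inter> \<tau>) \<in> Y"
proof -
  have m: "\<sigma> \<inter> \<tau> \<in> K" using Int_mem facets_mem neighbouring_mem[OF assms] by blast
  show 1: "barycenter (\<sigma> \<inter> \<tau>) \<in> rel_interior (\<sigma> \<inter> \<tau>)"
    using barycenter_rel_interior[OF m ridge_nonempty[OF assms]] .
  then show "barycenter (\<sigma> \<inter> \<tau>) \<in> \<sigma>" "barycenter (\<sigma> \<inter> \<tau>) \<in> \<tau>" using rel_interior_subset by blast+
  show "barycenter (\<sigma> \<inter> \<tau>) \<in> Y" using ridge_not_odd[OF assms 1] .
qed

text \<open>A segment from a relative interior point of a convex set stays in the relative interior
  up to its other end.\<close>

lemma segment_off_odd:
  assumes "\<sigma> \<in> facets K" "x \<in> \<sigma>" "x \<in> Y"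
  shows "closed_segment (barycenter \<sigma>) x \<subseteq> Y"
proof -
  have "open_segment (barycenter \<sigma>) x \<subseteq> rel_interior \<sigma>"
    using rel_interior_closure_convex_segment[OF convex_face barycenter_facet(1)] assms facets_mem closure_subset by blast
  then have "open_segment (barycenter \<sigma>) x \<subseteq> Y" using facet_not_odd[OF assms(1)] by blast
  then show ?thesis using assms(3) barycenter_facet(3)[OF assms(1)] closed_segment_eq_open by blast
qed

lemma barycentric_path_in:
  assumes "facet_path K \<gamma>"
  shows "path (barycentric_path \<gamma>) \<and> path_image (barycentric_path \<gamma>) \<subseteq> Y \<and>
    pathstart (barycentric_path \<gamma>) = barycenter (hd \<gamma>) \<and> pathfinish (barycentric_path \<gamma>) = barycenter (last \<gamma>)"
  using assms
proof (induction \<gamma> rule: induct_list012)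
  case (2 \<sigma>)
  then show ?case using barycenter_facet(3)[of \<sigma>] path_linepath[of "barycenter \<sigma>" "barycenter \<sigma>"]
    by (simp add: pathstart_def pathfinish_def linepath_refl)
next
  case (3 \<sigma> \<tau> \<gamma>)
  then have n: "neighbouring_facets K \<sigma> \<tau>" and p: "facet_path K (\<tau> # \<gamma>)" by auto
  have s: "\<sigma> \<in> facets K" "\<tau> \<in> facets K" using neighbouring_mem[OF n] by auto
  note r = barycenter_ridge[OF n]
  have "closed_segment (barycenter \<sigma>) (barycenter (\<sigma> \<inter> \<tau>)) \<subseteq> Y"
    "closed_segment (barycenter \<tau>) (barycenter (\<sigma> \<inter> \<tau>)) \<subseteq> Y"
    using segment_off_odd[OF s(1) r(2,4)] segment_off_odd[OF s(2) r(3,4)] by auto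
  then show ?case using 3(2)[OF p]
    by (simp add: subset_path_image_join closed_segment_commute)
qed simp

text \<open>Each section lifts the segments inside its facet, and the agreement at the ridge
  barycenters lets the lifted segments be joined. Over the one-facet path the lift is
  constant.\<close>

lemma section_chain_lift:
  assumes "section_chain X q s \<gamma> a b"
  shows "\<exists>\<alpha>. pathin X \<alpha> \<and> (\<forall>t\<in>{0..1}. q (\<alpha> t) = barycentric_path \<gamma> t) \<and>
     \<alpha> 0 = s (hd \<gamma>) a (barycenter (hd \<gamma>)) \<and> \<alpha> 1 = s (last \<gamma>) b (barycenter (last \<gamma>))"
  using assms
proof (induction rule: section_chain.induct)
  case (single \<sigma> a)
  let ?b = "barycenter \<sigma>"
  show ?case
    using section_linepath[OF single(2) convex_face[OF facets_mem[OF single(1)]], of ?b ?b] barycenter_facet(2)[OF single(1)]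
    by (intro exI[of _ "s \<sigma> a \<circ> linepath ?b ?b"]) (auto simp: linepath_refl)
next
  case (cons \<sigma> \<tau> a b \<gamma> c)
  then obtain \<alpha> where \<alpha>: "pathin X \<alpha>" "\<And>t. t \<in> {0..1} \<Longrightarrow> q (\<alpha> t) = barycentric_path (\<tau> # \<gamma>) t"
    "\<alpha> 0 = s \<tau> b (barycenter \<tau>)" "\<alpha> 1 = s (last (\<tau> # \<gamma>)) c (barycenter (last (\<tau> # \<gamma>)))" by auto
  have st: "\<sigma> \<in> facets K" "\<tau> \<in> facets K" using neighbouring_mem[OF cons(1)] by auto
  note r = barycenter_ridge[OF cons(1)]
  let ?r = "barycenter (\<sigma> \<inter> \<tau>)"
  have so: "section_over X q \<tau> (s \<tau> b)" using section_chain_hd[OF cons(4)] by simp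
  note l1 = section_linepath[OF cons(2) convex_face[OF facets_mem[OF st(1)]] barycenter_facet(2)[OF st(1)] r(2)]
  note l2 = section_linepath[OF so convex_face[OF facets_mem[OF st(2)]] r(3) barycenter_facet(2)[OF st(2)]]
  define g where "g = s \<sigma> a \<circ> linepath (barycenter \<sigma>) ?r"
  define h where "h = s \<tau> b \<circ> linepath ?r (barycenter \<tau>)"
  have ends: "g 0 = s \<sigma> a (barycenter \<sigma>)" "g 1 = h 0" "h 1 = \<alpha> 0"
    using cons(3) \<alpha>(3) by (auto simp: g_def h_def linepath_def)
  have "pathin X (concat_paths g (concat_paths h \<alpha>))"
    by (intro pathin_concat) (use l1(1) l2(1) \<alpha>(1) ends in \<open>auto simp: g_def h_def concat_paths_def\<close>)
  moreover have "q (concat_paths g (concat_paths h \<alpha>) t) = barycentric_path (\<sigma> # \<tau> # \<gamma>) t" if t: "t \<in> {0..1}" for t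
    using t l1(2)[of "2 * t"] l2(2)[of "2 * (2 * t - 1)"] \<alpha>(2)[of "2 * (2 * t - 1) - 1"]
    by (auto simp: concat_paths_def joinpaths_def g_def h_def)
  moreover have "concat_paths g (concat_paths h \<alpha>) 0 = s (hd (\<sigma> # \<tau> # \<gamma>)) a (barycenter (hd (\<sigma> # \<tau> # \<gamma>)))"
    "concat_paths g (concat_paths h \<alpha>) 1 = s (last (\<sigma> # \<tau> # \<gamma>)) c (barycenter (last (\<sigma> # \<tau> # \<gamma>)))"
    using ends \<alpha>(4) by (simp_all add: concat_paths_def)
  ultimately show ?case by blast
qed

section \<open>Well-definedness of the projectivity homomorphism\<close>

lemma section_over_sheet:
  "\<sigma> \<in> facets K \<Longrightarrow> v \<in> vertices \<sigma> \<Longrightarrow> section_over (partial_unfolding K) unfolding_map \<sigma> (sheet \<sigma> v)"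
  by (simp add: section_over_def continuous_sheet unfolding_map_sheet)

text \<open>The copies labelled by successive perspectivity images of \<open>v\<close> are glued
  across each ridge. With \<open>section_chain_lift\<close> the lifted barycentric path therefore
  ends in the copy labelled \<open>projectivity \<gamma> v\<close>.\<close>

lemma projectivity_chain:
  assumes "facet_path K \<gamma>" "v \<in> vertices (hd \<gamma>)"
  shows "section_chain (partial_unfolding K) unfolding_map sheet \<gamma> v (projectivity \<gamma> v) \<and>
    projectivity \<gamma> v \<in> vertices (last \<gamma>)"
  using assms
proof (induction \<gamma> arbitrary: v rule: induct_list012)
  case (2 \<sigma>)
  then show ?case using section_chain.single[of \<sigma> _ _ sheet v] section_over_sheet by simp
next
  case (3 \<sigma> \<tau> \<gamma>)
  then have n: "neighbouring_facets K \<sigma> \<tau>" and p: "facet_path K (\<tau> # \<gamma>)" and v: "v \<in> vertices \<sigma>" by auto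
  define w where "w = perspectivity \<sigma> \<tau> v"
  have w: "w \<in> vertices \<tau>" unfolding w_def by (rule perspectivity_mem[OF n v])
  have IH: "section_chain (partial_unfolding K) unfolding_map sheet (\<tau> # \<gamma>) w (projectivity (\<tau> # \<gamma>) w)"
    "projectivity (\<tau> # \<gamma>) w \<in> vertices (last (\<tau> # \<gamma>))" using 3(2)[OF p, of w] w by auto
  have "sheet \<sigma> v (barycenter (\<sigma> \<inter> \<tau>)) = sheet \<tau> w (barycenter (\<sigma> \<inter> \<tau>))"
    unfolding sheet_eq_iff w_def by (rule glued_step[OF n v barycenter_ridge(2,3)[OF n]])
  moreover have "projectivity (\<sigma> # \<tau> # \<gamma>) v = projectivity (\<tau> # \<gamma>) w" using v by (simp add: compose_def w_def)
  ultimately show ?case using section_chain.cons[OF n section_over_sheet _ IH(1)] IH(2) v neighbouring_mem[OF n] by auto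
qed simp

lemma projectivity_extensional: "\<gamma> \<noteq> [] \<Longrightarrow> projectivity \<gamma> \<in> extensional (vertices (hd \<gamma>))"
  by (cases \<gamma> rule: projectivity.cases) (auto simp: compose_def)

lemma covering_unfolding_off_odd:
  "covering_map (subtopology (partial_unfolding K) (preimage_in (partial_unfolding K) unfolding_map Y))
     (top_of_set Y) unfolding_map"
  by (rule covering_unfolding) (auto intro!: trivial_holonomy_off_odd link_simply_connected)

text \<open>Lifts of the two barycentric paths to the unfolding that start in the copy labelled
  \<open>v\<close> have the same end point, and trivial holonomy at the barycenter recovers the
  label from that point.\<close>

lemma projectivity_cong:
  assumes g: "\<gamma> \<in> closed_facet_paths K \<sigma>0" "\<gamma>' \<in> closed_facet_paths K \<sigma>0"
    and hom: "path_homotopic (top_of_set Y) (barycentric_path \<gamma>) (barycentric_path \<gamma>')"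
  shows "projectivity \<gamma> = projectivity \<gamma>'"
proof
  fix v
  let ?U = "partial_unfolding K"
  have p: "facet_path K \<gamma>" "hd \<gamma> = \<sigma>0" "last \<gamma> = \<sigma>0" "facet_path K \<gamma>'" "hd \<gamma>' = \<sigma>0" "last \<gamma>' = \<sigma>0"
    using g by (auto simp: closed_facet_paths_def)
  have ne: "\<gamma> \<noteq> []" "\<gamma>' \<noteq> []" using p by auto
  show "projectivity \<gamma> v = projectivity \<gamma>' v"
  proof (cases "v \<in> vertices \<sigma>0")
    case False
    then show ?thesis using projectivity_extensional ne p by (metis extensional_arb)
  next
    case v: True
    have s0: "\<sigma>0 \<in> facets K" using p(1,2) by (cases \<gamma> rule: projectivity.cases) (auto simp: neighbouring_facets_def)
    note c = projectivity_chain[OF p(1), unfolded p(2,3), OF v] projectivity_chain[OF p(4), unfolded p(5,6), OF v]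
    obtain \<alpha> where \<alpha>: "pathin ?U \<alpha>" "\<And>t. t \<in> {0..1} \<Longrightarrow> unfolding_map (\<alpha> t) = barycentric_path \<gamma> t"
       "\<alpha> 0 = sheet \<sigma>0 v (barycenter \<sigma>0)" "\<alpha> 1 = sheet \<sigma>0 (projectivity \<gamma> v) (barycenter \<sigma>0)"
      using section_chain_lift[OF conjunct1[OF c(1)]] p by auto
    obtain \<beta> where \<beta>: "pathin ?U \<beta>" "\<And>t. t \<in> {0..1} \<Longrightarrow> unfolding_map (\<beta> t) = barycentric_path \<gamma>' t"
       "\<beta> 0 = sheet \<sigma>0 v (barycenter \<sigma>0)" "\<beta> 1 = sheet \<sigma>0 (projectivity \<gamma>' v) (barycenter \<sigma>0)"
      using section_chain_lift[OF conjunct1[OF c(2)]] p by auto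
    have inY: "barycentric_path \<gamma> t \<in> Y" "barycentric_path \<gamma>' t \<in> Y" if "t \<in> {0..1}" for t
      using barycentric_path_in[OF p(1)] barycentric_path_in[OF p(4)] that unfolding path_image_def by blast+
    have lift: "pathin (subtopology ?U (preimage_in ?U unfolding_map Y)) \<delta>"
      if "pathin ?U \<delta>" "\<And>t. t \<in> {0..1} \<Longrightarrow> unfolding_map (\<delta> t) \<in> Y" for \<delta>
      using that unfolding pathin_def
      by (intro continuous_map_into_subtopology) (auto simp: preimage_in_def continuous_map_def)
    have "\<alpha> 1 = \<beta> 1"
      by (rule covering_lift_path_homotopic[OF covering_unfolding_off_odd hom lift[OF \<alpha>(1)] \<alpha>(2) lift[OF \<beta>(1)] \<beta>(2)])
        (use \<alpha> \<beta> inY in auto)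
    then have "(((\<sigma>0, projectivity \<gamma> v), barycenter \<sigma>0), ((\<sigma>0, projectivity \<gamma>' v), barycenter \<sigma>0)) \<in> glued"
      using \<alpha>(4) \<beta>(4) sheet_eq_iff by metis
    moreover have "trivial_holonomy (barycenter \<sigma>0)"
      by (rule trivial_holonomy_off_odd[OF link_simply_connected barycenter_facet(3)[OF s0]])
    ultimately show ?thesis
      using s0 barycenter_facet(2)[OF s0] c unfolding trivial_holonomy_def by blast
  qed
qed

lemma barycentric_loop:
  assumes "\<gamma> \<in> closed_facet_paths K \<sigma>0"
  shows "barycentric_path \<gamma> \<in> loops (top_of_set Y) (barycenter \<sigma>0)"
proof -
  have p: "facet_path K \<gamma>" "hd \<gamma> = \<sigma>0" "last \<gamma> = \<sigma>0" using assms by (auto simp: closed_facet_paths_def)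
  show ?thesis using barycentric_path_in[OF p(1)] p(2,3)
    by (auto simp: loops_def pathin_def path_def path_image_def pathstart_def pathfinish_def)
qed

text \<open>The definite description has a single candidate: a loop class contains its own
  representative, so equal classes give homotopic barycentric paths and hence equal
  projectivities.\<close>

lemma projectivity_hom_eq:
  assumes g: "\<gamma> \<in> closed_facet_paths K \<sigma>0"
  shows "projectivity_hom K \<sigma>0 (loop_class (top_of_set Y) (barycenter \<sigma>0) (barycentric_path \<gamma>)) = projectivity \<gamma>"
  unfolding projectivity_hom_def
proof (rule the_equality)
  fix h assume "\<exists>\<gamma>'\<in>closed_facet_paths K \<sigma>0.
      loop_class (top_of_set Y) (barycenter \<sigma>0) (barycentric_path \<gamma>) =
      loop_class (top_of_set Y) (barycenter \<sigma>0) (barycentric_path \<gamma>') \<and> h = projectivity \<gamma>'"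
  then obtain \<gamma>' where g': "\<gamma>' \<in> closed_facet_paths K \<sigma>0" "h = projectivity \<gamma>'" and
     eq: "loop_class (top_of_set Y) (barycenter \<sigma>0) (barycentric_path \<gamma>) =
      loop_class (top_of_set Y) (barycenter \<sigma>0) (barycentric_path \<gamma>')" by blast
  have "barycentric_path \<gamma>' \<in> loop_class (top_of_set Y) (barycenter \<sigma>0) (barycentric_path \<gamma>)"
    unfolding eq by (rule loop_class_self[OF barycentric_loop[OF g'(1)]])
  then have "path_homotopic (top_of_set Y) (barycentric_path \<gamma>) (barycentric_path \<gamma>')"
    by (simp add: loop_class_def)
  then show "h = projectivity \<gamma>" using projectivity_cong[OF g g'(1)] g'(2) by simp
qed (use g in blast)

end

section \<open>Sections over the facets of a branched cover\<close>

text \<open>Such sets are the domains for lifting through a prescribed point that may lie over the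
  boundary of a face: convex, and off the odd subcomplex if \<open>y\<close> is.\<close>

lemma convex_insert_rel_interior:
  fixes S :: "'a::euclidean_space set"
  assumes "convex S" "y \<in> S"
  shows "convex (insert y (rel_interior S))"
proof -
  have seg: "open_segment a y \<subseteq> rel_interior S" if "a \<in> rel_interior S" for a
    using rel_interior_closure_convex_segment[OF assms(1) that] assms(2) closure_subset by blast
  have "open_segment a b \<subseteq> insert y (rel_interior S)"
    if "a \<in> insert y (rel_interior S)" "b \<in> insert y (rel_interior S)" for a b
  proof (cases "a = y")
    case True
    show ?thesis
    proof (cases "b = y")
      case False
      then show ?thesis using True that seg[of b] open_segment_commute by blast
    qed (use True in simp)
  next
    case a: False
    show ?thesis
    proof (cases "b = y")
      case False
      then have "open_segment a b \<subseteq> rel_interior S"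
        using a that rel_interior_closure_convex_segment[OF assms(1), of a b] rel_interior_subset closure_subset by blast
      then show ?thesis by blast
    qed (use a that seg[of a] in blast)
  qed
  then show ?thesis unfolding convex_contains_open_segment by blast
qed

locale cover_of_nice_complex = nice_geometric_complex +
  fixes X :: "'x topology" and q :: "'x \<Rightarrow> 'a"
  assumes branched: "branched_cover X (top_of_set (\<Union>K)) q"
    and branching: "branching_set X (top_of_set (\<Union>K)) q = \<Union>(odd_subcomplex K)"
begin

abbreviation X0 where "X0 \<equiv> preimage_in X q Y"

lemma complete_spread_q: "complete_spread X (top_of_set (\<Union>K)) q"
  and dense_X0: "X closure_of X0 = topspace X"
  and locally_connected_X0: "locally_connected_within X X0"
  using branched branching unfolding branched_cover_def Let_def by auto

lemma spread_q: "spread X (top_of_set (\<Union>K)) q"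
  using complete_spread_q by (simp add: complete_spread_def)

lemma continuous_q: "continuous_map X (top_of_set (\<Union>K)) q"
  using spread_q by (simp add: spread_def)

lemma Hausdorff_X: "Hausdorff_space X"
  by (rule spread_Hausdorff[OF spread_q]) (simp add: Hausdorff_space_subtopology)

lemma covering_X0: "covering_map (subtopology X X0) (top_of_set Y) q"
  using covering_off_branching_set[OF continuous_q] unfolding branching covering_off_def
  by (simp add: subtopology_subtopology Int_absorb1)

lemma rel_interior_face_convex:
  assumes "g \<in> K" "rel_interior g \<subseteq> Y" "y \<in> g" "y \<in> Y"
  shows "convex (insert y (rel_interior g))" "insert y (rel_interior g) \<subseteq> Y" "insert y (rel_interior g) \<subseteq> g"
proof -
  show "convex (insert y (rel_interior g))"
    by (rule convex_insert_rel_interior[OF convex_face[OF assms(1)] assms(3)])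
  show "insert y (rel_interior g) \<subseteq> Y" using assms(2,4) by blast
  show "insert y (rel_interior g) \<subseteq> g" using assms(3) rel_interior_subset by blast
qed

text \<open>Uniqueness of lifts on the convex set \<open>insert y (rel_interior g)\<close> spreads
  the agreement from \<open>y\<close>; density of the relative interior and the Hausdorff property
  of \<open>X\<close> extend it to all of \<open>g\<close>, including the odd faces in its
  boundary.\<close>

lemma sections_agree:
  assumes g: "g \<in> K" "rel_interior g \<subseteq> Y" and y: "y \<in> g" "y \<in> Y"
    and s: "section_over X q g s" "section_over X q g s'" and eq: "s y = s' y" and z: "z \<in> g"
  shows "s z = s' z"
proof -
  let ?D = "insert y (rel_interior g)"
  note D = rel_interior_face_convex[OF g y]
  have c: "continuous_map (top_of_set ?D) (subtopology X X0) t" if "section_over X q g t" for t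
  proof (rule continuous_map_into_subtopology)
    show "continuous_map (top_of_set ?D) X t"
      by (rule continuous_map_from_subtopology_mono[OF _ D(3)]) (use that in \<open>simp add: section_over_def\<close>)
    show "t \<in> topspace (top_of_set ?D) \<rightarrow> X0"
    proof
      fix z assume "z \<in> topspace (top_of_set ?D)"
      then have "z \<in> g" "z \<in> Y" using D(2,3) by (simp_all only: topspace_euclidean_subtopology) blast+
      then show "t z \<in> X0"
        using that unfolding section_over_def preimage_in_def continuous_map_def by auto
    qed
  qed
  have "connected_space (top_of_set ?D)"
    using convex_connected[OF D(1)] by (simp add: connectedin_iff_connected[symmetric] connectedin_def)
  then have on_D: "s x = s' x" if "x \<in> ?D" for x
    by (rule covering_lift_unique[OF covering_X0 _ c[OF s(1)] c[OF s(2)], of y])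
       (use that eq s D(3) in \<open>auto simp: section_over_def subset_iff\<close>)
  have "closedin (top_of_set g) {x \<in> topspace (top_of_set g). s x = s' x}"
    by (rule closedin_continuous_maps_eq[OF Hausdorff_X]) (use s in \<open>auto simp: section_over_def\<close>)
  then have "closed {x \<in> g. s x = s' x}" using closed_face[OF g(1)] closedin_closed_trans by auto
  moreover have "rel_interior g \<subseteq> {x \<in> g. s x = s' x}" using on_D rel_interior_subset by blast
  ultimately have "closure (rel_interior g) \<subseteq> {x \<in> g. s x = s' x}" by (rule closure_minimal[rotated])
  then show ?thesis using z convex_closure_rel_interior[OF convex_face[OF g(1)]] closure_subset by blast
qed

lemma facet_rel_interior: "\<sigma> \<in> facets K \<Longrightarrow> rel_interior \<sigma> \<subseteq> Y"
  using facet_not_odd by blast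

lemma ridge_rel_interior: "neighbouring_facets K \<sigma> \<tau> \<Longrightarrow> rel_interior (\<sigma> \<inter> \<tau>) \<subseteq> Y"
  using ridge_not_odd by blast

text \<open>The covering is lifted through \<open>x\<close> over the relative interior with
  \<open>q x\<close> added, and \<open>complete_spread_extend\<close> carries this lift to the whole
  facet. Its local condition holds because balls cut a convex set in convex sets.\<close>

lemma section_exists:
  assumes s: "\<sigma> \<in> facets K" and x: "x \<in> topspace X" "q x \<in> \<sigma>" "q x \<in> Y"
  obtains s where "section_over X q \<sigma> s" "s (q x) = x"
proof -
  have sK: "\<sigma> \<in> K" using s facets_mem by blast
  let ?D = "insert (q x) (rel_interior \<sigma>)"
  note D = rel_interior_face_convex[OF sK facet_rel_interior[OF s] x(2,3)]
  have idc: "continuous_map (top_of_set ?D) (top_of_set Y) id"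
    by (rule continuous_map_into_subtopology)
       (simp, simp only: topspace_euclidean_subtopology Pi_iff id_apply, use D(2) in blast)
  have xX: "x \<in> topspace (subtopology X X0)" using x by (simp add: preimage_in_def)
  obtain s0 where s0: "continuous_map (top_of_set ?D) (subtopology X X0) s0" "\<And>z. z \<in> ?D \<Longrightarrow> q (s0 z) = z" "s0 (q x) = x"
    using covering_lift_convex[OF covering_X0 D(1) idc _ xX, of "q x"] by (auto simp del: UN_iff)
  have s0X: "continuous_map (top_of_set ?D) X s0" using s0(1) continuous_map_into_fulltopology by blast
  have loc: "?D \<inter> ball z e \<noteq> {} \<and> connected (?D \<inter> ball z e)" if z: "z \<in> \<sigma>" "e > 0" for z e
  proof
    have "z \<in> closure (rel_interior \<sigma>)"
      using convex_closure_rel_interior[OF convex_face[OF sK]] z closure_subset by blast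
    then obtain w where "w \<in> rel_interior \<sigma>" "dist w z < e" using z(2) closure_approachable by blast
    then have "w \<in> ?D \<inter> ball z e" by (simp add: dist_commute)
    then show "?D \<inter> ball z e \<noteq> {}" by blast
    show "connected (?D \<inter> ball z e)" by (intro convex_connected convex_Int D(1) convex_ball)
  qed
  obtain s where "continuous_map (top_of_set \<sigma>) X s" "\<And>z. z \<in> \<sigma> \<Longrightarrow> q (s z) = z" "\<And>z. z \<in> ?D \<Longrightarrow> s z = s0 z"
    by (rule complete_spread_extend[OF complete_spread_q _ D(3) s0X s0(2) loc]) (use sK in auto)
  then show thesis using that[of s] s0(3) by (simp add: section_over_def)
qed

definition fibre where "fibre \<sigma> = preimage_in X q {barycenter \<sigma>}"

text \<open>On a facet \<sigma> the choice has only one possible value, by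
  \<open>sections_agree\<close>; thus points of the fibre over the barycenter name the sections over
  \<sigma>.\<close>

definition sec where "sec \<sigma> e = (SOME s. section_over X q \<sigma> s \<and> s (barycenter \<sigma>) = e)"

lemma sec:
  assumes "\<sigma> \<in> facets K" "e \<in> fibre \<sigma>"
  shows "section_over X q \<sigma> (sec \<sigma> e)" "sec \<sigma> e (barycenter \<sigma>) = e"
proof -
  have e: "e \<in> topspace X" "q e = barycenter \<sigma>" using assms(2) by (auto simp: fibre_def preimage_in_def)
  obtain s where "section_over X q \<sigma> s" "s (q e) = e"
    by (rule section_exists[OF assms(1) e(1)]) (use barycenter_facet[OF assms(1)] e in auto)
  then have "\<exists>s. section_over X q \<sigma> s \<and> s (barycenter \<sigma>) = e" using e by auto
  from someI_ex[OF this] show "section_over X q \<sigma> (sec \<sigma> e)" "sec \<sigma> e (barycenter \<sigma>) = e"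
    unfolding sec_def by auto
qed

lemma section_over_range: "section_over X q \<sigma> s \<Longrightarrow> z \<in> \<sigma> \<Longrightarrow> s z \<in> topspace X \<and> q (s z) = z"
  by (auto simp: section_over_def continuous_map_def)

lemma section_is_sec:
  assumes s: "\<sigma> \<in> facets K" and t: "section_over X q \<sigma> s"
  shows "s (barycenter \<sigma>) \<in> fibre \<sigma>" "\<And>z. z \<in> \<sigma> \<Longrightarrow> s z = sec \<sigma> (s (barycenter \<sigma>)) z"
proof -
  show f: "s (barycenter \<sigma>) \<in> fibre \<sigma>"
    using section_over_range[OF t barycenter_facet(2)[OF s]] by (simp add: fibre_def preimage_in_def)
  show "s z = sec \<sigma> (s (barycenter \<sigma>)) z" if "z \<in> \<sigma>" for z
    by (rule sections_agree[OF facets_mem[OF s] facet_rel_interior[OF s] barycenter_facet(2,3)[OF s] t sec(1)[OF s f] _ that])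
       (simp add: sec(2)[OF s f])
qed

lemma sec_inj:
  assumes s: "\<sigma> \<in> facets K" and e: "e \<in> fibre \<sigma>" "e' \<in> fibre \<sigma>" and y: "y \<in> \<sigma>" "y \<in> Y" and eq: "sec \<sigma> e y = sec \<sigma> e' y"
  shows "e = e'"
  using sections_agree[OF facets_mem[OF s] facet_rel_interior[OF s] y sec(1)[OF s e(1)] sec(1)[OF s e(2)] eq barycenter_facet(2)[OF s]]
    sec(2)[OF s] e by simp

text \<open>The fibre counterpart of a perspectivity. Comparing at the ridge barycenter is enough,
  since that point lies off the odd subcomplex.\<close>

definition transported where
  "transported \<sigma> e \<tau> e' \<longleftrightarrow> neighbouring_facets K \<sigma> \<tau> \<and> e \<in> fibre \<sigma> \<and> e' \<in> fibre \<tau> \<and>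
     sec \<sigma> e (barycenter (\<sigma> \<inter> \<tau>)) = sec \<tau> e' (barycenter (\<sigma> \<inter> \<tau>))"

lemma transported_sym: "transported \<sigma> e \<tau> e' \<Longrightarrow> transported \<tau> e' \<sigma> e"
  by (auto simp: transported_def Int_commute neighbouring_sym)

lemma transported_exists:
  assumes n: "neighbouring_facets K \<sigma> \<tau>" and e: "e \<in> fibre \<sigma>"
  obtains e' where "transported \<sigma> e \<tau> e'"
proof -
  have st: "\<sigma> \<in> facets K" "\<tau> \<in> facets K" using neighbouring_mem[OF n] by auto
  note r = barycenter_ridge[OF n]
  let ?r = "barycenter (\<sigma> \<inter> \<tau>)"
  have x: "sec \<sigma> e ?r \<in> topspace X" "q (sec \<sigma> e ?r) = ?r"
    using section_over_range[OF sec(1)[OF st(1) e] r(2)] by auto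
  obtain s where s: "section_over X q \<tau> s" "s ?r = sec \<sigma> e ?r"
    using section_exists[OF st(2) x(1)] x r by metis
  note t = section_is_sec[OF st(2) s(1)]
  have "transported \<sigma> e \<tau> (s (barycenter \<tau>))"
    unfolding transported_def using n e t(1) t(2)[OF r(3)] s(2) by simp
  then show thesis by (rule that)
qed

lemma transported_unique: "transported \<sigma> e \<tau> e' \<Longrightarrow> transported \<sigma> e \<tau> e'' \<Longrightarrow> e' = e''"
  unfolding transported_def using sec_inj barycenter_ridge neighbouring_mem by metis

text \<open>This is \<open>sections_agree\<close> for the ridge as the face \<open>g\<close>:
  agreement at its barycenter spreads over the whole ridge, odd faces included.\<close>

lemma transported_ridge:
  assumes t: "transported \<sigma> e \<tau> e'" and z: "z \<in> \<sigma>" "z \<in> \<tau>"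
  shows "sec \<sigma> e z = sec \<tau> e' z"
proof -
  have n: "neighbouring_facets K \<sigma> \<tau>" and e: "e \<in> fibre \<sigma>" "e' \<in> fibre \<tau>"
    and eq: "sec \<sigma> e (barycenter (\<sigma> \<inter> \<tau>)) = sec \<tau> e' (barycenter (\<sigma> \<inter> \<tau>))" using t by (auto simp: transported_def)
  have st: "\<sigma> \<in> facets K" "\<tau> \<in> facets K" using neighbouring_mem[OF n] by auto
  have m: "\<sigma> \<inter> \<tau> \<in> K" using Int_mem facets_mem st by blast
  have so: "section_over X q (\<sigma> \<inter> \<tau>) (sec \<sigma> e)" "section_over X q (\<sigma> \<inter> \<tau>) (sec \<tau> e')"
    using sec(1)[OF st(1) e(1)] sec(1)[OF st(2) e(2)] unfolding section_over_def
    by (auto intro: continuous_map_from_subtopology_mono)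
  show ?thesis
    by (rule sections_agree[OF m ridge_rel_interior[OF n] _ barycenter_ridge(4)[OF n] so eq])
       (use barycenter_ridge[OF n] z in auto)
qed

end

section \<open>Matching the sheets\<close>

text \<open>The assumption \<open>monodromy\<close> is the commutation hypothesis in lifted form:
  along a closed facet path the sections of \<open>X\<close> permute the fibre as the projectivity
  permutes the vertices, after identification by \<iota>.\<close>

locale cover_with_projectivities = cover_of_nice_complex +
  fixes \<iota> :: "'b \<Rightarrow> 'a" and \<sigma>0 :: "'a set"
  assumes base_facet: "\<sigma>0 \<in> facets K"
    and bij: "bij_betw \<iota> (fibre \<sigma>0) (vertices \<sigma>0)"
    and monodromy: "\<And>\<gamma> e e'. \<gamma> \<in> closed_facet_paths K \<sigma>0 \<Longrightarrow> e \<in> fibre \<sigma>0 \<Longrightarrow> e' \<in> fibre \<sigma>0 \<Longrightarrow>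
      section_chain X q sec \<gamma> e e' \<Longrightarrow> \<iota> e' = projectivity \<gamma> (\<iota> e)"
begin

definition joint_step where
  "joint_step = (\<lambda>(\<sigma>, v, e) (\<tau>, w, e'). v \<in> vertices \<sigma> \<and> w = perspectivity \<sigma> \<tau> v \<and> transported \<sigma> e \<tau> e')"

text \<open>One facet path is recovered that carries both the vertex and the section. The induction
  adds steps at the front because \<open>projectivity\<close> and \<open>section_chain\<close> both
  recurse on the first facet.\<close>

lemma joint_step_path:
  assumes j: "joint_step\<^sup>*\<^sup>* s (\<tau>, w, e')" and s: "s = (\<sigma>, v, e)" "\<sigma> \<in> facets K" "v \<in> vertices \<sigma>" "e \<in> fibre \<sigma>"
  shows "\<exists>\<gamma>. facet_path K \<gamma> \<and> hd \<gamma> = \<sigma> \<and> last \<gamma> = \<tau> \<and> projectivity \<gamma> v = w \<and> section_chain X q sec \<gamma> e e' \<and> e' \<in> fibre \<tau>"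
  using assms
proof (induction arbitrary: \<sigma> v e rule: converse_rtranclp_induct)
  case base
  then show ?case
    by (intro exI[of _ "[\<tau>]"]) (auto simp: section_chain.single sec)
next
  case (step s z)
  obtain \<rho> u a where z: "z = (\<rho>, u, a)" by (cases z)
  have v: "\<sigma> \<in> facets K" "v \<in> vertices \<sigma>" "e \<in> fibre \<sigma>" using step.prems by auto
  have n: "neighbouring_facets K \<sigma> \<rho>" and u: "u = perspectivity \<sigma> \<rho> v" and t: "transported \<sigma> e \<rho> a"
    using step.hyps(1) step.prems(1) unfolding z joint_step_def by (auto simp: transported_def)
  have u': "u \<in> vertices \<rho>" "a \<in> fibre \<rho>" "\<rho> \<in> facets K"
    using u perspectivity_mem[OF n v(2)] t neighbouring_mem[OF n] by (auto simp: transported_def)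
  obtain \<gamma> where g: "facet_path K \<gamma>" "hd \<gamma> = \<rho>" "last \<gamma> = \<tau>" "projectivity \<gamma> u = w" "section_chain X q sec \<gamma> a e'" "e' \<in> fibre \<tau>"
    using step.IH[OF z u'(3,1,2)] by blast
  obtain \<gamma>' where g': "\<gamma> = \<rho> # \<gamma>'" using g(1,2) by (cases \<gamma>) auto
  have "section_chain X q sec (\<sigma> # \<rho> # \<gamma>') e e'"
    using section_chain.cons[OF n sec(1)[OF v(1,3)] _ g(5)[unfolded g']] t by (simp add: transported_def)
  moreover have "projectivity (\<sigma> # \<rho> # \<gamma>') v = w" using g(4) v(2) u by (simp add: g' compose_def)
  ultimately show ?case using g n by (intro exI[of _ "\<sigma> # \<rho> # \<gamma>'"]) (auto simp: g')
qed

text \<open>A relation first: \<open>v\<close> and \<open>e\<close> are matched if they arise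
  together, along the same facet path, from a pair matched by \<iota> over \<sigma>0. That it is
  one-to-one over every facet remains to be proved.\<close>

definition labelled where
  "labelled \<sigma> v e \<longleftrightarrow> (\<exists>e0\<in>fibre \<sigma>0. joint_step\<^sup>*\<^sup>* (\<sigma>0, \<iota> e0, e0) (\<sigma>, v, e))"

lemma \<iota>_mem: "e \<in> fibre \<sigma>0 \<Longrightarrow> \<iota> e \<in> vertices \<sigma>0"
  using bij by (auto simp: bij_betw_def)

lemma labelled_mem:
  assumes "labelled \<sigma> v e"
  shows "v \<in> vertices \<sigma> \<and> e \<in> fibre \<sigma> \<and> \<sigma> \<in> facets K"
proof -
  obtain e0 where e0: "e0 \<in> fibre \<sigma>0" "joint_step\<^sup>*\<^sup>* (\<sigma>0, \<iota> e0, e0) (\<sigma>, v, e)"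
    using assms by (auto simp: labelled_def)
  have "case z of (\<sigma>, v, e) \<Rightarrow> v \<in> vertices \<sigma> \<and> e \<in> fibre \<sigma> \<and> \<sigma> \<in> facets K"
    if "joint_step\<^sup>*\<^sup>* (\<sigma>0, \<iota> e0, e0) z" for z
    using that
  proof (induction rule: rtranclp_induct)
    case base
    then show ?case using e0(1) \<iota>_mem base_facet by auto
  next
    case (step y z)
    then show ?case using perspectivity_mem neighbouring_mem
      unfolding joint_step_def transported_def by auto
  qed
  then show ?thesis using e0(2) by blast
qed

lemma labelled_step: "labelled \<sigma> v e \<Longrightarrow> joint_step (\<sigma>, v, e) (\<tau>, w, e') \<Longrightarrow> labelled \<tau> w e'"
  unfolding labelled_def by (meson rtranclp.rtrancl_into_rtrancl)

text \<open>Here the monodromy hypothesis enters: going around a closed facet path produces no pairs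
  over \<sigma>0 other than those matched by \<iota>.\<close>

lemma labelled_base: "labelled \<sigma>0 v e \<longleftrightarrow> e \<in> fibre \<sigma>0 \<and> v = \<iota> e"
proof
  assume l: "labelled \<sigma>0 v e"
  then obtain e0 where e0: "e0 \<in> fibre \<sigma>0" "joint_step\<^sup>*\<^sup>* (\<sigma>0, \<iota> e0, e0) (\<sigma>0, v, e)"
    by (auto simp: labelled_def)
  obtain \<gamma> where "facet_path K \<gamma>" "hd \<gamma> = \<sigma>0" "last \<gamma> = \<sigma>0" "projectivity \<gamma> (\<iota> e0) = v" "section_chain X q sec \<gamma> e0 e" "e \<in> fibre \<sigma>0"
    using joint_step_path[OF e0(2) refl base_facet \<iota>_mem[OF e0(1)] e0(1)] by blast
  then show "e \<in> fibre \<sigma>0 \<and> v = \<iota> e" using monodromy[of \<gamma> e0 e] e0(1) by (simp add: closed_facet_paths_def)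
qed (auto simp: labelled_def)

lemma joint_step_exists:
  assumes n: "neighbouring_facets K \<sigma> \<tau>" and "v \<in> vertices \<sigma>" "e \<in> fibre \<sigma>"
  obtains e' where "joint_step (\<sigma>, v, e) (\<tau>, perspectivity \<sigma> \<tau> v, e')"
  using transported_exists[OF n assms(3)] assms(2) unfolding joint_step_def by auto

lemma facet_reachable: "\<sigma> \<in> facets K \<Longrightarrow> (neighbouring_facets K)\<^sup>*\<^sup>* \<sigma>0 \<sigma>"
  using strongly_connected_if_connected[OF connected_complex base_facet] .

lemma labelled_total:
  assumes "\<sigma> \<in> facets K"
  shows "(\<forall>v\<in>vertices \<sigma>. \<exists>e. labelled \<sigma> v e) \<and> (\<forall>e\<in>fibre \<sigma>. \<exists>v. labelled \<sigma> v e)"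
  using facet_reachable[OF assms]
proof (induction rule: rtranclp_induct)
  case base
  have "\<exists>e. labelled \<sigma>0 v e" if "v \<in> vertices \<sigma>0" for v
    using that bij unfolding labelled_base bij_betw_def by (metis imageE)
  then show ?case unfolding labelled_base by blast
next
  case (step \<sigma> \<tau>)
  note n = step(2) and n' = neighbouring_sym[OF step(2)]
  show ?case
  proof (intro conjI ballI)
    fix w assume w: "w \<in> vertices \<tau>"
    define v where "v = perspectivity \<tau> \<sigma> w"
    have v: "v \<in> vertices \<sigma>" "perspectivity \<sigma> \<tau> v = w"
      unfolding v_def using perspectivity_mem[OF n' w] perspectivity_inv[OF n' w] by auto
    obtain e where e: "labelled \<sigma> v e" using step(3) v by blast
    obtain e' where "joint_step (\<sigma>, v, e) (\<tau>, perspectivity \<sigma> \<tau> v, e')"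
      using joint_step_exists[OF n v(1)] labelled_mem[OF e] by blast
    then show "\<exists>e. labelled \<tau> w e" using labelled_step[OF e] v by auto
  next
    fix e' assume e': "e' \<in> fibre \<tau>"
    obtain e where t: "transported \<tau> e' \<sigma> e" using transported_exists[OF n' e'] .
    then have "e \<in> fibre \<sigma>" by (simp add: transported_def)
    then obtain v where v: "labelled \<sigma> v e" using step(3) by blast
    then have "joint_step (\<sigma>, v, e) (\<tau>, perspectivity \<sigma> \<tau> v, e')"
      using labelled_mem[OF v] transported_sym[OF t] by (simp add: joint_step_def)
    then show "\<exists>v. labelled \<tau> v e'" using labelled_step[OF v] by blast
  qed
qed

text \<open>Perspectivity and transport are both reversible, so two pairs over \<tau> are compared
  after crossing the ridge back to \<sigma>, one step nearer to \<sigma>0.\<close>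

lemma labelled_unique:
  assumes "\<sigma> \<in> facets K"
  shows "\<forall>v e v' e'. labelled \<sigma> v e \<longrightarrow> labelled \<sigma> v' e' \<longrightarrow> (v = v' \<longleftrightarrow> e = e')"
  using facet_reachable[OF assms]
proof (induction rule: rtranclp_induct)
  case base
  then show ?case unfolding labelled_base using bij by (auto simp: bij_betw_def inj_on_def)
next
  case (step \<sigma> \<tau>)
  note n = step(2) and n' = neighbouring_sym[OF step(2)]
  show ?case
  proof (intro allI impI)
    fix w e w' e' assume l: "labelled \<tau> w e" "labelled \<tau> w' e'"
    have m: "w \<in> vertices \<tau>" "w' \<in> vertices \<tau>" "e \<in> fibre \<tau>" "e' \<in> fibre \<tau>" using labelled_mem l by auto
    obtain a where a: "joint_step (\<tau>, w, e) (\<sigma>, perspectivity \<tau> \<sigma> w, a)" using joint_step_exists[OF n' m(1,3)] .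
    obtain a' where a': "joint_step (\<tau>, w', e') (\<sigma>, perspectivity \<tau> \<sigma> w', a')" using joint_step_exists[OF n' m(2,4)] .
    have "perspectivity \<tau> \<sigma> w = perspectivity \<tau> \<sigma> w' \<longleftrightarrow> a = a'"
      using step(3) labelled_step[OF l(1) a] labelled_step[OF l(2) a'] by blast
    moreover have "perspectivity \<tau> \<sigma> w = perspectivity \<tau> \<sigma> w' \<longleftrightarrow> w = w'"
      using perspectivity_inv[OF n'] m by metis
    moreover have t: "transported \<tau> e \<sigma> a" "transported \<tau> e' \<sigma> a'" using a a' by (auto simp: joint_step_def)
    then have "a = a' \<longleftrightarrow> e = e'" using transported_unique transported_sym by metis
    ultimately show "w = w' \<longleftrightarrow> e = e'" by blast
  qed
qed

definition lab where "lab \<sigma> v = (THE e. labelled \<sigma> v e)"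

lemma lab: "\<sigma> \<in> facets K \<Longrightarrow> v \<in> vertices \<sigma> \<Longrightarrow> labelled \<sigma> v (lab \<sigma> v)"
  unfolding lab_def using labelled_total labelled_unique by (metis theI)

section \<open>The labelled sections and the comparison map\<close>

definition F where "F \<sigma> v = sec \<sigma> (lab \<sigma> v)"

lemma F_section: "\<sigma> \<in> facets K \<Longrightarrow> v \<in> vertices \<sigma> \<Longrightarrow> section_over X q \<sigma> (F \<sigma> v)"
  unfolding F_def using sec(1) lab labelled_mem by blast

lemma F_inj:
  assumes "\<sigma> \<in> facets K" "v \<in> vertices \<sigma>" "w \<in> vertices \<sigma>" "y \<in> \<sigma>" "y \<in> Y" "F \<sigma> v y = F \<sigma> w y"
  shows "v = w"
proof -
  have l: "labelled \<sigma> v (lab \<sigma> v)" "labelled \<sigma> w (lab \<sigma> w)" using lab assms by auto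
  then have "lab \<sigma> v = lab \<sigma> w" using sec_inj[OF assms(1) _ _ assms(4,5)] labelled_mem assms(6) unfolding F_def by blast
  then show ?thesis using labelled_unique[OF assms(1)] l by blast
qed

lemma F_surj:
  assumes "\<sigma> \<in> facets K" "x \<in> topspace X" "q x \<in> \<sigma>" "q x \<in> Y"
  obtains v where "v \<in> vertices \<sigma>" "F \<sigma> v (q x) = x"
proof -
  obtain s where s: "section_over X q \<sigma> s" "s (q x) = x" using section_exists[OF assms] .
  note t = section_is_sec[OF assms(1) s(1)]
  obtain v where v: "labelled \<sigma> v (s (barycenter \<sigma>))" using labelled_total[OF assms(1)] t(1) by blast
  have vm: "v \<in> vertices \<sigma>" using labelled_mem[OF v] by blast
  have "lab \<sigma> v = s (barycenter \<sigma>)" using labelled_unique[OF assms(1)] v lab[OF assms(1) vm] by blast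
  then have "F \<sigma> v (q x) = x" unfolding F_def using t(2)[OF assms(3)] s(2) by simp
  then show thesis using vm that by blast
qed

text \<open>The fibre point matched with the image vertex is unique, so it is the one reached by
  crossing the ridge together with \<open>v\<close>; \<open>transported_ridge\<close> then compares
  the sections.\<close>

lemma F_ridge:
  assumes n: "neighbouring_facets K \<sigma> \<tau>" and v: "v \<in> vertices \<sigma>" and z: "z \<in> \<sigma>" "z \<in> \<tau>"
  shows "F \<sigma> v z = F \<tau> (perspectivity \<sigma> \<tau> v) z"
proof -
  have st: "\<sigma> \<in> facets K" "\<tau> \<in> facets K" using neighbouring_mem[OF n] by auto
  have l: "labelled \<sigma> v (lab \<sigma> v)" using lab[OF st(1) v] .
  obtain e' where e': "joint_step (\<sigma>, v, lab \<sigma> v) (\<tau>, perspectivity \<sigma> \<tau> v, e')"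
    using joint_step_exists[OF n v] labelled_mem[OF l] by blast
  have "lab \<tau> (perspectivity \<sigma> \<tau> v) = e'"
    using labelled_unique[OF st(2)] labelled_step[OF l e'] lab[OF st(2) perspectivity_mem[OF n v]] by blast
  moreover have "transported \<sigma> (lab \<sigma> v) \<tau> e'" using e' by (simp add: joint_step_def)
  ultimately show ?thesis using transported_ridge[OF _ z] unfolding F_def by metis
qed

lemma F_glued:
  assumes "(((\<sigma>, v), x), ((\<tau>, w), y)) \<in> glued" "\<sigma> \<in> facets K" "v \<in> vertices \<sigma>" "x \<in> \<sigma>"
  shows "F \<tau> w x = F \<sigma> v x"
proof -
  have "F \<tau> w x = F \<sigma> v x \<and> \<tau> \<in> facets K \<and> w \<in> vertices \<tau> \<and> x \<in> \<tau> \<and> y = x"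
    using assms
  proof (induction rule: glued_induct)
    case base
    then show ?case by simp
  next
    case (step \<rho> u \<rho>')
    then show ?case using F_ridge by metis
  qed
  then show ?thesis by blast
qed

definition \<Phi> where "\<Phi> P = (THE x. \<exists>\<sigma> v z. \<sigma> \<in> facets K \<and> v \<in> vertices \<sigma> \<and> z \<in> \<sigma> \<and> P = sheet \<sigma> v z \<and> x = F \<sigma> v z)"

lemma \<Phi>_sheet:
  assumes s: "\<sigma> \<in> facets K" "v \<in> vertices \<sigma>" "z \<in> \<sigma>"
  shows "\<Phi> (sheet \<sigma> v z) = F \<sigma> v z"
  unfolding \<Phi>_def
proof (rule the_equality)
  fix x assume "\<exists>\<sigma>' v' z'. \<sigma>' \<in> facets K \<and> v' \<in> vertices \<sigma>' \<and> z' \<in> \<sigma>' \<and> sheet \<sigma> v z = sheet \<sigma>' v' z' \<and> x = F \<sigma>' v' z'"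
  then obtain \<sigma>' v' z' where *: "(((\<sigma>, v), z), ((\<sigma>', v'), z')) \<in> glued" "x = F \<sigma>' v' z'"
    unfolding sheet_eq_iff by blast
  then show "x = F \<sigma> v z" using F_glued[OF *(1) s] glued_dest(4)[OF *(1) s] by simp
qed (use s in blast)

lemma continuous_\<Phi>: "continuous_map (partial_unfolding K) X \<Phi>"
proof (rule continuous_from_unfolding)
  fix \<sigma> v assume s: "\<sigma> \<in> facets K" "v \<in> vertices \<sigma>"
  show "continuous_map (top_of_set \<sigma>) X (\<lambda>x. \<Phi> (sheet \<sigma> v x))"
    by (rule continuous_map_eq[of _ _ "F \<sigma> v"]) (use F_section[OF s] \<Phi>_sheet[OF s] in \<open>auto simp: section_over_def\<close>)
qed

lemma \<Phi>_projection: "P \<in> topspace (partial_unfolding K) \<Longrightarrow> q (\<Phi> P) = unfolding_map P"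
  unfolding topspace_unfolding using \<Phi>_sheet unfolding_map_sheet section_over_range[OF F_section] by auto

lemma q_mem: "x \<in> topspace X \<Longrightarrow> q x \<in> \<Union>K"
  using continuous_q by (auto simp: continuous_map_def)

text \<open>The sections reach every unbranched point. As the image of a compact space in a
  Hausdorff space, the image of \<Phi> is closed, so it contains the closure of the dense set
  \<open>X0\<close>.\<close>

lemma \<Phi>_surj: "\<Phi> ` topspace (partial_unfolding K) = topspace X"
proof
  let ?I = "\<Phi> ` topspace (partial_unfolding K)"
  show "?I \<subseteq> topspace X" using continuous_\<Phi> by (auto simp: continuous_map_def)
  have "compactin X ?I"
    by (rule image_compactin[OF _ continuous_\<Phi>]) (use compact_unfolding in \<open>simp add: compact_space_def\<close>)
  then have cl: "closedin X ?I" using Hausdorff_X compactin_imp_closedin by blast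
  have "X0 \<subseteq> ?I"
  proof
    fix x assume "x \<in> X0"
    then have x: "x \<in> topspace X" "q x \<in> Y" by (auto simp: preimage_in_def)
    obtain \<sigma> where s: "\<sigma> \<in> facets K" "q x \<in> \<sigma>" using facet_at[OF q_mem[OF x(1)]] by blast
    obtain v where "v \<in> vertices \<sigma>" "F \<sigma> v (q x) = x" using F_surj[OF s(1) x(1) s(2) x(2)] .
    then show "x \<in> ?I" using \<Phi>_sheet s sheet_mem by (metis imageI)
  qed
  then have "X closure_of X0 \<subseteq> ?I" using cl by (rule closure_of_minimal)
  then show "topspace X \<subseteq> ?I" using dense_X0 by simp
qed

text \<open>Sheets meeting at a point over \<open>y\<close> are compared in the component \<open>C\<close> of the preimage of the
  open star of \<open>y\<close>. Its unbranched part stays connected, whereas it is the union of two closed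
  sets, formed by the sheets that are respectively are not glued to \<open>(\<sigma>, v)\<close> around \<open>y\<close>;
  off the branching set these are disjoint.\<close>

lemma F_eq_imp_glued:
  assumes s: "\<sigma> \<in> facets K" "v \<in> vertices \<sigma>" "y \<in> \<sigma>" and t: "\<tau> \<in> facets K" "w \<in> vertices \<tau>" "y \<in> \<tau>"
    and eq: "F \<sigma> v y = F \<tau> w y"
  shows "(((\<sigma>, v), y), ((\<tau>, w), y)) \<in> glued"
proof (rule ccontr)
  assume no: "(((\<sigma>, v), y), ((\<tau>, w), y)) \<notin> glued"
  define W where "W = \<Union>K - \<Union>{g \<in> K. y \<notin> g}"
  have W: "openin (top_of_set (\<Union>K)) W" unfolding W_def by (rule openin_open_star)
  have Wm: "y \<in> \<rho>" if "z \<in> W" "\<rho> \<in> facets K" "z \<in> \<rho>" for z \<rho>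
    using that facets_mem unfolding W_def by blast
  have yW: "y \<in> W" using s facets_mem by (auto simp: W_def)
  define x where "x = F \<sigma> v y"
  have x: "x \<in> topspace X" "q x = y" using section_over_range[OF F_section[OF s(1,2)] s(3)] by (auto simp: x_def)
  obtain C where C: "C \<in> connected_components_of (subtopology X (preimage_in X q W))" "x \<in> C"
    using ex_component_superset[of X "{x}" "preimage_in X q W"] x yW by (auto simp: preimage_in_def connectedin_sing)
  note Cp = component_preimage_open[OF spread_q W C(1)]
  have con: "connectedin X (C \<inter> X0)" by (rule connectedin_Int_dense[OF locally_connected_X0 dense_X0 Cp(1,2)])
  define A where "A = {(\<rho>, u). \<rho> \<in> facets K \<and> u \<in> vertices \<rho> \<and> (((\<sigma>, v), y), ((\<rho>, u), y)) \<in> glued}"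
  define B where "B = {(\<rho>, u). \<rho> \<in> facets K \<and> u \<in> vertices \<rho> \<and> (((\<sigma>, v), y), ((\<rho>, u), y)) \<notin> glued}"
  define im where "im S = (\<Union>(\<rho>, u)\<in>S. F \<rho> u ` \<rho>)" for S
  have fin: "finite (Sigma (facets K) vertices)" using finite_facets simplex_vertices(1)[OF facets_mem] by blast
  have AB: "A \<subseteq> Sigma (facets K) vertices" "B \<subseteq> Sigma (facets K) vertices" by (auto simp: A_def B_def)
  have cl: "closedin X (im S)" if S: "S \<subseteq> Sigma (facets K) vertices" for S
    unfolding im_def
  proof (rule closedin_Union)
    show "finite ((\<lambda>(\<rho>, u). F \<rho> u ` \<rho>) ` S)" using fin S finite_subset by blast
    fix T assume "T \<in> (\<lambda>(\<rho>, u). F \<rho> u ` \<rho>) ` S"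
    then obtain i where i: "i \<in> S" "T = (\<lambda>(\<rho>, u). F \<rho> u ` \<rho>) i" by blast
    obtain \<rho> u where "i = (\<rho>, u)" by (cases i)
    then have T: "T = F \<rho> u ` \<rho>" "\<rho> \<in> facets K" "u \<in> vertices \<rho>" using S i by auto
    have "compactin (top_of_set \<rho>) \<rho>" using compact_face[OF facets_mem[OF T(2)]] by (simp add: compactin_subtopology)
    then have "compactin X (F \<rho> u ` \<rho>)"
      using image_compactin F_section[OF T(2,3)] unfolding section_over_def by blast
    then show "closedin X T" using T(1) Hausdorff_X compactin_imp_closedin by blast
  qed
  have cover: "C \<inter> X0 \<subseteq> im A \<union> im B"
  proof
    fix a assume "a \<in> C \<inter> X0"
    then have a: "a \<in> topspace X" "q a \<in> Y" by (auto simp: preimage_in_def)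
    obtain \<rho> where r: "\<rho> \<in> facets K" "q a \<in> \<rho>" using facet_at[OF q_mem[OF a(1)]] by blast
    obtain u where u: "u \<in> vertices \<rho>" "F \<rho> u (q a) = a" using F_surj[OF r(1) a(1) r(2) a(2)] .
    then have "a \<in> F \<rho> u ` \<rho>" using r by force
    moreover have "(\<rho>, u) \<in> A \<union> B" using r u by (auto simp: A_def B_def)
    ultimately show "a \<in> im A \<union> im B" unfolding im_def by blast
  qed
  \<comment> \<open>At a common point over \<open>z\<close>, the copy of \<rho> is carried by gluing
    over \<open>z\<close> to a copy of \<rho>'. Since \<open>z\<close> is not odd,
    \<open>F_inj\<close> identifies this copy with the one from \<open>B\<close>, and
    \<open>glued_move\<close> takes the gluing from \<open>z\<close> back to \<open>y\<close>: a
    contradiction.\<close>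
  have disj: "im A \<inter> im B \<inter> (C \<inter> X0) = {}"
  proof (rule ccontr)
    assume "im A \<inter> im B \<inter> (C \<inter> X0) \<noteq> {}"
    then obtain a where a: "a \<in> im A" "a \<in> im B" "a \<in> C" "a \<in> X0" by blast
    have qa: "q a \<in> W" "q a \<in> Y" using a Cp(3) by (auto simp: preimage_in_def)
    obtain \<rho> u z where r: "\<rho> \<in> facets K" "u \<in> vertices \<rho>" "z \<in> \<rho>" "a = F \<rho> u z" "(((\<sigma>, v), y), ((\<rho>, u), y)) \<in> glued"
      using a(1) unfolding im_def A_def by blast
    obtain \<rho>' u' z' where r': "\<rho>' \<in> facets K" "u' \<in> vertices \<rho>'" "z' \<in> \<rho>'" "a = F \<rho>' u' z'" "(((\<sigma>, v), y), ((\<rho>', u'), y)) \<notin> glued"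
      using a(2) unfolding im_def B_def by blast
    have "q a = z" using section_over_range[OF F_section[OF r(1,2)] r(3)] r(4) by metis
    moreover have "q a = z'" using section_over_range[OF F_section[OF r'(1,2)] r'(3)] r'(4) by metis
    ultimately have z: "z \<in> W" "z \<in> Y" "z \<in> \<rho>'" "F \<rho> u z = F \<rho>' u' z" using qa r(4) r'(3,4) by auto
    obtain u1 where u1: "u1 \<in> vertices \<rho>'" "(((\<rho>, u), z), ((\<rho>', u1), z)) \<in> glued"
      by (rule glued_transport[OF r(1) r'(1) r(3) z(3) r(2)])
    have "F \<rho>' u1 z = F \<rho>' u' z" using F_glued[OF u1(2) r(1-3)] z(4) by metis
    then have "u1 = u'" by (rule F_inj[OF r'(1) u1(1) r'(2) z(3,2)])
    then have "(((\<rho>, u), y), ((\<rho>', u'), y)) \<in> glued"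
      using glued_move[OF u1(2) r(1-3), of y] Wm[OF z(1)] by blast
    then show False using r(5) r'(5) glued_trans by blast
  qed
  \<comment> \<open>The point \<open>x\<close> itself may be a branch point; but relative interior
    points of the facet near \<open>y\<close> are not odd, and continuity keeps the sheet over them
    inside the open set \<open>C\<close>.\<close>
  have meets: "F \<rho> u ` \<rho> \<inter> (C \<inter> X0) \<noteq> {}" if r: "\<rho> \<in> facets K" "u \<in> vertices \<rho>" "y \<in> \<rho>" "F \<rho> u y = x" for \<rho> u
  proof -
    have so: "continuous_map (top_of_set \<rho>) X (F \<rho> u)" using F_section[OF r(1,2)] by (simp add: section_over_def)
    have CX: "openin (top_of_set \<rho>) {z \<in> topspace (top_of_set \<rho>). F \<rho> u z \<in> C}"
      by (rule openin_continuous_map_preimage[OF so Cp(1)])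
    then obtain e where e: "e > 0" "ball y e \<inter> \<rho> \<subseteq> {z \<in> topspace (top_of_set \<rho>). F \<rho> u z \<in> C}"
      using r C(2) unfolding openin_contains_ball by auto
    have "y \<in> closure (rel_interior \<rho>)"
      using convex_closure_rel_interior[OF convex_face[OF facets_mem[OF r(1)]]] r(3) closure_subset by blast
    then obtain z where z: "z \<in> rel_interior \<rho>" "dist z y < e" using e(1) closure_approachable by blast
    have zr: "z \<in> \<rho>" "z \<in> Y" using z rel_interior_subset facet_rel_interior[OF r(1)] by blast+
    then have "F \<rho> u z \<in> C" using e z by (auto simp: dist_commute)
    moreover have "F \<rho> u z \<in> X0" using section_over_range[OF F_section[OF r(1,2)] zr(1)] zr(2) by (simp add: preimage_in_def)
    ultimately show ?thesis using zr by blast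
  qed
  have "(\<sigma>, v) \<in> A" "(\<tau>, w) \<in> B" using s t no by (auto simp: A_def B_def)
  then have "F \<sigma> v ` \<sigma> \<subseteq> im A" "F \<tau> w ` \<tau> \<subseteq> im B" unfolding im_def by blast+
  moreover have "F \<sigma> v ` \<sigma> \<inter> (C \<inter> X0) \<noteq> {}" "F \<tau> w ` \<tau> \<inter> (C \<inter> X0) \<noteq> {}"
    using meets[OF s] meets[OF t] eq unfolding x_def by metis+
  ultimately have ne: "im A \<inter> (C \<inter> X0) \<noteq> {}" "im B \<inter> (C \<inter> X0) \<noteq> {}" by blast+
  have "\<exists>E1 E2. closedin X E1 \<and> closedin X E2 \<and> C \<inter> X0 \<subseteq> E1 \<union> E2 \<and> E1 \<inter> E2 \<inter> (C \<inter> X0) = {} \<and>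
      E1 \<inter> (C \<inter> X0) \<noteq> {} \<and> E2 \<inter> (C \<inter> X0) \<noteq> {}"
    by (intro exI[of _ "im A"] exI[of _ "im B"] conjI cl AB cover disj ne)
  with con show False unfolding connectedin_closedin by (elim conjE notE)
qed

lemma \<Phi>_inj: "inj_on \<Phi> (topspace (partial_unfolding K))"
proof (rule inj_onI)
  fix P P' assume P: "P \<in> topspace (partial_unfolding K)" and P': "P' \<in> topspace (partial_unfolding K)" and eq: "\<Phi> P = \<Phi> P'"
  obtain \<sigma> v z where s: "\<sigma> \<in> facets K" "v \<in> vertices \<sigma>" "z \<in> \<sigma>" "P = sheet \<sigma> v z" using P unfolding topspace_unfolding by blast
  obtain \<tau> w z' where t: "\<tau> \<in> facets K" "w \<in> vertices \<tau>" "z' \<in> \<tau>" "P' = sheet \<tau> w z'" using P' unfolding topspace_unfolding by blast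
  have F: "F \<sigma> v z = F \<tau> w z'" using eq \<Phi>_sheet[OF s(1-3)] \<Phi>_sheet[OF t(1-3)] s(4) t(4) by simp
  have "z = z'" using section_over_range[OF F_section[OF s(1,2)] s(3)] section_over_range[OF F_section[OF t(1,2)] t(3)] F by simp
  then show "P = P'" using F_eq_imp_glued[OF s(1-3) t(1,2)] t(3) F s(4) t(4) sheet_eq_iff by metis
qed

lemma unfolding_cover_iso: "cover_iso (partial_unfolding K) (top_of_set (\<Union>K)) unfolding_map X (top_of_set (\<Union>K)) q \<Phi> id"
  unfolding cover_iso_def
proof (intro conjI ballI)
  show "homeomorphic_map (partial_unfolding K) X \<Phi>"
    by (rule continuous_imp_homeomorphic_map[OF continuous_\<Phi> compact_unfolding Hausdorff_X \<Phi>_surj \<Phi>_inj])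
  show "unfolding_map \<in> topspace (partial_unfolding K) \<rightarrow> topspace (top_of_set (\<Union>K))"
    using continuous_unfolding_map by (simp add: continuous_map_def)
qed (use \<Phi>_projection in auto)

end

theorem theorem1p7:
  fixes K :: "'a::euclidean_space set set"
    and X :: "'x topology" and Z :: "'z topology"
    and r :: "'x \<Rightarrow> 'z" and \<phi> :: "'z \<Rightarrow> 'a" and \<iota> :: "'x \<Rightarrow> 'a"
    and z0 :: 'z and \<sigma>0 :: "'a set" and n :: nat and c :: int
  assumes complex: "simplicial_complex K"
    and c: "c = 2 \<or> c = 3"
    and nice: "nice_complex c K"
    and manifold: "topological_manifold n Z" "connected_space Z"
    and simple: "simple_branched_cover n X Z r"
    and pair_homeo: "homeomorphic_map Z (top_of_set (\<Union>K)) \<phi>"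
      "\<phi> ` branching_set X Z r = \<Union>(odd_subcomplex K)"
    and base: "z0 \<in> topspace Z - branching_set X Z r" "\<sigma>0 \<in> facets K" "\<phi> z0 = barycenter \<sigma>0"
    and bij: "bij_betw \<iota> (preimage_in X r {z0}) (vertices \<sigma>0)"
    and induced_iso: "conjugate_perm (preimage_in X r {z0}) (vertices \<sigma>0) \<iota>
          \<in> iso (monodromy_group X Z r z0) (projectivity_group K \<sigma>0)"
    and commutes: "\<And>a. a \<in> fundamental_group (unbranched_part X Z r) z0 \<Longrightarrow>
          conjugate_perm (preimage_in X r {z0}) (vertices \<sigma>0) \<iota> (monodromy X r z0 a) =
          projectivity_hom K \<sigma>0 (induced_on_loops (odd_complement K) (\<phi> z0) \<phi> a)"
  shows "equivalent_branched_covers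
           (partial_unfolding K) (top_of_set (\<Union>K)) unfolding_map X Z r
         \<and> partial_unfolding K homeomorphic_space X"
proof -
  let ?K = "top_of_set (\<Union>K)"
  have "\<phi> z0 \<in> \<Union>K"
    using base(1) homeomorphic_imp_surjective_map[OF pair_homeo(1)] by auto
  then have nonempty: "\<Union>K \<noteq> {}" by blast
  have "connected_space ?K"
    using manifold(2) homeomorphic_connected_space[OF homeomorphic_map_imp_homeomorphic_space[OF pair_homeo(1)]] by blast
  then have con: "connected (\<Union>K)"
    using connectedin_iff_connected[of "\<Union>K"] by (simp add: connectedin_def)
  have links: "simply_connected (\<Union>(link K f))" if "f \<in> K" "f \<noteq> {}" "codim K f \<ge> 3" for f
    using nice c that by (auto simp: nice_complex_def)
  \<comment> \<open>\<open>X\<close> becomes a cover of |K| itself, compared with \<open>r\<close>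
    by the identity above and the inverse \<psi> of \<phi> below. Its branching set is then
    literally the odd part of |K|.\<close>
  define q where "q = \<phi> \<circ> r"
  obtain \<psi> where psi: "homeomorphic_maps Z ?K \<phi> \<psi>" using pair_homeo(1) homeomorphic_map_maps by blast
  have psi_homeo: "homeomorphic_map ?K Z \<psi>" and psi_phi: "\<And>z. z \<in> topspace Z \<Longrightarrow> \<psi> (\<phi> z) = z"
    and phi_psi: "\<And>y. y \<in> \<Union>K \<Longrightarrow> \<phi> (\<psi> y) = y"
    using psi unfolding homeomorphic_maps_map by auto
  have r: "branched_cover X Z r" using simple by (simp add: simple_branched_cover_def)
  have rc: "continuous_map X Z r"
    using r by (simp add: branched_cover_def Let_def complete_spread_def spread_def)
  have phi_mem: "\<phi> z \<in> \<Union>K" if "z \<in> topspace Z" for z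
    using that homeomorphic_imp_surjective_map[OF pair_homeo(1)] by auto
  have r_mem: "r x \<in> topspace Z" if "x \<in> topspace X" for x
    using that rc by (auto simp: continuous_map_def)
  have iso: "cover_iso X ?K q X Z r id \<psi>"
    unfolding cover_iso_def q_def using psi_homeo r_mem phi_mem psi_phi by auto
  have branched_q: "branched_cover X ?K q" by (rule cover_iso_branched_cover[OF iso r])
  have branching_q: "branching_set X ?K q = \<Union>(odd_subcomplex K)"
  proof -
    have sub: "branching_set X ?K q \<subseteq> \<Union>K" using closedin_subset[OF closedin_branching_set[of ?K X q]] by simp
    have "\<phi> ` \<psi> ` branching_set X ?K q = branching_set X ?K q"
      using sub phi_psi by (force simp: image_image)
    then show ?thesis using cover_iso_branching_set[OF iso] pair_homeo(2) by simp
  qed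
  interpret cover_of_nice_complex K X q
    by unfold_locales (use complex nice nonempty con links branched_q branching_q in \<open>auto simp: nice_complex_def\<close>)
  have z0: "z0 \<in> topspace Z" "\<phi> z0 = barycenter \<sigma>0" using base by auto
  have fib: "fibre \<sigma>0 = preimage_in X r {z0}"
  proof -
    have "\<phi> (r x) = \<phi> z0 \<longleftrightarrow> r x = z0" if "x \<in> topspace X" for x
      using psi_phi[OF r_mem[OF that]] psi_phi[OF z0(1)] by metis
    then show ?thesis unfolding fibre_def preimage_in_def z0(2)[symmetric] by (auto simp: q_def)
  qed

  \<comment> \<open>The monodromy hypothesis in terms of lifted facet paths\<close>
  let ?U = "unbranched_part X Z r"
  have phi_Y: "continuous_map ?U (top_of_set Y) \<phi>"
  proof (rule continuous_map_into_subtopology)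
    have "continuous_map Z ?K \<phi>" by (rule homeomorphic_imp_continuous_map[OF pair_homeo(1)])
    then show "continuous_map ?U euclidean \<phi>"
      by (simp add: continuous_map_from_subtopology continuous_map_in_subtopology)
    show "\<phi> \<in> topspace ?U \<rightarrow> Y"
    proof
      fix z assume z: "z \<in> topspace ?U"
      then have "\<phi> z \<notin> \<phi> ` branching_set X Z r"
        using psi_phi closedin_subset[OF closedin_branching_set[of Z X r]] by (auto) (metis subsetD)
      then show "\<phi> z \<in> Y" using z phi_mem pair_homeo(2) by auto
    qed
  qed
  have psi_U: "continuous_map (top_of_set Y) ?U \<psi>"
  proof (rule continuous_map_into_subtopology)
    have "continuous_map ?K Z \<psi>" by (rule homeomorphic_imp_continuous_map[OF psi_homeo])
    then show "continuous_map (top_of_set Y) Z \<psi>"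
      by (rule continuous_map_from_subtopology_mono) blast
    then have m: "\<psi> y \<in> topspace Z" if "y \<in> Y" for y using that by (auto simp: continuous_map_def)
    show "\<psi> \<in> topspace (top_of_set Y) \<rightarrow> topspace Z - branching_set X Z r"
    proof
      fix y assume "y \<in> topspace (top_of_set Y)"
      then have y: "y \<in> Y" by simp
      have "\<psi> y \<notin> branching_set X Z r"
      proof
        assume "\<psi> y \<in> branching_set X Z r"
        then have "\<phi> (\<psi> y) \<in> \<Union>(odd_subcomplex K)" using pair_homeo(2) by blast
        then show False using y phi_psi by auto
      qed
      then show "\<psi> y \<in> topspace Z - branching_set X Z r" using m[OF y] by blast
    qed
  qed
  have cov_r: "covering_map (subtopology X (preimage_in X r (topspace Z - branching_set X Z r))) ?U r"
    using covering_off_branching_set[OF rc] by (simp add: covering_off_def)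
  \<comment> \<open>The hypothesis \<open>commutes\<close> is applied to the class of the
    barycentric loop pulled back by \<psi>; the chain of sections supplies an explicit lift of this
    loop from \<open>e\<close> to \<open>e'\<close>.\<close>
  have monodromy: "\<iota> e' = projectivity \<gamma> (\<iota> e)"
    if g: "\<gamma> \<in> closed_facet_paths K \<sigma>0" and e: "e \<in> fibre \<sigma>0" "e' \<in> fibre \<sigma>0" and ch: "section_chain X q sec \<gamma> e e'" for \<gamma> e e'
  proof -
    have p: "hd \<gamma> = \<sigma>0" "last \<gamma> = \<sigma>0" using g by (auto simp: closed_facet_paths_def)
    obtain \<alpha>' where lift: "pathin X \<alpha>'" "\<And>t. t \<in> {0..1} \<Longrightarrow> q (\<alpha>' t) = barycentric_path \<gamma> t" "\<alpha>' 0 = e" "\<alpha>' 1 = e'"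
      using section_chain_lift[OF ch] unfolding p sec(2)[OF base(2) e(1)] sec(2)[OF base(2) e(2)] by blast
    define \<alpha> where "\<alpha> = \<psi> \<circ> barycentric_path \<gamma>"
    have bl: "barycentric_path \<gamma> \<in> loops (top_of_set Y) (barycenter \<sigma>0)" by (rule barycentric_loop[OF g])
    have "\<psi> (barycenter \<sigma>0) = z0" using z0 psi_phi by metis
    moreover have "pathin ?U \<alpha>"
      using bl continuous_map_compose[OF _ psi_U] unfolding loops_def pathin_def \<alpha>_def by blast
    ultimately have \<alpha>: "\<alpha> \<in> loops ?U z0" using bl by (simp add: loops_def \<alpha>_def)
    define a where "a = loop_class ?U z0 \<alpha>"
    have a: "a \<in> fundamental_group ?U z0" "\<alpha> \<in> a"
      using \<alpha> loop_class_self by (auto simp: fundamental_group_def a_def)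
    have r_lift: "r (\<alpha>' t) = \<alpha> t" if "t \<in> {0..1}" for t
    proof -
      have "\<alpha>' t \<in> topspace X" using lift(1) that by (auto simp: pathin_def continuous_map_def)
      then have "r (\<alpha>' t) = \<psi> (q (\<alpha>' t))" using psi_phi r_mem by (simp add: q_def)
      then show ?thesis using lift(2)[OF that] by (simp add: \<alpha>_def)
    qed
    have unbranched_lift: "pathin (subtopology X (preimage_in X r (topspace Z - branching_set X Z r))) \<delta>'"
      if "\<delta> \<in> loops ?U z0" "pathin X \<delta>'" "\<And>t. t \<in> {0..1} \<Longrightarrow> r (\<delta>' t) = \<delta> t" for \<delta> \<delta>'
      using that unfolding loops_def pathin_def
      by (intro continuous_map_into_subtopology) (auto simp: preimage_in_def continuous_map_def)
    have mon: "monodromy X r z0 a e = e'"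
    proof -
      \<comment> \<open>Lifts of all representatives of the class compete in the description;
        homotopy lifting in the unbranched part shows that those starting at \<open>e\<close> all
        end at \<open>e'\<close>.\<close>
      have "(THE y. \<exists>\<alpha>\<in>a. \<exists>\<alpha>'. pathin X \<alpha>' \<and> (\<forall>t\<in>{0..1}. r (\<alpha>' t) = \<alpha> t) \<and> \<alpha>' 0 = e \<and> \<alpha>' 1 = y) = e'"
      proof (rule the_equality)
        fix y assume "\<exists>\<alpha>\<in>a. \<exists>\<alpha>'. pathin X \<alpha>' \<and> (\<forall>t\<in>{0..1}. r (\<alpha>' t) = \<alpha> t) \<and> \<alpha>' 0 = e \<and> \<alpha>' 1 = y"
        then obtain \<beta> \<beta>' where \<beta>: "\<beta> \<in> a" "pathin X \<beta>'" "\<And>t. t \<in> {0..1} \<Longrightarrow> r (\<beta>' t) = \<beta> t" "\<beta>' 0 = e" "\<beta>' 1 = y"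
          by blast
        have h: "path_homotopic ?U \<alpha> \<beta>" "\<beta> \<in> loops ?U z0" using \<beta>(1) by (auto simp: a_def loop_class_def)
        have "\<alpha>' 1 = \<beta>' 1"
          by (rule covering_lift_path_homotopic[OF cov_r h(1) unbranched_lift[OF \<alpha> lift(1) r_lift] r_lift
                unbranched_lift[OF h(2) \<beta>(2,3)] \<beta>(3)]) (use lift \<beta> in auto)
        then show "y = e'" using lift \<beta> by simp
      qed (use a(2) lift r_lift in blast)
      then show ?thesis using e(1) unfolding fib monodromy_def by simp
    qed
    \<comment> \<open>Every loop in the class \<open>a\<close> is carried by \<phi> into one and the
      same homotopy class, and \<open>a\<close> is nonempty, so the union is that class.\<close>
    have "induced_on_loops (odd_complement K) (\<phi> z0) \<phi> a =
        loop_class (odd_complement K) (barycenter \<sigma>0) (barycentric_path \<gamma>)"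
    proof -
      have "loop_class (top_of_set Y) (barycenter \<sigma>0) (\<phi> \<circ> \<beta>) =
          loop_class (top_of_set Y) (barycenter \<sigma>0) (barycentric_path \<gamma>)" if "\<beta> \<in> a" for \<beta>
      proof -
        have "path_homotopic (top_of_set Y) (\<phi> \<circ> \<alpha>) (\<phi> \<circ> \<beta>)"
          using that by (intro path_homotopic_compose[OF _ phi_Y]) (auto simp: a_def loop_class_def)
        moreover have "path_homotopic (top_of_set Y) (barycentric_path \<gamma>) (\<phi> \<circ> \<alpha>)"
        proof (rule path_homotopic_refl_on)
          show bp: "pathin (top_of_set Y) (barycentric_path \<gamma>)" using bl by (simp add: loops_def)
          fix t :: real assume "t \<in> {0..1}"
          then have "barycentric_path \<gamma> t \<in> Y" using bp by (auto simp: pathin_def)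
          then show "barycentric_path \<gamma> t = (\<phi> \<circ> \<alpha>) t" using phi_psi by (simp add: \<alpha>_def)
        qed
        ultimately show ?thesis using loop_class_eq path_homotopic_trans by metis
      qed
      then show ?thesis using a(2) unfolding induced_on_loops_def z0(2) by blast
    qed
    \<comment> \<open>Evaluating both sides at \<open>\<iota> e\<close> gives the claim: the
      conjugated permutation sends it back to \<open>e\<close>, on to \<open>e'\<close>, and then to
      \<open>\<iota> e'\<close>.\<close>
    then have "conjugate_perm (preimage_in X r {z0}) (vertices \<sigma>0) \<iota> (monodromy X r z0 a) = projectivity \<gamma>"
      using commutes[OF a(1)] projectivity_hom_eq[OF g] by simp
    moreover have "\<iota> e \<in> vertices \<sigma>0" using bij e(1) unfolding fib by (auto simp: bij_betw_def)
    moreover have "inv_into (preimage_in X r {z0}) \<iota> (\<iota> e) = e"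
      using bij e(1) unfolding fib by (auto simp: bij_betw_def)
    ultimately show ?thesis using mon unfolding conjugate_perm_def by (metis restrict_apply')
  qed
  interpret cover_with_projectivities K X q \<iota> \<sigma>0
    by unfold_locales (use base(2) bij monodromy fib in auto)
  \<comment> \<open>The comparison over |K| is combined with the change of base from |K| to
    \<open>Z\<close>: \<Phi> above and \<psi> below. All parts of the conclusion follow from this
    one square.\<close>
  have iso': "cover_iso (partial_unfolding K) ?K unfolding_map X Z r \<Phi> \<psi>"
  proof -
    have "\<Phi> P \<in> topspace X" if "P \<in> topspace (partial_unfolding K)" for P using \<Phi>_surj that by blast
    then show ?thesis using unfolding_cover_iso iso unfolding cover_iso_def by auto
  qed
  have "homeomorphic_map (partial_unfolding K) X \<Phi>" using iso' by (simp add: cover_iso_def)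
  moreover have "equivalent_branched_covers (partial_unfolding K) ?K unfolding_map X Z r"
    unfolding equivalent_branched_covers_def
    using cover_iso_branched_cover[OF iso' r] r cover_iso_branching_set[OF iso'] iso'
    unfolding cover_iso_def by blast
  ultimately show ?thesis using homeomorphic_map_imp_homeomorphic_space by blast
qed

end
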